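(* Let $g_0\in\mathbb{Q}[X,Y]$ be a non-constant quasi-homogeneous polynomial. Let $p$ be a good prime associated with $g_0$, and let $g_p$ be the image of $g_0$ in $\mathbb{F}_p[X,Y]$. If $\operatorname{fpt}(g_p)\ne\operatorname{lct}(g_0)$, then the minimal denominator of $\operatorname{fpt}(g_p)$ is of the form $kp^e$, where $e\ge 1$ and $k$ is a factor of one of the following: $\operatorname{mult}_X(g_0)\cdot\deg X$, $\operatorname{mult}_Y(g_0)\cdot\deg Y$, or $\operatorname{mult}_h(g_0)$, where $h$ is some irreducible factor (over $\mathbb{C}$) of $g_0$ other than $X$ or $Y$.
   Context: For a field $K$, $K[X,Y]$ is endowed with an $\mathbb{N}$-grading in which $\deg X=u$, $\deg Y=v$, with $u,v$ fixed natural numbers and $uv\neq 0$; quasi-homogeneous polynomials are the nonzero polynomials homogeneous for this grading. For $f\in K[X,Y]$ and an irreducible polynomial $h$ over the algebraic closure $\overline{K}$ (or over $\mathbb{C}$ when $K=\mathbb{Q}$), $\operatorname{mult}_h(f)$ is the largest $m\in\mathbb{N}$ (possibly $0$) such that $h^m$ divides $f$. A prime $p$ is a good prime associated with a non-constant quasi-homogeneous $g_0\in\mathbb{Q}[X,Y]$ if: (1) there exists a reduction modulo $p$ of $g_0$ in $\mathbb{F}_p[X,Y]$, denoted $g_p$; (2) the factorization of $g_p$ over $\overline{\mathbb{F}}_p$ is similar to the factorization of $g_0$ over $\mathbb{C}$, in the sense that those factorizations have the same number of pairwise prime irreducible factors and the same multiplicities; (3) $\operatorname{mult}_X(g_p)=\operatorname{mult}_X(g_0)$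 and $\operatorname{mult}_Y(g_p)=\operatorname{mult}_Y(g_0)$. For a polynomial $g$ vanishing at the origin over a field of characteristic $p>0$ in variables $X,Y$, the $F$-pure threshold is $\operatorname{fpt}(g)=\inf\{a/p^e : a,e\in\mathbb{N},\ g^a\in\langle X^{p^e},Y^{p^e}\rangle\}$; it is known to be rational. $\operatorname{lct}(g_0)$ is the usual log canonical threshold of $g_0$ at the origin, defined via a log resolution; it satisfies $\operatorname{lct}(g_0)=\lim_{p\to\infty}\operatorname{fpt}(g_p)$. *)

theory Defs
  imports
    Complex_Main
    "HOL-Computational_Algebra.Computational_Algebra"
    "HOL-Algebra.Algebraic_Closure_Type"
    "Berlekamp_Zassenhaus.Finite_Field"
begin

hide_const (open) Divisibility.irreducible

section \<open>Polynomials in two variables\<close>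

text \<open>
  \<open>K[X,Y]\<close> is the type \<open>'a poly poly\<close> with \<open>Y\<close> the outer variable:
  the coefficient of \<open>X ^ i * Y ^ j\<close> in \<open>f\<close> is \<open>coeff (coeff f j) i\<close>.
\<close>

definition const2 :: "'a::zero \<Rightarrow> 'a poly poly" where
  "const2 c = [:[:c:]:]"

definition varX :: "'a::comm_semiring_1 poly poly" where
  "varX = [:[:0, 1:]:]"

definition varY :: "'a::comm_semiring_1 poly poly" where
  "varY = [:0, 1:]"

definition map_poly2 :: "('a::zero \<Rightarrow> 'b::zero) \<Rightarrow> 'a poly poly \<Rightarrow> 'b poly poly" where
  "map_poly2 \<phi> = map_poly (map_poly \<phi>)"

definition value0 :: "'a::comm_semiring_1 poly poly \<Rightarrow> 'a" where
  "value0 f = poly (poly f 0) 0"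

definition subst2 :: "'a::comm_semiring_1 poly poly \<Rightarrow> 'a poly poly \<Rightarrow> 'a poly poly \<Rightarrow> 'a poly poly" where
  "subst2 f F G = (\<Sum>j\<le>degree f. \<Sum>i\<le>degree (coeff f j). const2 (coeff (coeff f j) i) * F ^ i * G ^ j)"

definition derivX :: "'a::idom poly poly \<Rightarrow> 'a poly poly" where
  "derivX = map_poly pderiv"

definition derivY :: "'a::idom poly poly \<Rightarrow> 'a poly poly" where
  "derivY = pderiv"

definition jacobian :: "'a::idom poly poly \<Rightarrow> 'a poly poly \<Rightarrow> 'a poly poly" where
  "jacobian F G = derivX F * derivY G - derivY F * derivX G"

text \<open>Homogeneity for the grading with \<open>deg X = u\<close>, \<open>deg Y = v\<close>.\<close>

definition quasi_homogeneous :: "nat \<Rightarrow> nat \<Rightarrow> 'a::zero poly poly \<Rightarrow> bool" where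
  "quasi_homogeneous u v f \<longleftrightarrow>
     f \<noteq> 0 \<and> (\<exists>d. \<forall>i j. coeff (coeff f j) i \<noteq> 0 \<longrightarrow> u * i + v * j = d)"


section \<open>Reduction modulo a prime and good primes\<close>

text \<open>
  The prime field \<open>\<F>\<^sub>p\<close> is \<open>'p mod_ring\<close> with \<open>p = CARD('p)\<close>, \<open>'p :: prime_card\<close>;
  its algebraic closure is \<open>'p mod_ring alg_closure\<close>.
\<close>

definition reducible_rat :: "'p::prime_card itself \<Rightarrow> rat \<Rightarrow> bool" where
  "reducible_rat _ q \<longleftrightarrow> \<not> int CARD('p) dvd snd (quotient_of q)"

definition reduce_rat :: "rat \<Rightarrow> 'p::prime_card mod_ring" where
  "reduce_rat q = of_int (fst (quotient_of q)) / of_int (snd (quotient_of q))"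

definition has_reduction :: "'p::prime_card itself \<Rightarrow> rat poly poly \<Rightarrow> bool" where
  "has_reduction P g \<longleftrightarrow> (\<forall>i j. reducible_rat P (coeff (coeff g j) i))"

definition reduction :: "rat poly poly \<Rightarrow> 'p::prime_card mod_ring poly poly" where
  "reduction = map_poly2 reduce_rat"

definition over_C :: "rat poly poly \<Rightarrow> complex poly poly" where
  "over_C = map_poly2 of_rat"

definition over_closure :: "'a::field poly poly \<Rightarrow> 'a alg_closure poly poly" where
  "over_closure = map_poly2 to_ac"

definition is_factorization :: "'a::field poly poly \<Rightarrow> 'a \<Rightarrow> ('a poly poly \<times> nat) list \<Rightarrow> bool" where
  "is_factorization f c hms \<longleftrightarrow>
     c \<noteq> 0 \<and> f = const2 c * (\<Prod>(h, m)\<leftarrow>hms. h ^ m) \<and>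
     (\<forall>(h, m)\<in>set hms. irreducible h \<and> m > 0) \<and>
     sorted_wrt (\<lambda>(h, _) (h', _). coprime h h') hms"

text \<open>
  The order of the factors in the lists is arbitrary, so equality of the lists of exponents
  after a suitable choice of orders means equality as multisets.
\<close>

definition similar_factorizations :: "'a::field poly poly \<Rightarrow> 'b::field poly poly \<Rightarrow> bool" where
  "similar_factorizations f g \<longleftrightarrow>
     (\<exists>c c' hms hms'. is_factorization f c hms \<and> is_factorization g c' hms' \<and>
        map snd hms = map snd hms')"

definition good_prime :: "'p::prime_card itself \<Rightarrow> rat poly poly \<Rightarrow> bool" where
  "good_prime P g0 \<longleftrightarrow>
     has_reduction P g0 \<and>
     (let g0' = over_C g0; gp' = over_closure (reduction g0 :: 'p mod_ring poly poly) in
        similar_factorizations g0' gp' \<and>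
        multiplicity varX gp' = multiplicity varX g0' \<and>
        multiplicity varY gp' = multiplicity varY g0')"


section \<open>F-pure threshold\<close>

definition in_frobenius_ideal :: "nat \<Rightarrow> 'a::field poly poly \<Rightarrow> bool" where
  "in_frobenius_ideal q f \<longleftrightarrow> (\<exists>A B. f = A * varX ^ q + B * varY ^ q)"

text \<open>Meant for \<open>g\<close> vanishing at the origin over a field of positive characteristic.\<close>

definition fpt :: "'a::field poly poly \<Rightarrow> real" where
  "fpt g = Inf {real a / real (CHAR('a) ^ e) | a e. in_frobenius_ideal (CHAR('a) ^ e) (g ^ a)}"


section \<open>Log canonical threshold at the origin of the complex plane\<close>

text \<open>
  A proper birational morphism from a smooth surface to the plane that is an isomorphism
  outside the origin is a finite composition of blow-ups of points lying over the origin.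
  Such a point (an infinitely near point of the origin) is encoded by the list of the successive
  directions in which it lies, first blow-up first; the empty list is the origin itself.  The
  exceptional curve of the blow-up of a point with local coordinates \<open>(x, y)\<close> is the projective
  line of directions through that point: \<open>Slope c\<close> is the direction of \<open>y = c * x\<close>,
  \<open>Vertical\<close> that of \<open>x = 0\<close>.
\<close>

datatype direction = Slope complex | Vertical

type_synonym near_point = "direction list"

text \<open>
  The blow-up morphism near the point of the exceptional curve with the given direction,
  in affine coordinates centred at that point.
\<close>

fun blowup_chart :: "direction \<Rightarrow> complex poly poly \<times> complex poly poly" where
  "blowup_chart (Slope c) = (varX, varX * (varY + const2 c))"
| "blowup_chart Vertical = (varX * varY, varY)"

text \<open>
  The pair of polynomials expressing the coordinates of the plane in the coordinates centred at
  an infinitely near point.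
\<close>

fun chart_map :: "near_point \<Rightarrow> complex poly poly \<times> complex poly poly" where
  "chart_map [] = (varX, varY)"
| "chart_map (d # ds) =
     (let (F, G) = chart_map ds; (A, B) = blowup_chart d in (subst2 A F G, subst2 B F G))"

definition pullback :: "complex poly poly \<Rightarrow> near_point \<Rightarrow> complex poly poly" where
  "pullback g t = (case chart_map t of (F, G) \<Rightarrow> subst2 g F G)"

text \<open>A local equation of the relative canonical divisor.\<close>

definition pullback_jacobian :: "near_point \<Rightarrow> complex poly poly" where
  "pullback_jacobian t = (case chart_map t of (F, G) \<Rightarrow> jacobian F G)"

text \<open>
  Simple normal crossings at the origin: in the local ring of the origin, \<open>f\<close> is a unit
  \<open>r / s\<close> times a monomial in a regular system of parameters \<open>a, b\<close>.
\<close>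

definition snc_at_origin :: "complex poly poly \<Rightarrow> bool" where
  "snc_at_origin f \<longleftrightarrow>
     (\<exists>a b r s m n. s * f = r * a ^ m * b ^ n \<and> value0 r \<noteq> 0 \<and> value0 s \<noteq> 0 \<and>
        value0 a = 0 \<and> value0 b = 0 \<and> value0 (jacobian a b) \<noteq> 0)"

text \<open>
  \<open>T\<close> is the set of points that are blown up.  The points over the origin of the resulting
  surface are the infinitely near points that are not blown up themselves and whose predecessors
  all are; at each of them the divisor of the pullback of \<open>g\<close> together with the
  exceptional divisor must have simple normal crossings.
\<close>

definition log_resolution :: "complex poly poly \<Rightarrow> near_point set \<Rightarrow> bool" where
  "log_resolution g T \<longleftrightarrow>
     finite T \<and> (\<forall>t d. t @ [d] \<in> T \<longrightarrow> t \<in> T) \<and>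
     (\<forall>t. t \<notin> T \<and> (t = [] \<or> butlast t \<in> T) \<longrightarrow>
        snc_at_origin (pullback g t * pullback_jacobian t))"

text \<open>
  The multiplicities along the exceptional curve created by blowing up \<open>t\<close>; this curve is
  the line \<open>x = 0\<close> in the coordinates centred at its point \<open>t @ [Slope 0]\<close>.
\<close>

definition exc_order :: "complex poly poly \<Rightarrow> near_point \<Rightarrow> nat" where
  "exc_order g t = multiplicity varX (pullback g (t @ [Slope 0]))"

definition exc_discrepancy :: "near_point \<Rightarrow> nat" where
  "exc_discrepancy t = multiplicity varX (pullback_jacobian (t @ [Slope 0]))"

text \<open>
  The minimum of \<open>(k + 1) / N\<close> over the components of the divisor of the pullback of \<open>g\<close>
  that meet the fibre over the origin, \<open>N\<close> being the multiplicity in that divisor and \<open>k\<close>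
  the one in the relative canonical divisor.  The non-exceptional components are the strict
  transforms of the irreducible components \<open>h = 0\<close> of \<open>g\<close>, for which \<open>k = 0\<close>.
\<close>

definition lct_via :: "complex poly poly \<Rightarrow> near_point set \<Rightarrow> real" where
  "lct_via g T = Min
     ({real (exc_discrepancy t + 1) / real (exc_order g t) | t. t \<in> T \<and> exc_order g t > 0} \<union>
      {1 / real (multiplicity h g) | h. irreducible h \<and> h dvd g \<and> value0 h = 0})"

text \<open>
  Meant for nonzero \<open>g\<close> vanishing at the origin.  The value does not depend on the log
  resolution.
\<close>

definition lct :: "complex poly poly \<Rightarrow> real" where
  "lct g = lct_via g (SOME T. log_resolution g T)"


section \<open>Minimal denominators\<close>

text \<open>\<open>x\<close> is rational and \<open>n\<close> is its denominator in lowest terms.\<close>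

definition is_min_denominator :: "real \<Rightarrow> nat \<Rightarrow> bool" where
  "is_min_denominator x n \<longleftrightarrow> (\<exists>q. x = of_rat q \<and> snd (quotient_of q) = int n)"

text \<open>A factor of a positive number; no number is a factor of 0 in this sense.\<close>

definition factor_of :: "nat \<Rightarrow> nat \<Rightarrow> bool" where
  "factor_of k n \<longleftrightarrow> n > 0 \<and> k dvd n"

end

theory Submission
  imports Defs
begin

text \<open>
  Over an algebraically closed field a quasi-homogeneous polynomial is, after the weights \<open>u, v\<close>
  have been divided by their greatest common divisor,
  \<open>g = c * X ^ a * Y ^ b * (\<Prod>l\<in>S. (Y ^ u - l * X ^ v) ^ m l)\<close>, and its weighted degree is
  \<open>d = u * a + v * b + u * v * (\<Sum>l\<in>S. m l)\<close>.  Call a real number \<open>L\<close> admissible if \<open>L * a\<close>,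
  \<open>L * b\<close> and all \<open>L * m l\<close> are at most \<open>1\<close> and \<open>L * d \<le> u + v\<close>.  At a good prime the
  numbers \<open>a\<close>, \<open>b\<close> and the multiset of the \<open>m l\<close> agree on both sides, so admissibility means the
  same in both characteristics.

  In characteristic 0, \<open>lct g\<close> is the greatest admissible number.  The exceptional curve of the
  monomial valuation with weights \<open>(u, v)\<close> is reached by a chain of blow-ups that follows
  Euclid's algorithm on \<open>(u, v)\<close> (\<open>toric\<close> below).  At every infinitely near point that leaves
  this chain the pullback of \<open>g\<close> and the Jacobian are units times monomials, which gives the
  lower bound at every exceptional curve and shows that the points of the chain form a log
  resolution.  An arbitrary log resolution either contains the whole chain, so that the valuation
  itself contributes \<open>(u + v) / d\<close>, or it has simple normal crossings at a point of the chain; then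
  the product of the prime factors there divides \<open>A * B\<close> for local parameters \<open>A, B\<close>, and comparing
  weighted orders gives the inequality that is needed (\<open>snc_weight_bound\<close>).

  In characteristic \<open>p\<close> the inequality \<open>fpt g \<le> L\<close> for the greatest admissible \<open>L\<close> is immediate.
  Suppose that it is strict.  Substituting \<open>s = X ^ v\<close>, \<open>t = Y ^ u\<close> turns the condition
  \<open>g ^ N \<in> (X ^ q, Y ^ q)\<close> into \<open>F \<in> (s ^ A, t ^ B)\<close>, where
  \<open>A = \<lceil>(q - a * N) / v\<rceil>\<close>, \<open>B = \<lceil>(q - b * N) / u\<rceil>\<close> and \<open>F\<close> is a product of powers of linear
  forms.  The descent lemma \<open>flanked_descent\<close> says that such a membership at level \<open>p * q\<close> comes from one at
  level \<open>q\<close>, obtained by dividing all exponents by \<open>p\<close> and rounding, as long as the degree of \<open>F\<close> is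
  smaller than \<open>A + B\<close> by a fixed margin.  Below \<open>L\<close> the margin grows with the level, so from some level \<open>q\<close>
  on membership at \<open>\<tau> = N / q'\<close> depends only on the roundings of \<open>m l * \<tau> * q\<close>,
  \<open>q * (1 - a * \<tau>) / v\<close> and \<open>q * (1 - b * \<tau>) / u\<close>.  This has two consequences for \<open>\<tau> = fpt g\<close>.
  Being the place where membership starts, \<open>\<tau>\<close> must be a point where one of the roundings jumps; hence
  \<open>M * \<tau> * q\<close> is an integer for some \<open>M\<close> among \<open>a\<close>, \<open>b\<close> and the \<open>m l\<close>
  (\<open>Inf_ratios_integrality\<close>).  And if \<open>p\<close> did not
  divide the denominator of \<open>\<tau>\<close>, then \<open>N = (q - 1) * \<tau>\<close> would be an integer for suitable \<open>q\<close>, all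
  roundings at \<open>N / q\<close> and at \<open>\<tau>\<close> would agree because \<open>\<tau> * a\<close>, \<open>\<tau> * b\<close> and \<open>\<tau> * m l\<close> are less
  than \<open>1\<close>, and \<open>N / q < \<tau>\<close> would already be a member.  Together the two facts are the claim
  (\<open>Inf_ratios_denominator\<close>).
\<close>

section \<open>Substitution and differentiation in two variables\<close>

lemma poly_as_sum_of_coeffs_upto:
  fixes x :: "'a::comm_semiring_1"
  assumes "degree p \<le> n"
  shows "poly p x = (\<Sum>i\<le>n. coeff p i * x ^ i)"
  unfolding poly_altdef
  by (intro sum.mono_neutral_left ballI) (use assms in \<open>auto simp: not_le coeff_eq_0\<close>)

lemma const2_hom [simp]:
  "const2 0 = 0" "const2 1 = 1" "const2 (a + b) = const2 a + const2 b"
  "const2 (a * b) = const2 a * const2 b"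
  for a b :: "'a::comm_semiring_1"
  by (simp_all add: const2_def one_pCons)

lemma const2_uminus [simp]: "const2 (- a) = - const2 a" for a :: "'a::comm_ring_1"
  by (simp add: const2_def)

lemma const2_diff [simp]: "const2 (a - b) = const2 a - const2 b" for a :: "'a::comm_ring_1"
  by (simp add: const2_def)

lemma const2_power [simp]: "const2 (a ^ n) = const2 a ^ n" for a :: "'a::comm_semiring_1"
  by (induction n) simp_all

lemma const2_eq_0_iff [simp]: "const2 a = 0 \<longleftrightarrow> a = 0"
  by (simp add: const2_def)

text \<open>
  All identities about substitution and derivatives below hold because both sides behave in the same
  way under sums and products; this rule reduces them to constants and the two variables.
\<close>

lemma bivariate_induct [case_names const varX varY add mult]:
  fixes f :: "'a::comm_semiring_1 poly poly"
  assumes "\<And>c. P (const2 c)" "P varX" "P varY"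
    and add: "\<And>f g. P f \<Longrightarrow> P g \<Longrightarrow> P (f + g)" and mult: "\<And>f g. P f \<Longrightarrow> P g \<Longrightarrow> P (f * g)"
  shows "P f"
proof (induction f rule: pCons_induct)
  case 0
  show ?case using assms(1)[of 0] by simp
next
  case (pCons q f)
  have "P [:q:]"
  proof (induction q rule: pCons_induct)
    case 0
    show ?case using assms(1)[of 0] by simp
  next
    case (pCons a q)
    have "[:pCons a q:] = const2 a + varX * [:q:]"
      by (simp add: const2_def varX_def)
    thus ?case
      by (simp only:) (intro add mult assms pCons)
  qed
  moreover have "pCons q f = [:q:] + varY * f"
    by (simp add: varY_def)
  ultimately show ?case
    using pCons.IH assms(3) add mult by simp
qed

lemma monomial_conv_monom:
  "const2 c * varX ^ i * varY ^ j = monom (monom c i) j" for c :: "'a::comm_semiring_1"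
proof -
  have "const2 c * varX ^ i = [:monom c i:]" for c :: 'a and i
    by (induction i) (simp_all add: const2_def varX_def monom_0 monom_Suc mult_ac)
  moreover have "[:q:] * varY ^ j = monom q j" for q :: "'a poly" and j
    by (induction j) (simp_all add: varY_def monom_0 monom_Suc mult_ac)
  ultimately show ?thesis by simp
qed

lemma map_poly_add_hom:
  assumes "h 0 = 0" "\<And>a b. h (a + b) = h a + h b"
  shows "map_poly h (p + q) = map_poly h p + map_poly h q"
  by (rule poly_eqI) (simp add: coeff_map_poly assms)

lemma map_poly_mult_hom:
  fixes h :: "'a::comm_semiring_1 \<Rightarrow> 'b::comm_semiring_1"
  assumes "h 0 = 0" "\<And>a b. h (a + b) = h a + h b" "\<And>a b. h (a * b) = h a * h b"
  shows "map_poly h (p * q) = map_poly h p * map_poly h q"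
proof (induction p)
  case (pCons a p)
  have "map_poly h (smult a q) = smult (h a) (map_poly h q)"
    by (rule poly_eqI) (simp add: coeff_map_poly assms)
  with pCons show ?case
    by (simp add: map_poly_add_hom[of h, OF assms(1,2)] Polynomial.map_poly_pCons assms(1))
qed (simp add: assms)

text \<open>
  The double sum that defines substitution is an iterated Horner evaluation; in that form it is a ring
  homomorphism for general reasons.
\<close>

lemma subst2_conv_poly:
  "subst2 f F G = poly (map_poly (\<lambda>q. poly (map_poly const2 q) F) f) G"
proof -
  have inner: "poly (map_poly const2 q) F = (\<Sum>i\<le>degree q. const2 (coeff q i) * F ^ i)" for q
    by (subst poly_as_sum_of_coeffs_upto[OF degree_map_poly_le]) (simp add: coeff_map_poly)
  show ?thesis
    unfolding subst2_def
    by (subst poly_as_sum_of_coeffs_upto[OF degree_map_poly_le])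
       (simp add: coeff_map_poly inner sum_distrib_right)
qed

lemma subst2_hom [simp]:
  fixes f g F G :: "'a::comm_semiring_1 poly poly"
  shows "subst2 (f + g) F G = subst2 f F G + subst2 g F G"
    and "subst2 (f * g) F G = subst2 f F G * subst2 g F G"
    and "subst2 (const2 c) F G = const2 c"
    and "subst2 varX F G = F"
    and "subst2 varY F G = G"
proof -
  define h where "h = (\<lambda>q. poly (map_poly const2 q) F)"
  have h: "h 0 = 0" "\<And>a b. h (a + b) = h a + h b" "\<And>a b. h (a * b) = h a * h b"
    by (simp_all add: h_def map_poly_add_hom map_poly_mult_hom)
  have h_const: "h [:c:] = const2 c" for c
    by (simp add: h_def Polynomial.map_poly_pCons)
  have h1: "h 1 = 1"
    using h_const[of 1] by (simp add: one_pCons)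
  have hX: "h [:0, 1:] = F"
    by (simp add: h_def Polynomial.map_poly_pCons)
  show "subst2 (f + g) F G = subst2 f F G + subst2 g F G"
    using map_poly_add_hom[of h, OF h(1,2)] by (simp add: subst2_conv_poly flip: h_def)
  show "subst2 (f * g) F G = subst2 f F G * subst2 g F G"
    using map_poly_mult_hom[of h, OF h] by (simp add: subst2_conv_poly flip: h_def)
  show "subst2 (const2 c) F G = const2 c" "subst2 varX F G = F" "subst2 varY F G = G"
    by (simp_all add: subst2_conv_poly const2_def[of c] varX_def varY_def Polynomial.map_poly_pCons h h1
        hX h_const flip: h_def)
qed

lemma subst2_0 [simp]: "subst2 0 F G = 0" and subst2_1 [simp]: "subst2 1 F G = 1"
  using subst2_hom(3)[of 0 F G] subst2_hom(3)[of 1 F G] by simp_all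

lemma subst2_uminus [simp]: "subst2 (- f) F G = - subst2 f F G"
  for f :: "'a::comm_ring_1 poly poly"
  using subst2_hom(2)[of "const2 (- 1)" f F G] unfolding subst2_hom(3) by simp

lemma subst2_diff [simp]: "subst2 (f - g) F G = subst2 f F G - subst2 g F G"
  for f :: "'a::comm_ring_1 poly poly"
  using subst2_hom(1)[of f "- g" F G] by simp

lemma subst2_power [simp]: "subst2 (f ^ n) F G = subst2 f F G ^ n"
  by (induction n) simp_all

lemma subst2_prod [simp]: "subst2 (\<Prod>x\<in>A. f x) F G = (\<Prod>x\<in>A. subst2 (f x) F G)"
  by (induction A rule: infinite_finite_induct) simp_all

lemma subst2_id [simp]: "subst2 f varX varY = f"
  by (induction f rule: bivariate_induct) simp_all

lemma subst2_subst2: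
  "subst2 (subst2 f F G) A B = subst2 f (subst2 F A B) (subst2 G A B)"
  by (induction f rule: bivariate_induct) simp_all

lemma value0_hom [simp]:
  "value0 0 = 0" "value0 1 = 1" "value0 (const2 c) = c" "value0 varX = 0" "value0 varY = 0"
  "value0 (f + g) = value0 f + value0 g" "value0 (f * g) = value0 f * value0 g"
  "value0 (f ^ n) = value0 f ^ n"
  by (simp_all add: value0_def const2_def varX_def varY_def)

lemma value0_diff [simp]: "value0 (f - g) = value0 f - value0 g"
  for f :: "'a::comm_ring_1 poly poly"
  by (simp_all add: value0_def)

lemma value0_prod [simp]: "value0 (\<Prod>x\<in>A. f x) = (\<Prod>x\<in>A. value0 (f x))"
  by (induction A rule: infinite_finite_induct) simp_all

lemma value0_subst2:
  assumes "value0 F = 0" "value0 G = 0"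
  shows "value0 (subst2 f F G) = value0 f"
  by (induction f rule: bivariate_induct) (simp_all add: assms)

lemma coeff_derivX: "coeff (derivX f) j = pderiv (coeff f j)"
  by (simp add: derivX_def coeff_map_poly)

lemma derivX_simps [simp]:
  "derivX (f + g) = derivX f + derivX g"
  "derivX (f * g) = derivX f * g + f * derivX g"
  "derivX (const2 c) = 0" "derivX varX = 1" "derivX varY = 0"
proof -
  show "derivX (f + g) = derivX f + derivX g"
    by (rule poly_eqI) (simp add: coeff_derivX pderiv_add)
  show "derivX (f * g) = derivX f * g + f * derivX g"
    by (rule poly_eqI)
       (simp add: coeff_derivX coeff_mult pderiv_mult pderiv_sum mult.commute[of "pderiv _"] add.commute flip: sum.distrib)
  show "derivX (const2 c) = 0" "derivX varX = 1" "derivX varY = 0"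
    by (simp_all add: derivX_def const2_def varX_def varY_def Polynomial.map_poly_pCons pderiv_pCons one_pCons)
qed

lemma derivY_simps [simp]:
  "derivY (f + g) = derivY f + derivY g"
  "derivY (f * g) = derivY f * g + f * derivY g"
  "derivY (const2 c) = 0" "derivY varX = 0" "derivY varY = 1"
  by (simp_all add: derivY_def pderiv_add pderiv_mult const2_def varX_def varY_def pderiv_pCons
      one_pCons)

lemma chain_rule:
  fixes f F G :: "'a::idom poly poly"
  shows "derivX (subst2 f F G) =
           subst2 (derivX f) F G * derivX F + subst2 (derivY f) F G * derivX G"
    and "derivY (subst2 f F G) =
           subst2 (derivX f) F G * derivY F + subst2 (derivY f) F G * derivY G"
  by (induction f rule: bivariate_induct; simp add: algebra_simps)+

lemma jacobian_subst2:
  fixes F G A B :: "'a::idom poly poly"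
  shows "jacobian (subst2 F A B) (subst2 G A B) = subst2 (jacobian F G) A B * jacobian A B"
  by (simp add: jacobian_def chain_rule algebra_simps)

text \<open>
  The list of directions is consumed from the first blow-up on, whereas a point is studied by
  blowing it up once more, that is, by extending the list at its end.
\<close>

lemma chart_map_snoc:
  assumes "chart_map t = (F, G)" "blowup_chart d = (A, B)"
  shows "chart_map (t @ [d]) = (subst2 F A B, subst2 G A B)"
  using assms
proof (induction t arbitrary: F G)
  case (Cons d' t)
  obtain F' G' where FG: "chart_map t = (F', G')" by force
  from Cons.prems Cons.IH[OF FG] FG show ?case
    by (auto simp: Let_def subst2_subst2 split: prod.splits)
qed (simp add: Let_def)

lemma pullback_snoc:
  "blowup_chart d = (A, B) \<Longrightarrow> pullback g (t @ [d]) = subst2 (pullback g t) A B"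
  by (cases "chart_map t") (simp add: pullback_def chart_map_snoc subst2_subst2)

lemma pullback_jacobian_snoc:
  "blowup_chart d = (A, B) \<Longrightarrow>
     pullback_jacobian (t @ [d]) = subst2 (pullback_jacobian t) A B * jacobian A B"
  by (cases "chart_map t") (simp add: pullback_jacobian_def chart_map_snoc jacobian_subst2)

lemma pullback_Nil [simp]: "pullback g [] = g"
  and pullback_jacobian_Nil [simp]: "pullback_jacobian [] = 1"
  by (simp_all add: pullback_def pullback_jacobian_def jacobian_def)

lemma jacobian_chart [simp]:
  "jacobian varX (varX * (varY + const2 c)) = varX"
  "jacobian (varX * varY) varY = varY"
  by (simp_all add: jacobian_def)

section \<open>Prime factors in a factorial domain\<close>

text \<open>
  This makes bivariate polynomials over an algebraic closure a factorial ring, like those over the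
  complex numbers.
\<close>

instance alg_closure :: (field) field_gcd ..

lemma prod_primes_dvd:
  fixes z :: "'b::factorial_semiring"
  assumes "finite P" "\<And>\<pi>. \<pi> \<in> P \<Longrightarrow> prime_elem \<pi>" "\<And>\<pi>. \<pi> \<in> P \<Longrightarrow> \<pi> dvd z"
    and "\<And>\<pi> \<pi>'. \<pi> \<in> P \<Longrightarrow> \<pi>' \<in> P \<Longrightarrow> \<pi> dvd \<pi>' \<Longrightarrow> \<pi> = \<pi>'"
  shows "\<Prod>P dvd z"
  using assms
proof (induction P arbitrary: z)
  case (insert \<pi> P)
  obtain y where y: "z = \<pi> * y" using insert.prems(2)[of \<pi>] by (auto elim: dvdE)
  have "\<Prod>P dvd y"
  proof (rule insert.IH)
    fix \<pi>' assume \<pi>': "\<pi>' \<in> P"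
    hence "\<pi>' dvd \<pi> * y" "\<not> \<pi>' dvd \<pi>"
      using insert.prems(2)[of \<pi>'] insert.prems(3)[of \<pi>' \<pi>] insert.hyps(2) y by auto
    thus "\<pi>' dvd y" using prime_elem_dvd_multD[of \<pi>' \<pi> y] insert.prems(1) \<pi>' by simp
  qed (use insert.prems in blast)+
  thus ?case using insert.hyps y by (simp add: mult_dvd_mono)
qed simp

lemma irreducible_dvd_prime_imp_associated:
  fixes h \<pi> :: "'b::factorial_semiring"
  assumes "irreducible h" "prime_elem \<pi>" "h dvd \<pi>"
  shows "\<pi> dvd h"
  using irreducibleD'[OF Factorial_Ring.prime_elem_imp_irreducible[OF assms(2)] assms(3)] assms(1)
  by (simp add: irreducible_def)

text \<open>
  Uniqueness of factorization in the form in which similarity of factorizations uses it: the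
  exponents in any list of irreducible factors are the multiplicities along a system \<open>P\<close> of
  representatives of the prime divisors.  Each step of the induction removes the representative of the first
  factor, which divides none of the later factors because they are coprime to the first.
\<close>

lemma exponents_of_factorization:
  fixes f c :: "'b::factorial_semiring"
  assumes "is_unit c" "f = c * (\<Prod>(h, m)\<leftarrow>hms. h ^ m)"
    and "\<forall>(h, m)\<in>set hms. irreducible h \<and> m > 0"
    and "sorted_wrt (\<lambda>(h, _) (h', _). coprime h h') hms"
    and "finite P" "\<And>\<pi>. \<pi> \<in> P \<Longrightarrow> prime_elem \<pi>" "\<And>\<pi>. \<pi> \<in> P \<Longrightarrow> \<pi> dvd f"
    and "\<And>\<pi> \<pi>'. \<pi> \<in> P \<Longrightarrow> \<pi>' \<in> P \<Longrightarrow> \<pi> dvd \<pi>' \<Longrightarrow> \<pi> = \<pi>'"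
    and "\<And>h. irreducible h \<Longrightarrow> h dvd f \<Longrightarrow> \<exists>\<pi>\<in>P. \<pi> dvd h"
  shows "mset (map snd hms) = image_mset (\<lambda>\<pi>. multiplicity \<pi> f) (mset_set P)"
  using assms
proof (induction hms arbitrary: f P)
  case Nil
  have "P = {}"
  proof (rule ccontr)
    assume "P \<noteq> {}"
    then obtain \<pi> where "prime_elem \<pi>" "\<pi> dvd f" using Nil.prems by blast
    thus False using Nil.prems(1,2) by (auto dest: prime_elem_not_unit dvd_trans)
  qed
  thus ?case by simp
next
  case (Cons hm hms)
  obtain h m where hm: "hm = (h, m)" by force
  define g where "g = c * (\<Prod>(h, m)\<leftarrow>hms. h ^ m)"
  have f: "f = h ^ m * g" using Cons.prems(2) by (simp add: hm g_def mult_ac)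
  have h: "irreducible h" "m > 0" using Cons.prems(3) hm by auto
  have ph: "prime_elem h" using h(1) by (rule irreducible_imp_prime_elem)
  have "h dvd f" using f h(2) by (simp add: dvd_power)
  then obtain \<pi> where \<pi>: "\<pi> \<in> P" "\<pi> dvd h" using Cons.prems(9) h(1) by blast
  have p\<pi>: "prime_elem \<pi>" using Cons.prems(6) \<pi> by blast
  have h\<pi>: "h dvd \<pi>"
    by (rule irreducible_dvd_prime_imp_associated[OF Factorial_Ring.prime_elem_imp_irreducible[OF p\<pi>] ph \<pi>(2)])
  have nz: "h ^ m \<noteq> 0" "g \<noteq> 0"
  proof -
    show "h ^ m \<noteq> 0" using ph by simp
    have "h' \<noteq> 0" if "(h', m') \<in> set hms" for h' m'
      using Cons.prems(3) that by (auto dest: irreducible_imp_prime_elem)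
    hence "0 \<notin> set (map (\<lambda>(h, m). h ^ m) hms)" by auto
    thus "g \<noteq> 0" using Cons.prems(1) unfolding g_def by (auto simp: prod_list_zero_iff)
  qed
  have not_dvd_g: "\<not> \<pi> dvd g"
  proof
    assume "\<pi> dvd g"
    have "\<pi> dvd (\<Prod>(h, m)\<leftarrow>hms. h ^ m)"
    proof (rule disjE[OF prime_elem_dvd_multD[OF p\<pi>]])
      show "\<pi> dvd c * (\<Prod>(h, m)\<leftarrow>hms. h ^ m)" using \<open>\<pi> dvd g\<close> unfolding g_def .
      assume "\<pi> dvd c"
      hence "is_unit \<pi>" using Cons.prems(1) by (rule dvd_trans)
      thus ?thesis using p\<pi> by (simp add: prime_elem_def)
    qed
    hence "\<exists>(h', m')\<in>set hms. \<pi> dvd h'"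
      using p\<pi>
    proof (induction hms)
      case Nil
      thus ?case by (auto dest: prime_elem_not_unit)
    next
      case (Cons a hms)
      thus ?case by (cases a) (auto simp: prime_elem_dvd_mult_iff dest: prime_elem_dvd_power)
    qed
    then obtain h' m' where h': "(h', m') \<in> set hms" "\<pi> dvd h'" by auto
    hence "coprime h h'" using Cons.prems(4) hm by auto
    moreover have "h dvd h'" using h\<pi> h'(2) by (rule dvd_trans)
    ultimately have "is_unit h" by (simp add: coprime_absorb_left)
    thus False using ph by (simp add: prime_elem_def)
  qed
  have not_dvd_h: "\<not> \<pi>' dvd h" if "\<pi>' \<in> P - {\<pi>}" for \<pi>'
    using that Cons.prems(8)[of \<pi>' \<pi>] dvd_trans[OF _ h\<pi>, of \<pi>'] \<pi>(1) by auto
  have mult: "multiplicity \<pi>' f = multiplicity \<pi>' g" if "\<pi>' \<in> P - {\<pi>}" for \<pi>'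
  proof -
    have "prime_elem \<pi>'" using Cons.prems(6) that by blast
    moreover from this have "multiplicity \<pi>' (h ^ m) = 0"
      using not_dvd_h[OF that] ph
      by (simp add: prime_elem_multiplicity_power_distrib not_dvd_imp_multiplicity_0)
    ultimately show ?thesis using nz by (simp add: f prime_elem_multiplicity_mult_distrib)
  qed
  have "multiplicity \<pi> f = m"
  proof -
    obtain k where k: "h = \<pi> * k" using \<pi>(2) by (elim dvdE)
    have "is_unit k" using h(1) p\<pi> k by (auto simp: irreducible_def prime_elem_def)
    hence "multiplicity \<pi> h = 1"
      using p\<pi> multiplicity_times_unit_right[of k \<pi> \<pi>] by (simp add: k mult.commute)
    thus ?thesis
      using nz p\<pi> ph not_dvd_g
      by (simp add: f prime_elem_multiplicity_mult_distrib prime_elem_multiplicity_power_distrib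
          not_dvd_imp_multiplicity_0)
  qed
  moreover have "mset (map snd hms) = image_mset (\<lambda>\<pi>. multiplicity \<pi> g) (mset_set (P - {\<pi>}))"
  proof (rule Cons.IH[OF Cons.prems(1) g_def])
    fix \<pi>' assume \<pi>': "\<pi>' \<in> P - {\<pi>}"
    hence "\<pi>' dvd h ^ m * g" "prime_elem \<pi>'" using Cons.prems(6,7) f by auto
    thus "\<pi>' dvd g"
      using not_dvd_h[OF \<pi>'] prime_elem_dvd_multD[of \<pi>' "h ^ m" g] prime_elem_dvd_power[of \<pi>' h m]
      by auto
  next
    fix k assume k: "irreducible k" "k dvd g"
    hence "k dvd f" by (simp add: f)
    then obtain \<pi>' where \<pi>': "\<pi>' \<in> P" "\<pi>' dvd k" using Cons.prems(9) k(1) by blast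
    moreover have "\<pi>' \<noteq> \<pi>" using not_dvd_g dvd_trans[OF \<pi>'(2) k(2)] by auto
    ultimately show "\<exists>\<pi>'\<in>P - {\<pi>}. \<pi>' dvd k" by blast
  qed (use Cons.prems in auto)
  moreover have "mset_set P = add_mset \<pi> (mset_set (P - {\<pi>}))"
    using \<pi>(1) Cons.prems(5) by (simp add: mset_set.remove)
  ultimately show ?case
    using mult Cons.prems(5) by (auto simp: hm intro!: image_mset_cong)
qed

section \<open>The binomials that occur as prime factors\<close>

definition qbinom :: "nat \<Rightarrow> nat \<Rightarrow> 'a::comm_ring_1 \<Rightarrow> 'a poly poly" where
  "qbinom u v l = varY ^ u - const2 l * varX ^ v"

lemma coprime_combination_unique:
  fixes u v i j i' j' :: nat
  assumes "coprime u v" "j < u" "j' < u" "u * i + v * j = u * i' + v * j'"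
  shows "i = i' \<and> j = j'"
proof -
  have "[u * i + v * j = u * i' + v * j'] (mod u)" by (simp add: assms(4))
  hence "[v * j = v * j'] (mod u)" by (simp add: cong_def)
  hence "[j = j'] (mod u)"
    using assms(1) by (simp add: cong_mult_lcancel_nat coprime_commute)
  hence "j = j'" using assms(2,3) by (simp add: cong_def)
  thus ?thesis using assms by auto
qed

text \<open>
  On polynomials of degree less than \<open>u\<close> in \<open>Y\<close> the restriction to the curve
  \<open>(s ^ u, \<mu> * s ^ v)\<close> loses nothing: distinct monomials have distinct images because \<open>u\<close> and \<open>v\<close>
  are coprime.
\<close>

lemma subst2_curve_injective:
  fixes r :: "'a::idom poly poly"
  assumes uv: "coprime u v" "u > 0" and \<mu>: "\<mu> \<noteq> 0" and deg: "degree r < u"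
    and zero: "subst2 r (varX ^ u) (const2 \<mu> * varX ^ v) = 0"
  shows "r = 0"
proof (rule ccontr)
  assume "r \<noteq> 0"
  define j0 where "j0 = degree r"
  define i0 where "i0 = degree (coeff r j0)"
  have c0: "coeff (coeff r j0) i0 \<noteq> 0" using \<open>r \<noteq> 0\<close> by (simp add: j0_def i0_def)
  let ?e = "u * i0 + v * j0"
  have "subst2 r (varX ^ u) (const2 \<mu> * varX ^ v) =
      (\<Sum>j\<le>degree r. \<Sum>i\<le>degree (coeff r j). monom (monom (coeff (coeff r j) i * \<mu> ^ j) (u * i + v * j)) 0)"
    unfolding subst2_def
  proof (intro sum.cong refl)
    fix j i
    have "const2 (coeff (coeff r j) i) * (varX ^ u) ^ i * (const2 \<mu> * varX ^ v) ^ j =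
        const2 (coeff (coeff r j) i * \<mu> ^ j) * ((varX ^ u) ^ i * (varX ^ v) ^ j) * varY ^ 0"
      by (simp add: power_mult_distrib mult_ac)
    also have "(varX ^ u) ^ i * (varX ^ v) ^ j = (varX ^ (u * i + v * j) :: 'a poly poly)"
      by (simp only: power_add power_mult)
    finally have "const2 (coeff (coeff r j) i) * (varX ^ u) ^ i * (const2 \<mu> * varX ^ v) ^ j =
        const2 (coeff (coeff r j) i * \<mu> ^ j) * varX ^ (u * i + v * j) * varY ^ 0" .
    thus "const2 (coeff (coeff r j) i) * (varX ^ u) ^ i * (const2 \<mu> * varX ^ v) ^ j =
        monom (monom (coeff (coeff r j) i * \<mu> ^ j) (u * i + v * j)) 0"
      by (simp only: monomial_conv_monom)
  qed
  hence "0 = (\<Sum>j\<le>degree r. \<Sum>i\<le>degree (coeff r j).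
           if u * i + v * j = ?e then coeff (coeff r j) i * \<mu> ^ j else 0)"
    using arg_cong[OF zero, of "\<lambda>f. coeff (coeff f 0) ?e"] by (simp add: coeff_sum)
  also have "\<dots> = (\<Sum>j\<le>degree r. \<Sum>i\<le>degree (coeff r j).
           if i = i0 then (if j = j0 then coeff (coeff r j0) i0 * \<mu> ^ j0 else 0) else 0)"
  proof (intro sum.cong refl)
    fix j i assume "j \<in> {..degree r}" "i \<in> {..degree (coeff r j)}"
    hence "u * i + v * j = ?e \<longleftrightarrow> i = i0 \<and> j = j0"
      using coprime_combination_unique[OF uv(1), of j j0 i i0] deg by (auto simp: j0_def)
    thus "(if u * i + v * j = ?e then coeff (coeff r j) i * \<mu> ^ j else 0) =
      (if i = i0 then (if j = j0 then coeff (coeff r j0) i0 * \<mu> ^ j0 else 0) else 0)" by auto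
  qed
  also have "\<dots> = (\<Sum>j\<le>degree r. if j = j0 then coeff (coeff r j0) i0 * \<mu> ^ j0 else 0)"
    by (intro sum.cong refl) (auto simp: i0_def)
  also have "\<dots> = coeff (coeff r j0) i0 * \<mu> ^ j0" by (simp add: j0_def)
  finally show False using c0 \<mu> by simp
qed

lemma degree_qbinom:
  assumes "u > 0"
  shows "degree (qbinom u v l) = u" "lead_coeff (qbinom u v l) = 1"
proof -
  have Y: "varY ^ u = (monom 1 u :: 'a poly poly)"
    using monomial_conv_monom[of 1 0 u] by simp
  have X: "const2 l * varX ^ v = [:monom l v:]"
    using monomial_conv_monom[of l v 0] by (simp add: monom_0)
  have c: "coeff (qbinom u v l) u = 1" using assms by (simp add: qbinom_def X Y coeff_pCons split: nat.splits)
  have "degree (qbinom u v l) \<le> u"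
    unfolding qbinom_def X Y by (intro degree_diff_le) (simp_all add: degree_monom_le)
  moreover have "u \<le> degree (qbinom u v l)" by (rule le_degree) (simp add: c)
  ultimately show "degree (qbinom u v l) = u" by simp
  thus "lead_coeff (qbinom u v l) = 1" using c by simp
qed

lemma subst2_curve_qbinom:
  fixes l :: "'a::comm_ring_1"
  shows "subst2 (qbinom u v l) (varX ^ u) (const2 \<mu> * varX ^ v) = const2 (\<mu> ^ u - l) * varX ^ (u * v)"
proof -
  have "(varX ^ v) ^ u = (varX ^ (u * v) :: 'a poly poly)" "(varX ^ u) ^ v = (varX ^ (u * v) :: 'a poly poly)"
    by (simp_all only: power_mult[symmetric] mult.commute)
  thus ?thesis by (simp add: qbinom_def power_mult_distrib algebra_simps)
qed

text \<open>
  The binomial is the equation of the curve \<open>(s ^ u, \<mu> * s ^ v)\<close>.  It is monic in \<open>Y\<close>, so division with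
  remainder reduces the claim to remainders of degree less than \<open>u\<close>.
\<close>

lemma qbinom_dvd_iff:
  fixes f :: "'a::idom poly poly"
  assumes uv: "coprime u v" "u > 0" and \<mu>: "\<mu> ^ u = l" "\<mu> \<noteq> 0"
  shows "qbinom u v l dvd f \<longleftrightarrow> subst2 f (varX ^ u) (const2 \<mu> * varX ^ v) = 0"
proof
  assume "qbinom u v l dvd f"
  thus "subst2 f (varX ^ u) (const2 \<mu> * varX ^ v) = 0"
    using \<mu> by (auto simp: subst2_curve_qbinom elim!: dvdE)
next
  assume *: "subst2 f (varX ^ u) (const2 \<mu> * varX ^ v) = 0"
  note deg = degree_qbinom[OF uv(2), of v l]
  have nz: "qbinom u v l \<noteq> 0" using deg(2) by auto
  obtain q r where qr: "pseudo_divmod f (qbinom u v l) = (q, r)" by force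
  have f: "f = qbinom u v l * q + r"
    using pseudo_divmod(1)[OF nz qr] deg(2) by simp
  have "subst2 r (varX ^ u) (const2 \<mu> * varX ^ v) = 0"
    using * \<mu>(1) unfolding f by (simp add: subst2_curve_qbinom)
  moreover have "degree r < u"
    using pseudo_divmod(2)[OF nz qr] deg(1) uv(2) by auto
  ultimately have "r = 0" using subst2_curve_injective[OF uv \<mu>(2)] by simp
  thus "qbinom u v l dvd f" using f by simp
qed

lemma varX_dvd_imp: "varX dvd f \<Longrightarrow> subst2 f 0 varY = 0"
  by (auto elim!: dvdE)

lemma varY_dvd_imp: "varY dvd f \<Longrightarrow> subst2 f varX 0 = 0"
  by (auto elim!: dvdE)

lemma varXY_nonzero [simp]: "varX \<noteq> 0" "varY \<noteq> 0"
  by (simp_all add: varX_def varY_def)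

lemma prime_elem_varX: "prime_elem (varX :: 'a::field_gcd poly poly)"
  unfolding varX_def by (intro lift_prime_elem_poly prime_elem_linear_field_poly) simp

lemma prime_elem_varY: "prime_elem (varY :: 'a::field_gcd poly poly)"
  unfolding varY_def by (intro prime_elem_linear_poly) simp_all

text \<open>
  The multiples of the binomial are the kernel of a homomorphism into a domain.
\<close>

lemma prime_elem_qbinom:
  fixes l :: "'a::alg_closed_field"
  assumes uv: "coprime u v" "u > 0" and l: "l \<noteq> 0"
  shows "prime_elem (qbinom u v l)"
proof -
  obtain \<mu> where \<mu>: "\<mu> ^ u = l" using nth_root_exists[OF uv(2)] by blast
  hence "\<mu> \<noteq> 0" using l uv(2) by (auto simp: zero_power)
  note dvd = qbinom_dvd_iff[OF uv \<mu> this]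
  show ?thesis
  proof (rule prime_elemI)
    show "qbinom u v l \<noteq> 0" using degree_qbinom[OF uv(2), of v l] by auto
  qed (auto simp: dvd)
qed

lemma not_dvd_varX_varY [simp]:
  "\<not> varX dvd (varY :: 'a::idom poly poly)" "\<not> varY dvd (varX :: 'a::idom poly poly)"
  using varX_dvd_imp[of varY] varY_dvd_imp[of varX] by auto

lemma not_dvd_qbinom:
  fixes l :: "'a::idom"
  assumes "u > 0" "v > 0" "l \<noteq> 0"
  shows "\<not> varX dvd qbinom u v l" "\<not> varY dvd qbinom u v l"
  using varX_dvd_imp[of "qbinom u v l"] varY_dvd_imp[of "qbinom u v l"] assms
  by (auto simp: qbinom_def zero_power)

lemma qbinom_not_dvd:
  fixes l :: "'a::alg_closed_field"
  assumes "coprime u v" "u > 0" "l \<noteq> 0"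
  shows "\<not> qbinom u v l dvd varX" "\<not> qbinom u v l dvd varY"
    "qbinom u v l dvd qbinom u v l' \<Longrightarrow> l = l'"
proof -
  obtain \<mu> where \<mu>: "\<mu> ^ u = l" using nth_root_exists[OF assms(2)] by blast
  hence \<mu>0: "\<mu> \<noteq> 0" using assms by (auto simp: zero_power)
  note dvd = qbinom_dvd_iff[OF assms(1,2) \<mu> \<mu>0]
  show "\<not> qbinom u v l dvd varX" "\<not> qbinom u v l dvd varY"
    "qbinom u v l dvd qbinom u v l' \<Longrightarrow> l = l'"
    using \<mu> \<mu>0 by (auto simp: dvd subst2_curve_qbinom simp del: const2_diff const2_power)
qed

section \<open>The shape of quasi-homogeneous polynomials\<close>

text \<open>
  The homogenization of degree \<open>n\<close> of \<open>P\<close> in the variables \<open>X ^ v\<close> and \<open>Y ^ u\<close>, multiplied by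
  \<open>X ^ a * Y ^ b\<close>.
\<close>

definition qhom :: "nat \<Rightarrow> nat \<Rightarrow> nat \<Rightarrow> nat \<Rightarrow> nat \<Rightarrow> 'a::comm_ring_1 poly \<Rightarrow> 'a poly poly" where
  "qhom u v a b n P = (\<Sum>k\<le>n. monom (monom (coeff P k) (a + v * (n - k))) (b + u * k))"

lemma coeff_qhom:
  assumes "u > 0"
  shows "coeff (coeff (qhom u v a b n P) j) i =
           (if \<exists>k\<le>n. j = b + u * k \<and> i = a + v * (n - k) then coeff P ((j - b) div u) else 0)"
proof -
  have "coeff (coeff (qhom u v a b n P) j) i =
      (\<Sum>k\<le>n. if j = b + u * k \<and> i = a + v * (n - k) then coeff P k else 0)"
    unfolding qhom_def coeff_sum by (intro sum.cong refl) auto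
  also have "\<dots> = (if \<exists>k\<le>n. j = b + u * k \<and> i = a + v * (n - k) then coeff P ((j - b) div u) else 0)"
  proof (cases "\<exists>k\<le>n. j = b + u * k \<and> i = a + v * (n - k)")
    case True
    then obtain k where k: "k \<le> n" "j = b + u * k" "i = a + v * (n - k)" by blast
    have "(\<Sum>k'\<le>n. if j = b + u * k' \<and> i = a + v * (n - k') then coeff P k' else 0) =
          (\<Sum>k'\<le>n. if k' = k then coeff P k else 0)"
      using k assms by (intro sum.cong refl) auto
    also have "\<dots> = coeff P k" using k(1) by simp
    finally show ?thesis using True k assms by simp
  next
    case False
    hence "(\<Sum>k\<le>n. if j = b + u * k \<and> i = a + v * (n - k) then coeff P k else 0) = 0"
      by (intro sum.neutral) auto
    thus ?thesis by (subst if_not_P[OF False])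
  qed
  finally show ?thesis .
qed

lemma qhom_sum: "qhom u v a b n (\<Sum>x\<in>A. f x) = (\<Sum>x\<in>A. qhom u v a b n (f x))"
proof -
  have A: "qhom u v a b n (p + q) = qhom u v a b n p + qhom u v a b n q" for p q
    by (simp add: qhom_def sum.distrib add_monom[symmetric])
  have B: "qhom u v a b n 0 = 0" by (simp add: qhom_def)
  show ?thesis by (induction A rule: infinite_finite_induct) (simp_all add: A B)
qed

lemma qhom_monom:
  assumes "s \<le> n"
  shows "qhom u v a b n (monom c s) = monom (monom c (a + v * (n - s))) (b + u * s)"
proof -
  have "qhom u v a b n (monom c s) =
      (\<Sum>k\<le>n. if k = s then monom (monom c (a + v * (n - s))) (b + u * s) else 0)"
    unfolding qhom_def by (intro sum.cong refl) auto
  thus ?thesis using assms by simp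
qed

lemma qhom_mult:
  assumes "degree P \<le> n" "degree Q \<le> n'"
  shows "qhom u v a b n P * qhom u v a' b' n' Q = qhom u v (a + a') (b + b') (n + n') (P * Q)"
proof -
  have expand: "p = (\<Sum>k\<le>n. monom (coeff p k) k)" if "degree p \<le> n" for p :: "'a poly" and n
    using that by (rule poly_as_sum_of_monoms'[symmetric])
  have "P * Q = (\<Sum>k\<le>n. \<Sum>l\<le>n'. monom (coeff P k * coeff Q l) (k + l))"
    by (subst expand[OF assms(1)], subst expand[OF assms(2)])
       (simp add: sum_product mult_monom)
  hence "qhom u v (a + a') (b + b') (n + n') (P * Q) =
      (\<Sum>k\<le>n. \<Sum>l\<le>n'. qhom u v (a + a') (b + b') (n + n') (monom (coeff P k * coeff Q l) (k + l)))"
    by (simp add: qhom_sum)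
  also have "\<dots> = (\<Sum>k\<le>n. \<Sum>l\<le>n'. monom (monom (coeff P k) (a + v * (n - k))) (b + u * k) *
                                  monom (monom (coeff Q l) (a' + v * (n' - l))) (b' + u * l))"
  proof (intro sum.cong refl)
    fix k l assume kl: "k \<in> {..n}" "l \<in> {..n'}"
    hence e: "n + n' - (k + l) = (n - k) + (n' - l)" by auto
    have le: "k + l \<le> n + n'" using kl by simp
    show "qhom u v (a + a') (b + b') (n + n') (monom (coeff P k * coeff Q l) (k + l)) =
        monom (monom (coeff P k) (a + v * (n - k))) (b + u * k) *
        monom (monom (coeff Q l) (a' + v * (n' - l))) (b' + u * l)"
      unfolding qhom_monom[OF le] mult_monom e distrib_left by (simp only: add_ac)
  qed
  also have "\<dots> = qhom u v a b n P * qhom u v a' b' n' Q"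
    by (simp add: qhom_def sum_product)
  finally show ?thesis by simp
qed

lemma qhom_const: "qhom u v a b 0 [:c:] = const2 c * varX ^ a * varY ^ b"
  by (simp add: qhom_def monomial_conv_monom)

lemma qhom_1: "qhom u v 0 0 0 1 = 1"
  by (simp add: qhom_def)

lemma qhom_power:
  fixes P :: "'a::idom poly"
  assumes "degree P \<le> n"
  shows "qhom u v a b n P ^ N = qhom u v (a * N) (b * N) (n * N) (P ^ N)"
proof (induction N)
  case 0
  show ?case by (simp add: qhom_1)
next
  case (Suc N)
  have "degree (P ^ N) \<le> n * N"
    using degree_power_le[of P N] mult_le_mono1[OF assms, of N] by linarith
  with Suc qhom_mult[OF assms this] show ?case by simp
qed

lemma qhom_linear: "qhom u v 0 0 1 [:- l, 1:] = qbinom u v l"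
proof -
  have "qhom u v 0 0 1 [:- l, 1:] = const2 (- l) * varX ^ v * varY ^ 0 + const2 1 * varX ^ 0 * varY ^ u"
    unfolding monomial_conv_monom by (simp add: qhom_def)
  thus ?thesis by (simp add: qbinom_def)
qed

lemma qhom_prod_linear_powers:
  fixes S :: "'a::idom set"
  assumes "finite S"
  shows "qhom u v 0 0 (\<Sum>l\<in>S. m l) (\<Prod>l\<in>S. [:- l, 1:] ^ m l) = (\<Prod>l\<in>S. qbinom u v l ^ m l)"
  using assms
proof (induction S)
  case empty
  show ?case by (simp add: qhom_1)
next
  case (insert l S)
  have "qbinom u v l ^ m l = qhom u v 0 0 (m l) ([:- l, 1:] ^ m l)"
    using qhom_power[of "[:- l, 1:]" 1 u v 0 0 "m l"] qhom_linear[of u v l] by simp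
  moreover have deg: "degree (\<Prod>l\<in>S. [:- l, 1:] ^ m l) \<le> (\<Sum>l\<in>S. m l)"
  proof -
    have "degree (\<Prod>l\<in>S. [:- l, 1:] ^ m l) \<le> sum (degree \<circ> (\<lambda>l. [:- l, 1:] ^ m l)) S"
      by (rule degree_prod_sum_le[OF insert.hyps(1)])
    thus ?thesis by (simp add: degree_linear_power)
  qed
  moreover have "qhom u v 0 0 (m l) ([:- l, 1:] ^ m l) *
        qhom u v 0 0 (\<Sum>l\<in>S. m l) (\<Prod>l\<in>S. [:- l, 1:] ^ m l) =
      qhom u v 0 0 (\<Sum>l\<in>insert l S. m l) (\<Prod>l\<in>insert l S. [:- l, 1:] ^ m l)"
    using insert.hyps qhom_mult[OF _ deg, of "[:- l, 1:] ^ m l" "m l" u v 0 0 0 0]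
    by (simp add: degree_linear_power)
  ultimately show ?case
    using insert.hyps insert.IH by simp
qed

text \<open>
  By coprimality of \<open>u\<close> and \<open>v\<close> two monomials of the same weighted degree differ by a power of
  \<open>Y ^ u / X ^ v\<close>.  Starting from the lowest power \<open>b\<close> of \<open>Y\<close>, the exponents that occur therefore form a
  subset of an arithmetic progression.
\<close>

lemma quasi_homogeneous_imp_qhom:
  fixes f :: "'a::comm_ring_1 poly poly"
  assumes qh: "quasi_homogeneous (w * u) (w * v) f" and uv: "coprime u v" "u > 0" "v > 0" "w > 0"
  shows "\<exists>a b P. coeff P 0 \<noteq> 0 \<and> f = qhom u v a b (degree P) P"
proof -
  obtain d where "f \<noteq> 0" and d: "\<And>i j. coeff (coeff f j) i \<noteq> 0 \<Longrightarrow> w * u * i + w * v * j = d"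
    using qh by (auto simp: quasi_homogeneous_def)
  define b where "b = (LEAST j. coeff f j \<noteq> 0)"
  have "\<exists>j. coeff f j \<noteq> 0" using \<open>f \<noteq> 0\<close> by (meson leading_coeff_0_iff)
  hence fb: "coeff f b \<noteq> 0" unfolding b_def by (rule LeastI_ex)
  have b_le: "b \<le> j" if "coeff f j \<noteq> 0" for j unfolding b_def using that by (rule Least_le)
  define i1 where "i1 = degree (coeff f b)"
  have fbi: "coeff (coeff f b) i1 \<noteq> 0" using fb by (simp add: i1_def)
  have supp: "\<exists>k. j = b + u * k \<and> i1 = i + v * k" if "coeff (coeff f j) i \<noteq> 0" for i j
  proof -
    have "w * (u * i + v * j) = w * (u * i1 + v * b)"
      using d[OF that] d[OF fbi] by (simp add: distrib_left mult.assoc)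
    hence eq: "u * i + v * j = u * i1 + v * b" using uv(4) by simp
    have "b \<le> j" using that by (intro b_le) auto
    then obtain t where t: "j = b + t" using le_Suc_ex by blast
    hence eq': "u * i + v * t = u * i1" using eq by (simp add: distrib_left)
    hence "u dvd v * t" by (metis dvd_add_right_iff dvd_triv_left)
    hence "u dvd t" using uv(1) by (simp add: coprime_dvd_mult_right_iff)
    then obtain k where k: "t = u * k" by blast
    have "u * (i + v * k) = u * i1" using eq' k by (simp add: algebra_simps)
    thus ?thesis using uv(2) t k by auto
  qed
  define K where "K = {k. v * k \<le> i1 \<and> coeff (coeff f (b + u * k)) (i1 - v * k) \<noteq> 0}"
  have "K \<subseteq> {..i1}"
  proof
    fix k assume "k \<in> K"
    have "k \<le> v * k" using uv(3) by simp
    also have "\<dots> \<le> i1" using \<open>k \<in> K\<close> by (simp add: K_def)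
    finally show "k \<in> {..i1}" by simp
  qed
  hence fin: "finite K" by (rule finite_subset) simp
  have "0 \<in> K" using fbi by (simp add: K_def)
  define n where "n = Max K"
  have nK: "n \<in> K" unfolding n_def using fin \<open>0 \<in> K\<close> by (intro Max_in) auto
  define a where "a = i1 - v * n"
  have i1: "i1 = a + v * n" using nK by (simp add: a_def K_def)
  define P where "P = (\<Sum>k\<le>n. monom (coeff (coeff f (b + u * k)) (a + v * (n - k))) k)"
  have cP: "coeff P k = (if k \<le> n then coeff (coeff f (b + u * k)) (a + v * (n - k)) else 0)" for k
    by (simp add: P_def coeff_sum)
  have "coeff P n \<noteq> 0" using nK i1 by (simp add: cP K_def)
  hence "degree P = n" by (intro antisym le_degree degree_le) (auto simp: cP)
  moreover have "coeff P 0 \<noteq> 0" using fbi i1 by (simp add: cP)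
  moreover have "f = qhom u v a b n P"
  proof (rule poly_eqI, rule poly_eqI)
    fix j i
    show "coeff (coeff f j) i = coeff (coeff (qhom u v a b n P) j) i"
    proof (cases "\<exists>k\<le>n. j = b + u * k \<and> i = a + v * (n - k)")
      case True
      thus ?thesis using uv(2) by (auto simp: coeff_qhom cP)
    next
      case False
      have "coeff (coeff f j) i = 0"
      proof (rule ccontr)
        assume nz: "coeff (coeff f j) i \<noteq> 0"
        then obtain k where k: "j = b + u * k" "i1 = i + v * k" using supp by blast
        hence "k \<in> K" using nz by (simp add: K_def)
        hence "k \<le> n" unfolding n_def using fin by simp
        moreover have "i = a + v * (n - k)"
          using k(2) i1 \<open>k \<le> n\<close> by (simp add: diff_mult_distrib2)
        ultimately show False using False k(1) by blast
      qed
      thus ?thesis unfolding coeff_qhom[OF uv(2)] by (subst if_not_P[OF False])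
    qed
  qed
  ultimately show ?thesis by blast
qed

lemma alg_closed_splits:
  fixes P :: "'a::alg_closed_field poly"
  assumes "coeff P 0 \<noteq> 0"
  obtains c S m where "c \<noteq> 0" "finite S" "0 \<notin> S" "\<And>l. l \<in> S \<Longrightarrow> m l > 0"
    "P = smult c (\<Prod>l\<in>S. [:- l, 1:] ^ m l)" "degree P = (\<Sum>l\<in>S. m l)"
proof -
  have P: "P \<noteq> 0" using assms by auto
  obtain A where A: "size A = degree P" "P = smult (lead_coeff P) (\<Prod>x\<in>#A. [:- x, 1:])"
    using alg_closed_imp_factorization[OF P] by blast
  have "(\<Prod>x\<in>#A. [:- x, 1:]) = (\<Prod>l\<in>set_mset A. [:- l, 1:] ^ count A l)"
    by (rule image_prod_mset_multiplicity)
  hence eq: "P = smult (lead_coeff P) (\<Prod>l\<in>set_mset A. [:- l, 1:] ^ count A l)" using A(2) by simp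
  have "0 \<notin># A"
  proof
    assume "0 \<in># A"
    hence "poly (\<Prod>l\<in>set_mset A. [:- l, 1:] ^ count A l) 0 = 0"
      by (auto simp: poly_prod prod_zero_iff intro!: bexI[of _ 0])
    hence "poly P 0 = 0" using arg_cong[OF eq, of "\<lambda>p. poly p 0"] by simp
    thus False using assms by (simp add: poly_0_coeff_0)
  qed
  show ?thesis
    by (rule that[OF _ _ \<open>0 \<notin># A\<close> _ eq]) (use P A(1) in \<open>simp_all add: size_multiset_overloaded_eq\<close>)
qed

lemma prime_elem_dvd_prodD:
  assumes "prime_elem h" "finite S" "h dvd (\<Prod>l\<in>S. g l)"
  shows "\<exists>l\<in>S. h dvd g l"
  using assms(2,3)
proof (induction S)
  case empty
  thus ?case using assms(1) by (simp add: prime_elem_def)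
next
  case (insert l S)
  thus ?case using prime_elem_dvd_multD[OF assms(1)] by auto
qed

text \<open>
  The same locale serves for \<open>\<complex>\<close>, for the algebraic closure of \<open>\<F>\<^sub>p\<close>, and for the pullbacks of
  \<open>g\<close> to infinitely near points, where the weights and the exponents \<open>a, b\<close> change.
\<close>

locale factored_form =
  fixes u v a b :: nat and c :: "'a::{alg_closed_field,field_gcd}" and S :: "'a set"
    and m :: "'a \<Rightarrow> nat" and f :: "'a poly poly"
  assumes coprime: "coprime u v" and pos: "u > 0" "v > 0"
    and c_nonzero: "c \<noteq> 0" and roots: "finite S" "0 \<notin> S" and m_pos: "\<And>l. l \<in> S \<Longrightarrow> m l > 0"
    and f_eq: "f = const2 c * varX ^ a * varY ^ b * (\<Prod>l\<in>S. qbinom u v l ^ m l)"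
begin

lemma primes [simp]: "prime_elem (varX :: 'a poly poly)" "prime_elem (varY :: 'a poly poly)"
  "l \<in> S \<Longrightarrow> prime_elem (qbinom u v l)"
proof -
  show "prime_elem (qbinom u v l)" if "l \<in> S"
    using that roots by (intro prime_elem_qbinom[OF coprime pos(1)]) auto
qed (rule prime_elem_varX prime_elem_varY)+

lemma not_dvd:
  assumes "l \<in> S"
  shows "\<not> varX dvd qbinom u v l" "\<not> varY dvd qbinom u v l"
    "\<not> qbinom u v l dvd varX" "\<not> qbinom u v l dvd varY"
    "qbinom u v l dvd qbinom u v l' \<Longrightarrow> l = l'"
proof -
  have "l \<noteq> 0" using assms roots by auto
  note l = this
  show "\<not> varX dvd qbinom u v l" "\<not> varY dvd qbinom u v l"
    by (rule not_dvd_qbinom[OF pos l])+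
  show "\<not> qbinom u v l dvd varX" "\<not> qbinom u v l dvd varY"
    by (rule qbinom_not_dvd[OF coprime pos(1) l])+
  show "qbinom u v l dvd qbinom u v l' \<Longrightarrow> l = l'"
    by (rule qbinom_not_dvd(3)[OF coprime pos(1) l])
qed

lemma is_unit_const2: "is_unit (const2 c)"
proof -
  have "const2 c * const2 (inverse c) = 1"
    using c_nonzero by (simp flip: const2_hom(4))
  thus ?thesis by (metis dvd_triv_left)
qed

lemma qbinom_nonzero: "l \<in> S \<Longrightarrow> qbinom u v l \<noteq> 0"
  using primes(3)[of l] by (auto simp: prime_elem_def)

lemma f_nonzero: "f \<noteq> 0"
proof -
  have "(\<Prod>l\<in>S. qbinom u v l ^ m l) \<noteq> 0"
    using qbinom_nonzero unfolding prod_zero_iff[OF roots(1)] by simp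
  thus ?thesis using c_nonzero by (simp add: f_eq)
qed

lemma multiplicity_f:
  assumes "prime_elem \<pi>"
  shows "multiplicity \<pi> f = a * multiplicity \<pi> varX + b * multiplicity \<pi> varY +
           (\<Sum>l\<in>S. m l * multiplicity \<pi> (qbinom u v l))"
proof -
  have nz: "qbinom u v l \<noteq> 0" if "l \<in> S" for l using that by (rule qbinom_nonzero)
  have "multiplicity \<pi> f = multiplicity \<pi> (varX ^ a * varY ^ b * (\<Prod>l\<in>S. qbinom u v l ^ m l))"
    unfolding f_eq mult.assoc by (rule multiplicity_times_unit_right[OF is_unit_const2])
  also have "\<dots> = multiplicity \<pi> (varX ^ a) + multiplicity \<pi> (varY ^ b) +
       multiplicity \<pi> (\<Prod>l\<in>S. qbinom u v l ^ m l)"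
    using assms roots nz by (subst prime_elem_multiplicity_mult_distrib, simp, simp, simp add: prod_zero_iff)+ simp
  also have "multiplicity \<pi> (\<Prod>l\<in>S. qbinom u v l ^ m l) =
      (\<Sum>l\<in>S. multiplicity \<pi> (qbinom u v l ^ m l))"
    using assms roots nz by (intro prime_elem_multiplicity_prod_distrib) auto
  finally show ?thesis
    using assms nz by (simp add: prime_elem_multiplicity_power_distrib)
qed

lemma multiplicities:
  "multiplicity varX f = a" "multiplicity varY f = b"
  "l \<in> S \<Longrightarrow> multiplicity (qbinom u v l) f = m l"
proof -
  show "multiplicity varX f = a" "multiplicity varY f = b"
    using not_dvd by (simp_all add: multiplicity_f not_dvd_imp_multiplicity_0)
  assume l: "l \<in> S"
  have *: "multiplicity (qbinom u v l) (qbinom u v l') = (if l' = l then 1 else 0)" for l'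
  proof (cases "l' = l")
    case False
    hence "\<not> qbinom u v l dvd qbinom u v l'" using not_dvd(5)[OF l, of l'] by auto
    thus ?thesis using False by (simp add: not_dvd_imp_multiplicity_0)
  qed (use l in simp)
  have "(\<Sum>k\<in>S. m k * multiplicity (qbinom u v l) (qbinom u v k)) = (\<Sum>k\<in>S. if k = l then m l else 0)"
    by (intro sum.cong) (auto simp: *)
  also have "\<dots> = m l" using l roots by simp
  finally show "multiplicity (qbinom u v l) f = m l"
    using l not_dvd(3,4)[OF l] by (simp add: multiplicity_f not_dvd_imp_multiplicity_0)
qed

text \<open>
  One representative for each class of associated prime divisors of \<open>f\<close>.
\<close>

definition prime_divisors :: "'a poly poly set" where
  "prime_divisors = (if a > 0 then {varX} else {}) \<union> (if b > 0 then {varY} else {}) \<union> qbinom u v ` S"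

lemma finite_prime_divisors: "finite prime_divisors"
  using roots by (simp add: prime_divisors_def)

lemma prime_divisors_antichain:
  "\<pi> \<in> prime_divisors \<Longrightarrow> \<pi>' \<in> prime_divisors \<Longrightarrow> \<pi> dvd \<pi>' \<Longrightarrow> \<pi> = \<pi>'"
  using not_dvd(1-4) by (auto simp: prime_divisors_def split: if_splits dest: not_dvd(5))

lemma prime_divisors_prime: "\<pi> \<in> prime_divisors \<Longrightarrow> prime_elem \<pi>"
  by (auto simp: prime_divisors_def split: if_splits)

lemma prime_divisors_dvd:
  assumes "\<pi> \<in> prime_divisors"
  shows "\<pi> dvd f"
proof -
  have "multiplicity \<pi> f > 0"
    using assms multiplicities m_pos by (auto simp: prime_divisors_def split: if_splits)
  thus ?thesis by (metis not_dvd_imp_multiplicity_0 less_irrefl)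
qed

lemma irreducible_dvd_f:
  assumes "irreducible h" "h dvd f"
  shows "\<exists>\<pi>\<in>prime_divisors. \<pi> dvd h \<and> h dvd \<pi>"
proof -
  have h: "prime_elem h" using assms(1) by (rule irreducible_imp_prime_elem)
  have "\<exists>\<pi>\<in>prime_divisors. h dvd \<pi>"
  proof -
    have "\<not> h dvd const2 c" using h is_unit_const2 dvd_trans by (auto simp: prime_elem_def)
    then consider "h dvd varX ^ a" | "h dvd varY ^ b" | "h dvd (\<Prod>l\<in>S. qbinom u v l ^ m l)"
      using assms(2) h unfolding f_eq by (auto simp: prime_elem_dvd_mult_iff)
    thus ?thesis
    proof cases
      case 1
      hence "h dvd varX" "a > 0" using h prime_elem_dvd_power by (auto intro: gr0I simp: prime_elem_def)
      thus ?thesis by (auto simp: prime_divisors_def)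
    next
      case 2
      hence "h dvd varY" "b > 0" using h prime_elem_dvd_power by (auto intro: gr0I simp: prime_elem_def)
      thus ?thesis by (auto simp: prime_divisors_def)
    next
      case 3
      then obtain l where "l \<in> S" "h dvd qbinom u v l ^ m l"
        using prime_elem_dvd_prodD[OF h roots(1)] by blast
      thus ?thesis using h prime_elem_dvd_power by (auto simp: prime_divisors_def)
    qed
  qed
  thus ?thesis
    using irreducible_dvd_prime_imp_associated[OF assms(1)] prime_divisors_prime by blast
qed

lemma multiplicity_irreducible:
  assumes "irreducible h" "h dvd f"
  shows "a > 0 \<and> h dvd varX \<and> multiplicity h f = a \<or> b > 0 \<and> h dvd varY \<and> multiplicity h f = b \<or>
           (\<exists>l\<in>S. h dvd qbinom u v l \<and> multiplicity h f = m l)"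
proof -
  obtain \<pi> where \<pi>: "\<pi> \<in> prime_divisors" "\<pi> dvd h" "h dvd \<pi>"
    using irreducible_dvd_f[OF assms] by blast
  have "multiplicity h f = multiplicity \<pi> f"
  proof (rule antisym)
    have hf: "h \<noteq> 0" "\<not> is_unit h" "\<pi> \<noteq> 0" "\<not> is_unit \<pi>"
      using assms(1) prime_divisors_prime[OF \<pi>(1)] by (auto simp: irreducible_def prime_elem_def)
    have f0: "f \<noteq> 0" by (rule f_nonzero)
    show "multiplicity h f \<le> multiplicity \<pi> f"
      using hf f0 dvd_trans[OF dvd_power_same[OF \<pi>(2)] multiplicity_dvd]
      by (intro multiplicity_geI) auto
    show "multiplicity \<pi> f \<le> multiplicity h f"
      using hf f0 dvd_trans[OF dvd_power_same[OF \<pi>(3)] multiplicity_dvd]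
      by (intro multiplicity_geI) auto
  qed
  thus ?thesis using \<pi> multiplicities by (auto simp: prime_divisors_def split: if_splits)
qed

lemma mset_set_prime_divisors:
  "mset_set prime_divisors = (if a > 0 then {#varX#} else {#}) +
     (if b > 0 then {#varY#} else {#}) + image_mset (qbinom u v) (mset_set S)"
proof -
  have inj: "inj_on (qbinom u v) S" using not_dvd(5) by (intro inj_onI) simp
  have neq: "varX \<noteq> (varY :: 'a poly poly)"
    using not_dvd_varX_varY(1)[where ?'a = 'a] by (metis dvd_refl)
  have "varX \<notin> qbinom u v ` S"
  proof
    assume "varX \<in> qbinom u v ` S"
    then obtain l where "l \<in> S" "varX = qbinom u v l" by (elim imageE)
    thus False using not_dvd(1)[of l] by simp
  qed
  moreover have "varY \<notin> qbinom u v ` S"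
  proof
    assume "varY \<in> qbinom u v ` S"
    then obtain l where "l \<in> S" "varY = qbinom u v l" by (elim imageE)
    thus False using not_dvd(2)[of l] by simp
  qed
  ultimately have "((if a > 0 then {varX} else {}) \<union> (if b > 0 then {varY} else {})) \<inter> qbinom u v ` S = {}"
    by simp
  moreover have "(if a > 0 then {varX} else {}) \<inter> (if b > 0 then {varY} else {}) = ({} :: 'a poly poly set)"
    using neq by simp
  ultimately show ?thesis
    unfolding prime_divisors_def image_mset_mset_set[OF inj]
    using roots(1) by (subst mset_set_Union, simp, simp, simp, subst mset_set_Union) simp_all
qed

lemma prod_prime_divisors:
  "\<Prod>prime_divisors = varX ^ of_bool (a > 0) * varY ^ of_bool (b > 0) * (\<Prod>l\<in>S. qbinom u v l)"
  using arg_cong[OF mset_set_prime_divisors, of prod_mset]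
  by (simp add: prod_unfold_prod_mset)

lemma exponents_multiset:
  assumes "is_factorization f d hms"
  shows "mset (map snd hms) =
    (if a > 0 then {#a#} else {#}) + (if b > 0 then {#b#} else {#}) + image_mset m (mset_set S)"
proof -
  have d: "is_unit (const2 d)"
  proof -
    have "const2 d * const2 (inverse d) = 1"
      using assms by (simp add: is_factorization_def flip: const2_hom(4))
    thus ?thesis by (metis dvd_triv_left)
  qed
  have "mset (map snd hms) = image_mset (\<lambda>\<pi>. multiplicity \<pi> f) (mset_set prime_divisors)"
  proof (rule exponents_of_factorization[OF d])
    show "f = const2 d * (\<Prod>(h, m)\<leftarrow>hms. h ^ m)"
      "\<forall>(h, m)\<in>set hms. irreducible h \<and> m > 0"
      "sorted_wrt (\<lambda>(h, _) (h', _). coprime h h') hms"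
      using assms unfolding is_factorization_def by argo+
    show "\<exists>\<pi>\<in>prime_divisors. \<pi> dvd h" if "irreducible h" "h dvd f" for h
      using irreducible_dvd_f[OF that] by fast
  qed (fact finite_prime_divisors prime_divisors_prime prime_divisors_dvd prime_divisors_antichain)+
  also note mset_set_prime_divisors
  finally have "mset (map snd hms) = image_mset (\<lambda>\<pi>. multiplicity \<pi> f) ((if a > 0 then {#varX#} else {#}) +
      (if b > 0 then {#varY#} else {#}) + image_mset (qbinom u v) (mset_set S))" .
  moreover have "image_mset (\<lambda>l. multiplicity (qbinom u v l) f) (mset_set S) = image_mset m (mset_set S)"
    using multiplicities(3) roots(1) by (intro image_mset_cong) simp
  ultimately show ?thesis
    using multiplicities(1,2) by (simp add: multiset.map_comp o_def)
qed

end

lemma (in factored_form) f_qhom: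
  "f = qhom u v a b (\<Sum>l\<in>S. m l) (smult c (\<Prod>l\<in>S. [:- l, 1:] ^ m l))"
proof -
  have "degree (\<Prod>l\<in>S. [:- l, 1:] ^ m l) \<le> (\<Sum>l\<in>S. m l)"
    using degree_prod_sum_le[OF roots(1), of "\<lambda>l. [:- l, 1:] ^ m l"]
    by (simp add: degree_linear_power)
  from qhom_mult[OF _ this, of "[:c:]" 0 u v a b 0 0] show ?thesis
    using qhom_prod_linear_powers[OF roots(1), of u v m]
    by (simp add: f_eq qhom_const mult.assoc)
qed

lemma quasi_homogeneous_factored:
  fixes f :: "'a::{alg_closed_field,field_gcd} poly poly"
  assumes "quasi_homogeneous (w * u) (w * v) f" "coprime u v" "u > 0" "v > 0" "w > 0"
  obtains a b c S m where "factored_form u v a b c S m f"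
proof -
  obtain a b P where P: "coeff P 0 \<noteq> 0" "f = qhom u v a b (degree P) P"
    using quasi_homogeneous_imp_qhom[OF assms] by blast
  obtain c S m where S: "c \<noteq> 0" "finite S" "0 \<notin> S" "\<And>l. l \<in> S \<Longrightarrow> m l > 0"
    "P = smult c (\<Prod>l\<in>S. [:- l, 1:] ^ m l)" "degree P = (\<Sum>l\<in>S. m l)"
    using alg_closed_splits[OF P(1)] by metis
  have "degree (\<Prod>l\<in>S. [:- l, 1:] ^ m l) \<le> (\<Sum>l\<in>S. m l)"
    using degree_prod_sum_le[OF S(2), of "\<lambda>l. [:- l, 1:] ^ m l"]
    by (simp add: degree_linear_power)
  from qhom_mult[OF _ this, of "[:c:]" 0 u v a b 0 0]
  have "f = const2 c * varX ^ a * varY ^ b * (\<Prod>l\<in>S. qbinom u v l ^ m l)"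
    using qhom_prod_linear_powers[OF S(2), of u v m] P(2) S(5,6)
    by (simp add: qhom_const mult.assoc)
  with S assms have "factored_form u v a b c S m f" by unfold_locales auto
  thus ?thesis by (rule that)
qed

section \<open>Weighted orders and simple normal crossings\<close>

lemma not_varX_dvd_unit:
  fixes r :: "'a::field_gcd poly poly"
  assumes "value0 r \<noteq> 0"
  shows "\<not> varX dvd r" "r \<noteq> 0"
  using assms by (auto elim!: dvdE)

lemma multiplicity_varX_monomial:
  fixes r :: "'a::field_gcd poly poly"
  assumes "value0 r \<noteq> 0"
  shows "multiplicity varX (r * varX ^ M * varY ^ N) = M"
proof -
  note p = prime_elem_varX[where ?'a = 'a]
  have "multiplicity varX (varY :: 'a poly poly) = 0"
    by (simp add: not_dvd_imp_multiplicity_0)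
  thus ?thesis
    using not_varX_dvd_unit[OF assms] p
    by (simp add: prime_elem_multiplicity_mult_distrib prime_elem_multiplicity_power_distrib
        not_dvd_imp_multiplicity_0)
qed

text \<open>
  The order in \<open>Y\<close> of the scaled polynomial is the order of \<open>f\<close> for the monomial valuation that gives
  \<open>X\<close> weight \<open>\<alpha>\<close> and \<open>Y\<close> weight \<open>\<beta>\<close>.  Keeping \<open>X\<close> as a factor, instead of
  substituting a pure power of \<open>Y\<close>, prevents cancellation between monomials of equal weight.
\<close>

definition weighted_scaling :: "nat \<Rightarrow> nat \<Rightarrow> 'a::comm_ring_1 poly poly \<Rightarrow> 'a poly poly" where
  "weighted_scaling \<alpha> \<beta> f = subst2 f (varX * varY ^ \<alpha>) (varY ^ \<beta>)"

lemma coeff_weighted_scaling: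
  fixes f :: "'a::comm_ring_1 poly poly"
  shows "coeff (coeff (weighted_scaling \<alpha> \<beta> f) s) k =
    (\<Sum>j\<le>degree f. \<Sum>i\<le>degree (coeff f j).
       if s = \<alpha> * i + \<beta> * j \<and> k = i then coeff (coeff f j) i else 0)"
proof -
  have "const2 x * (varX * varY ^ \<alpha>) ^ i * (varY ^ \<beta>) ^ j = monom (monom x i) (\<alpha> * i + \<beta> * j)"
    for x :: 'a and i j
  proof -
    have "const2 x * (varX * varY ^ \<alpha>) ^ i * (varY ^ \<beta>) ^ j =
        const2 x * varX ^ i * ((varY ^ \<alpha>) ^ i * (varY ^ \<beta>) ^ j)"
      by (simp add: power_mult_distrib mult_ac)
    also have "(varY ^ \<alpha>) ^ i * (varY ^ \<beta>) ^ j = (varY ^ (\<alpha> * i + \<beta> * j) :: 'a poly poly)"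
      by (simp only: power_add power_mult)
    finally show ?thesis by (simp only: monomial_conv_monom)
  qed
  hence "weighted_scaling \<alpha> \<beta> f =
      (\<Sum>j\<le>degree f. \<Sum>i\<le>degree (coeff f j). monom (monom (coeff (coeff f j) i) i) (\<alpha> * i + \<beta> * j))"
    by (simp add: weighted_scaling_def subst2_def)
  thus ?thesis
    unfolding coeff_sum by (auto simp: coeff_sum intro!: sum.cong)
qed

text \<open>
  The two linear coefficients survive in the scaled polynomial, at places where no other monomial
  contributes.
\<close>

lemma weighted_scaling_linear_terms:
  fixes f :: "'a::comm_ring_1 poly poly"
  assumes "\<alpha> > 0" "\<beta> > 0"
  shows "coeff (coeff (weighted_scaling \<alpha> \<beta> f) \<alpha>) 1 = coeff (coeff f 0) 1"
    and "coeff (coeff (weighted_scaling \<alpha> \<beta> f) \<beta>) 0 = coeff (coeff f 1) 0"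
proof -
  have "coeff (coeff (weighted_scaling \<alpha> \<beta> f) \<alpha>) 1 =
    (\<Sum>j\<le>degree f. if j = 0 then (\<Sum>i\<le>degree (coeff f 0). if i = 1 then coeff (coeff f 0) 1 else 0) else 0)"
    unfolding coeff_weighted_scaling
  proof (rule sum.cong[OF refl])
    fix j
    show "(\<Sum>i\<le>degree (coeff f j). if \<alpha> = \<alpha> * i + \<beta> * j \<and> 1 = i then coeff (coeff f j) i else 0) =
      (if j = 0 then (\<Sum>i\<le>degree (coeff f 0). if i = 1 then coeff (coeff f 0) 1 else 0) else 0)"
      using assms by (cases "j = 0") (auto intro!: sum.cong sum.neutral)
  qed
  also have "\<dots> = (\<Sum>i\<le>degree (coeff f 0). if i = 1 then coeff (coeff f 0) 1 else 0)" by simp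
  also have "\<dots> = coeff (coeff f 0) 1"
  proof (cases "1 \<le> degree (coeff f 0)")
    case False
    hence "coeff (coeff f 0) 1 = 0" by (intro coeff_eq_0) simp
    thus ?thesis by (simp cong: if_cong)
  qed simp
  finally show "coeff (coeff (weighted_scaling \<alpha> \<beta> f) \<alpha>) 1 = coeff (coeff f 0) 1" .
  have "coeff (coeff (weighted_scaling \<alpha> \<beta> f) \<beta>) 0 =
    (\<Sum>j\<le>degree f. if j = 1 then (\<Sum>i\<le>degree (coeff f 1). if i = 0 then coeff (coeff f 1) 0 else 0) else 0)"
    unfolding coeff_weighted_scaling
  proof (rule sum.cong[OF refl])
    fix j
    show "(\<Sum>i\<le>degree (coeff f j). if \<beta> = \<alpha> * i + \<beta> * j \<and> 0 = i then coeff (coeff f j) i else 0) =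
      (if j = 1 then (\<Sum>i\<le>degree (coeff f 1). if i = 0 then coeff (coeff f 1) 0 else 0) else 0)"
      using assms by (cases "j = 1") (auto intro!: sum.cong sum.neutral)
  qed
  also have "\<dots> = (if 1 \<le> degree f then coeff (coeff f 1) 0 else 0)" by simp
  also have "\<dots> = coeff (coeff f 1) 0"
  proof (cases "1 \<le> degree f")
    case False
    hence "coeff f 1 = 0" by (intro coeff_eq_0) simp
    thus ?thesis by simp
  qed simp
  finally show "coeff (coeff (weighted_scaling \<alpha> \<beta> f) \<beta>) 0 = coeff (coeff f 1) 0" .
qed

lemma value0_derivX: "value0 (derivX f) = coeff (coeff f 0) 1"
  and value0_derivY: "value0 (derivY f) = coeff (coeff f 1) 0"
  for f :: "'a::idom poly poly"
  by (simp_all add: value0_def poly_0_coeff_0 coeff_derivX coeff_pderiv derivY_def)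

lemma coeff_0_if_varY_power_dvd:
  assumes "varY ^ n dvd f" "k < n"
  shows "coeff f k = 0"
proof -
  have "varY ^ n = (monom 1 n :: 'a poly poly)"
    using monomial_conv_monom[of "1 :: 'a" 0 n] by simp
  thus ?thesis using assms by (simp add: monom_1_dvd_iff')
qed

text \<open>
  One of the products of linear coefficients in the Jacobian at the origin is nonzero.  So one of the parameters
  contains the monomial \<open>X\<close> and the other one \<open>Y\<close>, and their orders add up to at most \<open>\<alpha> + \<beta>\<close>.
\<close>

lemma varY_power_dvd_weighted_scaling_parameters:
  fixes A B :: "'a::field_gcd poly poly"
  assumes w: "\<alpha> > 0" "\<beta> > 0"
    and jac: "value0 (jacobian A B) \<noteq> 0"
    and dvd: "varY ^ n dvd weighted_scaling \<alpha> \<beta> (A * B)"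
  shows "n \<le> \<alpha> + \<beta>"
proof (rule ccontr)
  assume "\<not> n \<le> \<alpha> + \<beta>"
  hence "\<alpha> + \<beta> + 1 \<le> n" by simp
  hence "varY ^ (\<alpha> + \<beta> + 1) dvd weighted_scaling \<alpha> \<beta> (A * B)"
    by (rule dvd_trans[OF le_imp_power_dvd dvd])
  hence d: "varY ^ (\<alpha> + \<beta> + 1) dvd weighted_scaling \<alpha> \<beta> A * weighted_scaling \<alpha> \<beta> B"
    by (simp add: weighted_scaling_def)
  obtain x y where xy: "x + y = \<alpha> + \<beta> + 1" "varY ^ x dvd weighted_scaling \<alpha> \<beta> A"
    "varY ^ y dvd weighted_scaling \<alpha> \<beta> B"
    using prime_elem_power_dvd_prod[OF d prime_elem_varY] by (elim exE conjE)
  have "coeff (coeff A 0) 1 = 0 \<or> coeff (coeff B 1) 0 = 0"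
  proof (cases "x > \<alpha>")
    case True
    thus ?thesis using coeff_0_if_varY_power_dvd[OF xy(2)] weighted_scaling_linear_terms(1)[OF w, of A] by auto
  next
    case False
    hence "y > \<beta>" using xy(1) by linarith
    thus ?thesis using coeff_0_if_varY_power_dvd[OF xy(3)] weighted_scaling_linear_terms(2)[OF w, of B] by auto
  qed
  moreover have "coeff (coeff A 1) 0 = 0 \<or> coeff (coeff B 0) 1 = 0"
  proof (cases "x > \<beta>")
    case True
    thus ?thesis using coeff_0_if_varY_power_dvd[OF xy(2)] weighted_scaling_linear_terms(2)[OF w, of A] by auto
  next
    case False
    hence "y > \<alpha>" using xy(1) by linarith
    thus ?thesis using coeff_0_if_varY_power_dvd[OF xy(3)] weighted_scaling_linear_terms(1)[OF w, of B] by auto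
  qed
  ultimately have "value0 (jacobian A B) = 0"
    unfolding jacobian_def value0_diff value0_hom value0_derivX value0_derivY by auto
  thus False using jac by simp
qed

lemma value0_qbinom: "u > 0 \<Longrightarrow> v > 0 \<Longrightarrow> value0 (qbinom u v l) = 0"
  by (simp add: qbinom_def zero_power)

lemma weighted_scaling_qbinom:
  fixes l :: "'a::comm_ring_1"
  shows "weighted_scaling u v (qbinom u v l) = varY ^ (u * v) * (1 - const2 l * varX ^ v)"
proof -
  have "(varY ^ v) ^ u = (varY ^ (u * v) :: 'a poly poly)" "(varY ^ u) ^ v = (varY ^ (u * v) :: 'a poly poly)"
    by (simp_all only: power_mult[symmetric] mult.commute)
  thus ?thesis by (simp add: weighted_scaling_def qbinom_def power_mult_distrib algebra_simps)
qed

text \<open>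
  The left-hand side is the weighted order of the reduced equation of \<open>f\<close>.  Every prime divisor of \<open>f\<close>
  vanishes at the origin, hence divides \<open>A\<close> or \<open>B\<close>; so the reduced equation divides \<open>A * B\<close>.
\<close>

lemma (in factored_form) snc_weight_bound:
  assumes eq: "s * f = r * A ^ i * B ^ j" and r: "value0 r \<noteq> 0"
    and jac: "value0 (jacobian A B) \<noteq> 0"
  shows "u * of_bool (a > 0) + v * of_bool (b > 0) + u * v * card S \<le> u + v"
proof (rule varY_power_dvd_weighted_scaling_parameters[OF pos jac])
  have "\<Prod>prime_divisors dvd A * B"
  proof (rule prod_primes_dvd[OF finite_prime_divisors prime_divisors_prime _ prime_divisors_antichain])
    fix \<pi> assume \<pi>: "\<pi> \<in> prime_divisors"
    have p: "prime_elem \<pi>" by (rule prime_divisors_prime[OF \<pi>])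
    have "\<pi> dvd s * f" by (rule dvd_mult[OF prime_divisors_dvd[OF \<pi>]])
    hence "\<pi> dvd r * A ^ i * B ^ j" by (simp only: eq)
    moreover have "\<not> \<pi> dvd r"
    proof
      assume "\<pi> dvd r"
      then obtain k where "r = \<pi> * k" by (elim dvdE)
      moreover have "value0 \<pi> = 0"
        using \<pi> pos by (auto simp: prime_divisors_def value0_qbinom split: if_splits)
      ultimately show False using r by simp
    qed
    ultimately have "\<pi> dvd A ^ i \<or> \<pi> dvd B ^ j"
      using p by (simp add: prime_elem_dvd_mult_iff)
    thus "\<pi> dvd A * B"
      using prime_elem_dvd_power[OF p] by (auto intro: dvd_mult dvd_mult2)
  qed
  then obtain k where k: "A * B = \<Prod>prime_divisors * k" by (elim dvdE)
  define x y :: nat where "x = of_bool (a > 0)" and "y = of_bool (b > 0)"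
  have "weighted_scaling u v (\<Prod>prime_divisors) =
      (varX * varY ^ u) ^ x * (varY ^ v) ^ y * (\<Prod>l\<in>S. varY ^ (u * v) * (1 - const2 l * varX ^ v))"
    unfolding prod_prime_divisors x_def[symmetric] y_def[symmetric]
    using weighted_scaling_qbinom[of u v, where ?'a = 'a] by (simp add: weighted_scaling_def)
  also have "\<dots> = (varY ^ u) ^ x * (varY ^ v) ^ y * (varY ^ (u * v)) ^ card S *
      (varX ^ x * (\<Prod>l\<in>S. 1 - const2 l * varX ^ v))"
    by (simp add: prod.distrib power_mult_distrib mult_ac)
  also have "(varY ^ u) ^ x * (varY ^ v) ^ y * (varY ^ (u * v)) ^ card S =
      (varY ^ (u * x + v * y + u * v * card S) :: 'a poly poly)"
    by (simp only: power_add power_mult)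
  finally have e: "weighted_scaling u v (\<Prod>prime_divisors) = varY ^ (u * x + v * y + u * v * card S) *
      (varX ^ x * (\<Prod>l\<in>S. 1 - const2 l * varX ^ v))" .
  show "varY ^ (u * of_bool (a > 0) + v * of_bool (b > 0) + u * v * card S)
      dvd weighted_scaling u v (A * B)"
  proof -
    have "weighted_scaling u v (A * B) = weighted_scaling u v (\<Prod>prime_divisors) * weighted_scaling u v k"
      unfolding k by (simp add: weighted_scaling_def)
    thus ?thesis unfolding e x_def[symmetric] y_def[symmetric] by (simp only: mult.assoc dvd_triv_left)
  qed
qed

section \<open>Infinitely near points and the log canonical threshold\<close>

text \<open>
  At such a point the pullback of \<open>g\<close> and the Jacobian have only the coordinate axes as components;
  the two inequalities say that \<open>L\<close> is at most \<open>(k + 1) / N\<close> along both axes.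
\<close>

definition monomial_at :: "complex poly poly \<Rightarrow> real \<Rightarrow> near_point \<Rightarrow> nat \<Rightarrow> nat \<Rightarrow> nat \<Rightarrow> nat \<Rightarrow> bool" where
  "monomial_at g L t M N k1 k2 \<longleftrightarrow>
     (\<exists>r. value0 r \<noteq> 0 \<and> pullback g t = r * varX ^ M * varY ^ N) \<and>
     (\<exists>r. value0 r \<noteq> 0 \<and> pullback_jacobian t = r * varX ^ k1 * varY ^ k2) \<and>
     L * real M \<le> real (k1 + 1) \<and> L * real N \<le> real (k2 + 1)"

lemma pullback_Slope:
  "pullback g (t @ [Slope e]) = subst2 (pullback g t) varX (varX * (varY + const2 e))"
  "pullback_jacobian (t @ [Slope e]) =
     subst2 (pullback_jacobian t) varX (varX * (varY + const2 e)) * varX"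
  by (simp_all add: pullback_snoc pullback_jacobian_snoc)

lemma pullback_Vertical:
  "pullback g (t @ [Vertical]) = subst2 (pullback g t) (varX * varY) varY"
  "pullback_jacobian (t @ [Vertical]) = subst2 (pullback_jacobian t) (varX * varY) varY * varY"
  by (simp_all add: pullback_snoc pullback_jacobian_snoc)

text \<open>
  Blowing up adds the exponents along the two axes and one more for the Jacobian of the chart, so the
  inequalities for the new curve are the sums of the old ones.  In a direction that is not an axis, the
  strict transforms of both axes miss the new point.
\<close>

lemma monomial_at_snoc:
  assumes "monomial_at g L t M N k1 k2"
  shows "\<exists>M' N' k1' k2'. monomial_at g L (t @ [d]) M' N' k1' k2'"
proof -
  obtain r where r: "value0 r \<noteq> 0" "pullback g t = r * varX ^ M * varY ^ N"
    using assms by (auto simp: monomial_at_def)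
  obtain r' where r': "value0 r' \<noteq> 0" "pullback_jacobian t = r' * varX ^ k1 * varY ^ k2"
    using assms by (auto simp: monomial_at_def)
  have L: "L * real M \<le> real (k1 + 1)" "L * real N \<le> real (k2 + 1)"
    using assms by (auto simp: monomial_at_def)
  have LMN: "L * real (M + N) \<le> real (k1 + k2 + 1 + 1)" using L by (simp add: algebra_simps)
  show ?thesis
  proof (cases d)
    case (Slope e)
    let ?A = "varX" and ?B = "varX * (varY + const2 e)"
    have v: "value0 (subst2 r ?A ?B) \<noteq> 0" "value0 (subst2 r' ?A ?B) \<noteq> 0"
      using r(1) r'(1) by (simp_all add: value0_subst2)
    show ?thesis
    proof (cases "e = 0")
      case True
      have "pullback g (t @ [d]) = subst2 r ?A ?B * varX ^ (M + N) * varY ^ N"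
        "pullback_jacobian (t @ [d]) = subst2 r' ?A ?B * varX ^ (k1 + k2 + 1) * varY ^ k2"
        using True by (simp_all add: Slope pullback_Slope r(2) r'(2) power_mult_distrib power_add mult_ac)
      hence "monomial_at g L (t @ [d]) (M + N) N (k1 + k2 + 1) k2"
        unfolding monomial_at_def using v L LMN by blast
      thus ?thesis by blast
    next
      case False
      have "pullback g (t @ [d]) = (subst2 r ?A ?B * (varY + const2 e) ^ N) * varX ^ (M + N) * varY ^ 0"
        "pullback_jacobian (t @ [d]) =
           (subst2 r' ?A ?B * (varY + const2 e) ^ k2) * varX ^ (k1 + k2 + 1) * varY ^ 0"
        by (simp_all add: Slope pullback_Slope r(2) r'(2) power_mult_distrib power_add mult_ac)
      moreover have "value0 (subst2 r ?A ?B * (varY + const2 e) ^ N) \<noteq> 0"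
        "value0 (subst2 r' ?A ?B * (varY + const2 e) ^ k2) \<noteq> 0"
        using v False by simp_all
      moreover have "L * real 0 \<le> real (0 + 1)" by simp
      ultimately have "monomial_at g L (t @ [d]) (M + N) 0 (k1 + k2 + 1) 0"
        unfolding monomial_at_def using LMN by blast
      thus ?thesis by blast
    qed
  next
    case Vertical
    let ?A = "varX * varY :: complex poly poly" and ?B = "varY :: complex poly poly"
    have v: "value0 (subst2 r ?A ?B) \<noteq> 0" "value0 (subst2 r' ?A ?B) \<noteq> 0"
      using r(1) r'(1) by (simp_all add: value0_subst2)
    have "pullback g (t @ [d]) = subst2 r ?A ?B * varX ^ M * varY ^ (M + N)"
      "pullback_jacobian (t @ [d]) = subst2 r' ?A ?B * varX ^ k1 * varY ^ (k1 + k2 + 1)"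
      by (simp_all add: Vertical pullback_Vertical r(2) r'(2) power_mult_distrib power_add mult_ac)
    hence "monomial_at g L (t @ [d]) M (M + N) k1 (k1 + k2 + 1)"
      unfolding monomial_at_def using v L LMN by blast
    thus ?thesis by blast
  qed
qed

lemma monomial_at_multiplicity:
  assumes "monomial_at g L t M N k1 k2"
  shows "multiplicity varX (pullback g t) = M" "multiplicity varX (pullback_jacobian t) = k1"
  using assms multiplicity_varX_monomial unfolding monomial_at_def by force+

lemma monomial_at_snc:
  assumes "monomial_at g L t M N k1 k2"
  shows "snc_at_origin (pullback g t * pullback_jacobian t)"
proof -
  obtain r where r: "value0 r \<noteq> 0" "pullback g t = r * varX ^ M * varY ^ N"
    using assms by (auto simp: monomial_at_def)
  obtain r' where r': "value0 r' \<noteq> 0" "pullback_jacobian t = r' * varX ^ k1 * varY ^ k2"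
    using assms by (auto simp: monomial_at_def)
  have "1 * (pullback g t * pullback_jacobian t) = (r * r') * varX ^ (M + k1) * varY ^ (N + k2)"
    by (simp add: r(2) r'(2) power_add mult_ac)
  moreover have "value0 (r * r') \<noteq> 0" "value0 (1 :: complex poly poly) \<noteq> 0"
    "value0 (varX :: complex poly poly) = 0" "value0 (varY :: complex poly poly) = 0"
    "value0 (jacobian varX varY :: complex poly poly) \<noteq> 0"
    using r r' by (simp_all add: jacobian_def)
  ultimately show ?thesis unfolding snc_at_origin_def by blast
qed

text \<open>
  How the binomials pull back in the two charts of a blow-up, according to which weight is larger; the
  extracted power is the multiplicity along the exceptional curve.
\<close>

lemma qbinom_Slope_ge:
  assumes "\<beta> = \<alpha> + \<gamma>"
  shows "subst2 (qbinom \<alpha> \<beta> l) varX (varX * w) = varX ^ \<alpha> * (w ^ \<alpha> - const2 l * varX ^ \<gamma>)"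
  by (simp add: assms qbinom_def power_mult_distrib power_add algebra_simps)

lemma qbinom_Slope_le:
  assumes "\<alpha> = \<beta> + \<gamma>"
  shows "subst2 (qbinom \<alpha> \<beta> l) varX (varX * w) = varX ^ \<beta> * (varX ^ \<gamma> * w ^ \<alpha> - const2 l)"
  by (simp add: assms qbinom_def power_mult_distrib power_add algebra_simps)

lemma qbinom_Vertical_le:
  assumes "\<alpha> = \<beta> + \<gamma>"
  shows "subst2 (qbinom \<alpha> \<beta> l) (varX * varY) varY = varY ^ \<beta> * (varY ^ \<gamma> - const2 l * varX ^ \<beta>)"
  by (simp add: assms qbinom_def power_mult_distrib power_add algebra_simps)

lemma qbinom_Vertical_ge:
  assumes "\<beta> = \<alpha> + \<gamma>"
  shows "subst2 (qbinom \<alpha> \<beta> l) (varX * varY) varY = varY ^ \<alpha> * (1 - const2 l * varX ^ \<beta> * varY ^ \<gamma>)"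
  by (simp add: assms qbinom_def power_mult_distrib power_add algebra_simps)

text \<open>
  \<open>wd\<close> is the weighted degree of \<open>g\<close>.
\<close>

locale complex_form = factored_form u v a b c S m g
  for u v a b :: nat and c :: complex and S m g +
  fixes D wd :: nat
  assumes D_eq: "D = (\<Sum>l\<in>S. m l)" and wd_eq: "wd = u * a + v * b + u * v * D"
begin

lemma prod_power_factor: "(\<Prod>l\<in>S. (x ^ e * y l) ^ m l) = x ^ (e * D) * (\<Prod>l\<in>S. y l ^ m l)"
  for x :: "complex poly poly"
  by (simp add: D_eq power_mult_distrib prod.distrib power_sum power_mult)

text \<open>
  The chain of blow-ups that follows the monomial valuation with weights \<open>(u, v)\<close>.  In
  \<open>toric t \<alpha> \<beta> M N k1 k2\<close>, the numbers \<open>\<alpha>, \<beta>\<close> are the weights of this valuation in the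
  coordinates at \<open>t\<close>, the pullback of \<open>g\<close> has the exponents \<open>M, N\<close> along the axes, and
  the Jacobian has \<open>k1, k2\<close>.  The chain ends when both weights are \<open>1\<close>.
\<close>

inductive toric :: "near_point \<Rightarrow> nat \<Rightarrow> nat \<Rightarrow> nat \<Rightarrow> nat \<Rightarrow> nat \<Rightarrow> nat \<Rightarrow> bool" where
  Nil: "toric [] u v a b 0 0"
| Slope: "toric t \<alpha> \<beta> M N k1 k2 \<Longrightarrow> \<alpha> < \<beta> \<Longrightarrow>
    toric (t @ [Slope 0]) \<alpha> (\<beta> - \<alpha>) (M + N + \<alpha> * D) N (k1 + k2 + 1) k2"
| Vertical: "toric t \<alpha> \<beta> M N k1 k2 \<Longrightarrow> \<beta> < \<alpha> \<Longrightarrow>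
    toric (t @ [Vertical]) (\<alpha> - \<beta>) \<beta> M (M + N + \<beta> * D) k1 (k1 + k2 + 1)"

text \<open>
  The two equations say that the order of \<open>g\<close> along the valuation is \<open>wd\<close> and that its log
  discrepancy is \<open>u + v\<close>, computed in the coordinates at \<open>t\<close>.
\<close>

lemma toric_weights:
  assumes "toric t \<alpha> \<beta> M N k1 k2"
  shows "\<alpha> > 0" "\<beta> > 0" "Rings.coprime \<alpha> \<beta>"
    "\<alpha> * M + \<beta> * N + \<alpha> * \<beta> * D = wd" "\<alpha> * (k1 + 1) + \<beta> * (k2 + 1) = u + v"
proof -
  have "\<alpha> > 0 \<and> \<beta> > 0 \<and> Rings.coprime \<alpha> \<beta> \<and>
    \<alpha> * M + \<beta> * N + \<alpha> * \<beta> * D = wd \<and> \<alpha> * (k1 + 1) + \<beta> * (k2 + 1) = u + v"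
    using assms
  proof induction
    case Nil
    show ?case using pos coprime by (simp add: wd_eq)
  next
    case (Slope t \<alpha> \<beta> M N k1 k2)
    then obtain \<gamma> where \<gamma>: "\<beta> = \<alpha> + \<gamma>" "\<gamma> > 0" using less_imp_add_positive by blast
    have "Rings.coprime \<alpha> \<gamma>" using Slope.IH \<gamma>(1) by (simp add: coprime_iff_gcd_eq_1)
    thus ?case using Slope.IH \<gamma> by (simp add: algebra_simps)
  next
    case (Vertical t \<alpha> \<beta> M N k1 k2)
    then obtain \<gamma> where \<gamma>: "\<alpha> = \<beta> + \<gamma>" "\<gamma> > 0" using less_imp_add_positive by blast
    have "Rings.coprime \<gamma> \<beta>" using Vertical.IH \<gamma>(1)
      by (simp add: coprime_iff_gcd_eq_1 add.commute[of \<beta> \<gamma>])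
    thus ?case using Vertical.IH \<gamma> by (simp add: algebra_simps)
  qed
  thus "\<alpha> > 0" "\<beta> > 0" "Rings.coprime \<alpha> \<beta>"
    "\<alpha> * M + \<beta> * N + \<alpha> * \<beta> * D = wd" "\<alpha> * (k1 + 1) + \<beta> * (k2 + 1) = u + v"
    by auto
qed

lemma toric_pullback:
  assumes "toric t \<alpha> \<beta> M N k1 k2"
  shows "pullback g t = const2 c * varX ^ M * varY ^ N * (\<Prod>l\<in>S. qbinom \<alpha> \<beta> l ^ m l)"
    and "pullback_jacobian t = varX ^ k1 * varY ^ k2"
proof -
  have "pullback g t = const2 c * varX ^ M * varY ^ N * (\<Prod>l\<in>S. qbinom \<alpha> \<beta> l ^ m l) \<and>
    pullback_jacobian t = varX ^ k1 * varY ^ k2"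
    using assms
  proof induction
    case Nil
    show ?case by (simp add: f_eq)
  next
    case (Slope t \<alpha> \<beta> M N k1 k2)
    then obtain \<gamma> where \<gamma>: "\<beta> = \<alpha> + \<gamma>" using less_imp_add_positive by blast
    have q: "subst2 (qbinom \<alpha> \<beta> l) varX (varX * varY) = varX ^ \<alpha> * qbinom \<alpha> \<gamma> l" for l :: complex
      using qbinom_Slope_ge[OF \<gamma>, of l varY] by (simp add: qbinom_def)
    show ?case
    proof -
      have e: "(\<Prod>l\<in>S. subst2 (qbinom \<alpha> \<beta> l) varX (varX * varY) ^ m l) =
          varX ^ (\<alpha> * D) * (\<Prod>l\<in>S. qbinom \<alpha> \<gamma> l ^ m l)"
        by (simp only: q prod_power_factor)
      have "\<beta> - \<alpha> = \<gamma>" using \<gamma> by simp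
      with Slope.IH show ?thesis unfolding pullback_Slope
        by (simp add: e power_add power_mult_distrib mult_ac)
    qed
  next
    case (Vertical t \<alpha> \<beta> M N k1 k2)
    then obtain \<gamma> where \<gamma>: "\<alpha> = \<beta> + \<gamma>" using less_imp_add_positive by blast
    have q: "subst2 (qbinom \<alpha> \<beta> l) (varX * varY) varY = varY ^ \<beta> * qbinom \<gamma> \<beta> l" for l :: complex
      using qbinom_Vertical_le[OF \<gamma>, of l] by (simp add: qbinom_def)
    show ?case
    proof -
      have e: "(\<Prod>l\<in>S. subst2 (qbinom \<alpha> \<beta> l) (varX * varY) varY ^ m l) =
          varY ^ (\<beta> * D) * (\<Prod>l\<in>S. qbinom \<gamma> \<beta> l ^ m l)"
        by (simp only: q prod_power_factor)
      have "\<alpha> - \<beta> = \<gamma>" using \<gamma> by simp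
      with Vertical.IH show ?thesis unfolding pullback_Vertical
        by (simp add: e power_add power_mult_distrib mult_ac)
    qed
  qed
  thus "pullback g t = const2 c * varX ^ M * varY ^ N * (\<Prod>l\<in>S. qbinom \<alpha> \<beta> l ^ m l)"
    "pullback_jacobian t = varX ^ k1 * varY ^ k2" by auto
qed

lemma toric_factored_form:
  assumes "toric t \<alpha> \<beta> M N k1 k2"
  shows "factored_form \<alpha> \<beta> M N c S m (pullback g t)"
    and "factored_form \<alpha> \<beta> (M + k1) (N + k2) c S m (pullback g t * pullback_jacobian t)"
  using toric_weights[OF assms] toric_pullback[OF assms] roots m_pos c_nonzero
  by (unfold_locales, auto simp: power_add mult_ac)

lemma toric_multiplicity:
  assumes "toric t \<alpha> \<beta> M N k1 k2"
  shows "multiplicity varX (pullback g t) = M" "multiplicity varX (pullback_jacobian t) = k1"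
proof -
  show "multiplicity varX (pullback g t) = M"
    using toric_factored_form(1)[OF assms] by (rule factored_form.multiplicities(1))
  show "multiplicity varX (pullback_jacobian t) = k1"
    using multiplicity_varX_monomial[of "1 :: complex poly poly" k1 k2] toric_pullback(2)[OF assms] by simp
qed

definition admissible :: "real \<Rightarrow> bool" where
  "admissible L \<longleftrightarrow> L * real a \<le> 1 \<and> L * real b \<le> 1 \<and> (\<forall>l\<in>S. L * real (m l) \<le> 1) \<and>
     L * real wd \<le> real (u + v)"

text \<open>
  For \<open>\<alpha> \<le> \<beta>\<close> the vector \<open>(1, 1)\<close> of the next exceptional curve lies in the cone spanned by
  \<open>(1, 0)\<close> and \<open>(\<alpha>, \<beta>)\<close>, on which the orders of the binomials are linear.  So the bound
  is a positive combination of the bound for the first axis and of \<open>L * wd \<le> u + v\<close>.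
\<close>

lemma toric_exceptional_bound:
  assumes "toric t \<alpha> \<beta> M N k1 k2" "admissible L"
    and "L * real M \<le> real (k1 + 1)" "L * real N \<le> real (k2 + 1)"
  shows "L * real (M + N + min \<alpha> \<beta> * D) \<le> real (k1 + k2 + 1 + 1)"
proof -
  note w = toric_weights[OF assms(1)]
  have wd: "L * real (\<alpha> * M + \<beta> * N + \<alpha> * \<beta> * D) \<le> real (\<alpha> * (k1 + 1) + \<beta> * (k2 + 1))"
    using assms(2) w(4,5) by (simp add: admissible_def)
  show ?thesis
  proof (cases "\<alpha> \<le> \<beta>")
    case True
    then obtain \<gamma> where \<gamma>: "\<beta> = \<alpha> + \<gamma>" using le_Suc_ex by blast
    have "real \<beta> * (L * real (M + N + \<alpha> * D)) =
        L * real (\<alpha> * M + \<beta> * N + \<alpha> * \<beta> * D) + real \<gamma> * (L * real M)"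
      by (simp add: \<gamma> algebra_simps)
    also have "\<dots> \<le> real (\<alpha> * (k1 + 1) + \<beta> * (k2 + 1)) + real \<gamma> * real (k1 + 1)"
      by (intro add_mono wd mult_left_mono assms(3)) simp
    also have "\<dots> = real \<beta> * real (k1 + k2 + 1 + 1)" by (simp add: \<gamma> algebra_simps)
    finally have "L * real (M + N + \<alpha> * D) \<le> real (k1 + k2 + 1 + 1)"
      by (rule mult_left_le_imp_le) (use w(2) in simp)
    thus ?thesis using True by (simp add: min_absorb1)
  next
    case False
    then obtain \<gamma> where \<gamma>: "\<alpha> = \<beta> + \<gamma>" using le_Suc_ex nat_le_linear by blast
    have "real \<alpha> * (L * real (M + N + \<beta> * D)) =
        L * real (\<alpha> * M + \<beta> * N + \<alpha> * \<beta> * D) + real \<gamma> * (L * real N)"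
      by (simp add: \<gamma> algebra_simps)
    also have "\<dots> \<le> real (\<alpha> * (k1 + 1) + \<beta> * (k2 + 1)) + real \<gamma> * real (k2 + 1)"
      by (intro add_mono wd mult_left_mono assms(4)) simp
    also have "\<dots> = real \<alpha> * real (k1 + k2 + 1 + 1)" by (simp add: \<gamma> algebra_simps)
    finally have "L * real (M + N + \<beta> * D) \<le> real (k1 + k2 + 1 + 1)"
      by (rule mult_left_le_imp_le) (use w(1) in simp)
    thus ?thesis using False by (simp add: min_absorb2)
  qed
qed

lemma toric_bounds:
  assumes "toric t \<alpha> \<beta> M N k1 k2" "admissible L"
  shows "L * real M \<le> real (k1 + 1) \<and> L * real N \<le> real (k2 + 1)"
  using assms(1)
proof induction
  case Nil
  show ?case using assms(2) by (simp add: admissible_def)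
next
  case (Slope t \<alpha> \<beta> M N k1 k2)
  thus ?case using toric_exceptional_bound[OF Slope.hyps(1) assms(2)] by (simp add: min_absorb1)
next
  case (Vertical t \<alpha> \<beta> M N k1 k2)
  thus ?case using toric_exceptional_bound[OF Vertical.hyps(1) assms(2)] by (simp add: min_absorb2)
qed

text \<open>
  Away from the chain the strict transforms of the binomials miss the point, with one exception: when
  both weights are \<open>1\<close>, the binomials are the lines \<open>y = l * x\<close>, and the direction \<open>Slope l\<close> meets
  the strict transform of one of them, transversally, with multiplicity \<open>m l\<close>.
\<close>

lemma toric_Slope_off_path:
  assumes t: "toric t \<alpha> \<beta> M N k1 k2" and L: "admissible L" and off: "\<beta> \<le> \<alpha> \<or> e \<noteq> 0"
  shows "\<exists>N' k2'. monomial_at g L (t @ [Slope e]) (M + N + min \<alpha> \<beta> * D) N' (k1 + k2 + 1) k2'"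
proof -
  note w = toric_weights[OF t]
  note LB = toric_bounds[OF t L]
  note LE = toric_exceptional_bound[OF t L conjunct1[OF LB] conjunct2[OF LB]]
  let ?Y = "varY + const2 e :: complex poly poly"
  have pb: "pullback g (t @ [Slope e]) = const2 c * varX ^ (M + N) * ?Y ^ N *
      (\<Prod>l\<in>S. subst2 (qbinom \<alpha> \<beta> l) varX (varX * ?Y) ^ m l)"
    unfolding pullback_Slope toric_pullback[OF t]
    by (simp add: power_mult_distrib power_add mult_ac)
  have jac: "pullback_jacobian (t @ [Slope e]) = ?Y ^ k2 * varX ^ (k1 + k2 + 1)"
    unfolding pullback_Slope toric_pullback[OF t]
    by (simp add: power_mult_distrib power_add mult_ac)
  define e' where "e' = min \<alpha> \<beta>"
  \<comment> \<open>\<open>y l\<close> is the strict transform of the binomial with root \<open>l\<close>.\<close>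
  have fac: "\<exists>y. (\<forall>l. subst2 (qbinom \<alpha> \<beta> l) varX (varX * ?Y) = varX ^ e' * y l) \<and>
     (\<forall>l\<in>S. \<alpha> \<noteq> \<beta> \<longrightarrow> value0 (y l) \<noteq> 0) \<and> (\<forall>l. \<alpha> = \<beta> \<longrightarrow> y l = ?Y - const2 l)"
  proof (cases "\<alpha> < \<beta>")
    case True
    then obtain \<gamma> where \<gamma>: "\<beta> = \<alpha> + \<gamma>" "\<gamma> > 0" using less_imp_add_positive by blast
    show ?thesis
      by (rule exI[of _ "\<lambda>l. ?Y ^ \<alpha> - const2 l * varX ^ \<gamma>"])
         (use True off \<gamma>(2) qbinom_Slope_ge[OF \<gamma>(1), where ?'a = complex] in \<open>simp add: e'_def min_absorb1 zero_power\<close>)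
  next
    case False
    then obtain \<gamma> where \<gamma>: "\<alpha> = \<beta> + \<gamma>" using le_Suc_ex not_less by blast
    have ab: "\<alpha> = 1 \<and> \<beta> = 1" if "\<alpha> = \<beta>" using w(3) that by simp
    have y1: "varX ^ \<gamma> * ?Y ^ \<alpha> - const2 l = ?Y - const2 l" if "\<alpha> = \<beta>" for l
    proof -
      have "\<gamma> = 0" "\<alpha> = 1" using ab[OF that] \<gamma> by auto
      thus ?thesis by simp
    qed
    show ?thesis
      by (rule exI[of _ "\<lambda>l. varX ^ \<gamma> * ?Y ^ \<alpha> - const2 l"])
         (use False \<gamma> roots y1 qbinom_Slope_le[OF \<gamma>, where ?'a = complex] in
           \<open>auto simp: e'_def min_absorb2 zero_power\<close>)
  qed
  then obtain y where y: "\<And>l. subst2 (qbinom \<alpha> \<beta> l) varX (varX * ?Y) = varX ^ e' * y l"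
    "\<And>l. l \<in> S \<Longrightarrow> \<alpha> \<noteq> \<beta> \<Longrightarrow> value0 (y l) \<noteq> 0" "\<And>l. \<alpha> = \<beta> \<Longrightarrow> y l = ?Y - const2 l"
    by blast
  have pb': "pullback g (t @ [Slope e]) =
      (const2 c * ?Y ^ N * (\<Prod>l\<in>S. y l ^ m l)) * varX ^ (M + N + e' * D)"
    unfolding pb y(1) prod_power_factor by (simp add: power_add mult_ac)
  show ?thesis
  proof (cases "e = 0")
    case True
    hence unit: "value0 (y l) \<noteq> 0" if "l \<in> S" for l
      using y(2,3)[of l] that roots by (cases "\<alpha> = \<beta>") auto
    have "value0 (const2 c * (\<Prod>l\<in>S. y l ^ m l)) \<noteq> 0"
      using unit c_nonzero roots by (simp add: prod_zero_iff)
    moreover have "pullback g (t @ [Slope e]) =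
        (const2 c * (\<Prod>l\<in>S. y l ^ m l)) * varX ^ (M + N + e' * D) * varY ^ N"
      unfolding pb' using True by (simp add: mult_ac)
    moreover have "pullback_jacobian (t @ [Slope e]) = 1 * varX ^ (k1 + k2 + 1) * varY ^ k2"
      unfolding jac using True by (simp add: mult_ac)
    moreover have "value0 (1 :: complex poly poly) \<noteq> 0" by simp
    ultimately have "monomial_at g L (t @ [Slope e]) (M + N + e' * D) N (k1 + k2 + 1) k2"
      unfolding monomial_at_def using LE LB e'_def by blast
    thus ?thesis unfolding e'_def by blast
  next
    case e0: False
    have jac': "pullback_jacobian (t @ [Slope e]) = ?Y ^ k2 * varX ^ (k1 + k2 + 1) * varY ^ 0"
      unfolding jac by simp
    have vY: "value0 (?Y ^ n) \<noteq> 0" for n using e0 by simp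
    show ?thesis
    proof (cases "\<alpha> = \<beta> \<and> e \<in> S")
      case True
      have "(\<Prod>l\<in>S. y l ^ m l) = y e ^ m e * (\<Prod>l\<in>S - {e}. y l ^ m l)"
        using True roots by (intro prod.remove) auto
      also have "y e = varY" using True y(3)[of e] by simp
      finally have "pullback g (t @ [Slope e]) =
          (const2 c * ?Y ^ N * (\<Prod>l\<in>S - {e}. y l ^ m l)) * varX ^ (M + N + e' * D) * varY ^ m e"
        unfolding pb' by (simp add: mult_ac)
      moreover have "value0 (const2 c * ?Y ^ N * (\<Prod>l\<in>S - {e}. y l ^ m l)) \<noteq> 0"
        using True y(3) c_nonzero roots e0 by (auto simp: prod_zero_iff)
      moreover have "L * real (m e) \<le> real (0 + 1)"
        using L True by (simp add: admissible_def)
      ultimately have "monomial_at g L (t @ [Slope e]) (M + N + e' * D) (m e) (k1 + k2 + 1) 0"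
        unfolding monomial_at_def using LE jac' vY e'_def by blast
      thus ?thesis unfolding e'_def by blast
    next
      case False
      hence "value0 (y l) \<noteq> 0" if "l \<in> S" for l
        using y(2,3)[of l] that by (cases "\<alpha> = \<beta>") auto
      hence "value0 (const2 c * ?Y ^ N * (\<Prod>l\<in>S. y l ^ m l)) \<noteq> 0"
        using c_nonzero roots e0 by (simp add: prod_zero_iff)
      moreover have "pullback g (t @ [Slope e]) =
          (const2 c * ?Y ^ N * (\<Prod>l\<in>S. y l ^ m l)) * varX ^ (M + N + e' * D) * varY ^ 0"
        unfolding pb' by simp
      moreover have "L * real 0 \<le> real (0 + 1)" by simp
      ultimately have "monomial_at g L (t @ [Slope e]) (M + N + e' * D) 0 (k1 + k2 + 1) 0"
        unfolding monomial_at_def using LE jac' vY e'_def by blast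
      thus ?thesis unfolding e'_def by blast
    qed
  qed
qed

lemma toric_Vertical_off_path:
  assumes t: "toric t \<alpha> \<beta> M N k1 k2" and L: "admissible L" and off: "\<alpha> \<le> \<beta>"
  shows "monomial_at g L (t @ [Vertical]) M (M + N + \<alpha> * D) k1 (k1 + k2 + 1)"
proof -
  note w = toric_weights[OF t]
  note LB = toric_bounds[OF t L]
  note LE = toric_exceptional_bound[OF t L conjunct1[OF LB] conjunct2[OF LB]]
  obtain \<gamma> where \<gamma>: "\<beta> = \<alpha> + \<gamma>" using off le_Suc_ex by blast
  let ?y = "\<lambda>l. 1 - const2 l * varX ^ \<beta> * varY ^ \<gamma> :: complex poly poly"
  have "pullback g (t @ [Vertical]) =
      (const2 c * (\<Prod>l\<in>S. ?y l ^ m l)) * varX ^ M * varY ^ (M + N + \<alpha> * D)"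
  proof -
    have e: "(\<Prod>l\<in>S. subst2 (qbinom \<alpha> \<beta> l) (varX * varY) varY ^ m l) =
        varY ^ (\<alpha> * D) * (\<Prod>l\<in>S. ?y l ^ m l)"
      by (simp only: qbinom_Vertical_ge[OF \<gamma>] prod_power_factor)
    show ?thesis
      unfolding pullback_Vertical toric_pullback[OF t]
      by (simp add: e power_mult_distrib power_add mult_ac)
  qed
  moreover have "value0 (const2 c * (\<Prod>l\<in>S. ?y l ^ m l)) \<noteq> 0"
    using c_nonzero w roots by (simp add: prod_zero_iff zero_power)
  moreover have "pullback_jacobian (t @ [Vertical]) = 1 * varX ^ k1 * varY ^ (k1 + k2 + 1)"
    unfolding pullback_Vertical toric_pullback[OF t]
    by (simp add: power_mult_distrib power_add mult_ac)
  moreover have "value0 (1 :: complex poly poly) \<noteq> 0" by simp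
  ultimately show ?thesis
    unfolding monomial_at_def using LE LB off by (auto simp: min_absorb1)
qed

text \<open>
  A point that has left the chain stays monomial under all further blow-ups.
\<close>

lemma near_point_cases:
  assumes L: "admissible L"
  shows "(\<exists>\<alpha> \<beta> M N k1 k2. toric t \<alpha> \<beta> M N k1 k2) \<or> (\<exists>M N k1 k2. monomial_at g L t M N k1 k2)"
proof (induction t rule: rev_induct)
  case Nil
  show ?case using toric.Nil by blast
next
  case (snoc d t)
  from snoc.IH show ?case
  proof
    assume "\<exists>M N k1 k2. monomial_at g L t M N k1 k2"
    thus ?thesis using monomial_at_snoc by blast
  next
    assume "\<exists>\<alpha> \<beta> M N k1 k2. toric t \<alpha> \<beta> M N k1 k2"
    then obtain \<alpha> \<beta> M N k1 k2 where t: "toric t \<alpha> \<beta> M N k1 k2" by blast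
    show ?thesis
    proof (cases d)
      case (Slope e)
      show ?thesis
      proof (cases "\<alpha> < \<beta> \<and> e = 0")
        case True
        thus ?thesis using toric.Slope[OF t] Slope by blast
      next
        case False
        thus ?thesis using toric_Slope_off_path[OF t L, of e] Slope by (meson not_less)
      qed
    next
      case Vertical
      show ?thesis
      proof (cases "\<beta> < \<alpha>")
        case True
        thus ?thesis using toric.Vertical[OF t] Vertical by blast
      next
        case False
        thus ?thesis using toric_Vertical_off_path[OF t L] Vertical by (meson not_less)
      qed
    qed
  qed
qed

lemma exceptional_bound:
  assumes "admissible L"
  shows "L * real (exc_order g t) \<le> real (exc_discrepancy t + 1)"
  using near_point_cases[OF assms, of "t @ [Slope 0]"]
proof
  assume "\<exists>\<alpha> \<beta> M N k1 k2. toric (t @ [Slope 0]) \<alpha> \<beta> M N k1 k2"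
  then obtain \<alpha> \<beta> M N k1 k2 where *: "toric (t @ [Slope 0]) \<alpha> \<beta> M N k1 k2" by blast
  from toric_bounds[OF * assms] toric_multiplicity[OF *] show ?thesis
    by (simp add: exc_order_def exc_discrepancy_def)
next
  assume "\<exists>M N k1 k2. monomial_at g L (t @ [Slope 0]) M N k1 k2"
  then obtain M N k1 k2 where *: "monomial_at g L (t @ [Slope 0]) M N k1 k2" by blast
  from * monomial_at_multiplicity[OF *] show ?thesis
    by (simp add: exc_order_def exc_discrepancy_def monomial_at_def)
qed

text \<open>
  The curve created by blowing up \<open>t\<close> is visible at \<open>t @ [Slope 0]\<close>, which is the next point of the chain
  or has left it; in the latter case the exponents come from the monomial form for \<open>L = 0\<close>.
\<close>

lemma exc_toric:
  assumes t: "toric t \<alpha> \<beta> M N k1 k2"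
  shows "exc_order g t = M + N + min \<alpha> \<beta> * D" "exc_discrepancy t = k1 + k2 + 1"
proof -
  have "exc_order g t = M + N + min \<alpha> \<beta> * D \<and> exc_discrepancy t = k1 + k2 + 1"
  proof (cases "\<alpha> < \<beta>")
    case True
    from toric_multiplicity[OF toric.Slope[OF t True]] True show ?thesis
      by (simp add: exc_order_def exc_discrepancy_def min_absorb1)
  next
    case False
    have "admissible 0" by (simp add: admissible_def)
    then obtain N' k2' where
      "monomial_at g 0 (t @ [Slope 0]) (M + N + min \<alpha> \<beta> * D) N' (k1 + k2 + 1) k2'"
      using toric_Slope_off_path[OF t, of 0 0] False by auto
    from monomial_at_multiplicity[OF this] show ?thesis
      by (simp add: exc_order_def exc_discrepancy_def)
  qed
  thus "exc_order g t = M + N + min \<alpha> \<beta> * D" "exc_discrepancy t = k1 + k2 + 1" by auto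
qed

definition toric_points :: "near_point set" where
  "toric_points = {t. \<exists>\<alpha> \<beta> M N k1 k2. toric t \<alpha> \<beta> M N k1 k2}"

lemma toric_pointsI: "toric t \<alpha> \<beta> M N k1 k2 \<Longrightarrow> t \<in> toric_points"
  unfolding toric_points_def by blast

lemma toric_points_snoc:
  assumes "t @ [d] \<in> toric_points"
  shows "t \<in> toric_points"
proof -
  obtain \<alpha> \<beta> M N k1 k2 where "toric (t @ [d]) \<alpha> \<beta> M N k1 k2"
    using assms by (auto simp: toric_points_def)
  thus ?thesis by cases (auto intro: toric_pointsI)
qed

lemma finite_toric_points: "finite toric_points"
proof (rule finite_subset)
  show "toric_points \<subseteq> {t. set t \<subseteq> {Slope 0, Vertical} \<and> length t \<le> u + v}"
  proof
    fix t assume "t \<in> toric_points"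
    then obtain \<alpha> \<beta> M N k1 k2 where t: "toric t \<alpha> \<beta> M N k1 k2"
      by (auto simp: toric_points_def)
    hence "set t \<subseteq> {Slope 0, Vertical} \<and> length t + \<alpha> + \<beta> \<le> u + v"
    proof induction
      case (Slope t \<alpha> \<beta> M N k1 k2)
      thus ?case using toric_weights(1)[OF Slope.hyps(1)] by auto
    next
      case (Vertical t \<alpha> \<beta> M N k1 k2)
      thus ?case using toric_weights(2)[OF Vertical.hyps(1)] by auto
    qed simp
    thus "t \<in> {t. set t \<subseteq> {Slope 0, Vertical} \<and> length t \<le> u + v}" by simp
  qed
  show "finite {t. set t \<subseteq> {Slope 0, Vertical} \<and> length t \<le> u + v}"
    by (rule finite_lists_length_le) simp
qed

lemma log_resolution_toric_points: "log_resolution g toric_points"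
  unfolding log_resolution_def
proof (intro conjI allI impI)
  show "finite toric_points" by (rule finite_toric_points)
  show "t \<in> toric_points" if "t @ [d] \<in> toric_points" for t d
    using that by (rule toric_points_snoc)
  fix t assume "t \<notin> toric_points \<and> (t = [] \<or> butlast t \<in> toric_points)"
  moreover have "admissible 0" by (simp add: admissible_def)
  ultimately obtain M N k1 k2 where "monomial_at g 0 t M N k1 k2"
    using near_point_cases[of 0 t] by (auto simp: toric_points_def)
  thus "snc_at_origin (pullback g t * pullback_jacobian t)" by (rule monomial_at_snc)
qed

text \<open>
  An axis at a point of the chain is either a strict transform of one of the original axes or
  an exceptional curve of an earlier point of the chain.
\<close>

lemma toric_axes:
  assumes "toric t \<alpha> \<beta> M N k1 k2"
  shows "(k1 = 0 \<and> M = a \<or>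
            (\<exists>t'\<in>toric_points. length t' < length t \<and> exc_order g t' = M \<and> exc_discrepancy t' = k1)) \<and>
         (k2 = 0 \<and> N = b \<or>
            (\<exists>t'\<in>toric_points. length t' < length t \<and> exc_order g t' = N \<and> exc_discrepancy t' = k2))"
  using assms
proof induction
  case Nil
  show ?case by simp
next
  case (Slope t \<alpha> \<beta> M N k1 k2)
  have "t \<in> toric_points" by (rule toric_pointsI[OF Slope.hyps(1)])
  moreover have "exc_order g t = M + N + \<alpha> * D" "exc_discrepancy t = k1 + k2 + 1"
    using exc_toric[OF Slope.hyps(1)] Slope.hyps(2) by (simp_all add: min_absorb1)
  ultimately show ?case using Slope.IH by (auto intro: less_SucI)
next
  case (Vertical t \<alpha> \<beta> M N k1 k2)
  have "t \<in> toric_points" by (rule toric_pointsI[OF Vertical.hyps(1)])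
  moreover have "exc_order g t = M + N + \<beta> * D" "exc_discrepancy t = k1 + k2 + 1"
    using exc_toric[OF Vertical.hyps(1)] Vertical.hyps(2) by (simp_all add: min_absorb2)
  ultimately show ?case using Vertical.IH by (auto intro: less_SucI)
qed

lemma ex_toric_equal_weights: "\<exists>t M N k1 k2. toric t 1 1 M N k1 k2"
proof -
  have "\<exists>t M N k1 k2. toric t 1 1 M N k1 k2" if "toric t \<alpha> \<beta> M N k1 k2" for t \<alpha> \<beta> M N k1 k2
    using that
  proof (induction "\<alpha> + \<beta>" arbitrary: t \<alpha> \<beta> M N k1 k2 rule: less_induct)
    case less
    note w = toric_weights[OF less.prems]
    consider "\<alpha> < \<beta>" | "\<beta> < \<alpha>" | "\<alpha> = \<beta>" by linarith
    thus ?case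
    proof cases
      case 1
      show ?thesis by (rule less.hyps[OF _ toric.Slope[OF less.prems 1]]) (use 1 w(1) in simp)
    next
      case 2
      show ?thesis by (rule less.hyps[OF _ toric.Vertical[OF less.prems 2]]) (use 2 w(2) in simp)
    next
      case 3
      hence "\<alpha> = 1" "\<beta> = 1" using w(3) by auto
      thus ?thesis using less.prems by blast
    qed
  qed
  thus ?thesis using toric.Nil by blast
qed

text \<open>
  The set whose minimum is the log canonical threshold computed on the surface given by \<open>T\<close>.
\<close>

definition thresholds :: "near_point set \<Rightarrow> real set" where
  "thresholds T =
     {real (exc_discrepancy t + 1) / real (exc_order g t) | t. t \<in> T \<and> exc_order g t > 0} \<union>
     {1 / real (multiplicity h g) | h. irreducible h \<and> h dvd g \<and> value0 h = 0}"

lemma lct_via_eq: "lct_via g T = Min (thresholds T)"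
  by (simp add: lct_via_def thresholds_def)

lemma branch_thresholds:
  "a > 0 \<Longrightarrow> 1 / real a \<in> thresholds T" "b > 0 \<Longrightarrow> 1 / real b \<in> thresholds T"
  "l \<in> S \<Longrightarrow> 1 / real (m l) \<in> thresholds T"
proof -
  have *: "1 / real (multiplicity h g) \<in> thresholds T"
    if "h \<in> prime_divisors" "value0 h = 0" for h
    using that prime_divisors_dvd[OF that(1)]
      Factorial_Ring.prime_elem_imp_irreducible[OF prime_divisors_prime[OF that(1)]]
    unfolding thresholds_def by blast
  show "a > 0 \<Longrightarrow> 1 / real a \<in> thresholds T"
    using *[of varX] multiplicities(1) by (simp add: prime_divisors_def)
  show "b > 0 \<Longrightarrow> 1 / real b \<in> thresholds T"
    using *[of varY] multiplicities(2) by (simp add: prime_divisors_def)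
  show "1 / real (m l) \<in> thresholds T" if "l \<in> S"
    using *[of "qbinom u v l"] multiplicities(3)[OF that] that value0_qbinom[OF pos, of l]
    by (simp add: prime_divisors_def)
qed

lemma branch_threshold_cases:
  assumes "irreducible h" "h dvd g"
  shows "multiplicity h g \<in> ({a, b} - {0}) \<union> m ` S"
  using multiplicity_irreducible[OF assms] by auto

lemma finite_thresholds:
  assumes "finite T"
  shows "finite (thresholds T)"
proof -
  have "thresholds T \<subseteq> (\<lambda>t. real (exc_discrepancy t + 1) / real (exc_order g t)) ` T \<union>
      (\<lambda>n. 1 / real n) ` (({a, b} - {0}) \<union> m ` S)"
    unfolding thresholds_def using branch_threshold_cases by blast
  thus ?thesis by (rule finite_subset) (use assms roots in simp)
qed

lemma thresholds_nonempty:
  assumes "wd > 0"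
  shows "thresholds T \<noteq> {}"
proof -
  have "a > 0 \<or> b > 0 \<or> S \<noteq> {}" using assms by (auto simp: wd_eq D_eq)
  thus ?thesis using branch_thresholds[where T = T] by blast
qed

lemma admissible_le_threshold:
  assumes L: "admissible L" and x: "x \<in> thresholds T"
  shows "L \<le> x"
  using x unfolding thresholds_def
proof (elim UnE CollectE exE conjE)
  fix t assume t: "x = real (exc_discrepancy t + 1) / real (exc_order g t)" "exc_order g t > 0"
  show ?thesis using exceptional_bound[OF L, of t] t by (simp add: pos_le_divide_eq)
next
  fix h assume h: "x = 1 / real (multiplicity h g)" "irreducible h" "h dvd g"
  have "multiplicity h g > 0" "L * real (multiplicity h g) \<le> 1"
    using branch_threshold_cases[OF h(2,3)] L m_pos by (auto simp: admissible_def)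
  thus ?thesis using h(1) by (simp add: pos_le_divide_eq)
qed

text \<open>
  If \<open>T\<close> contains the chain, the last curve of the chain attains the bound.  Otherwise the first point of
  the chain outside \<open>T\<close> has simple normal crossings, and all components through it contribute to the
  minimum \<open>x\<close>: the product of \<open>x\<close> with the multiplicity of such a component is at most \<open>k + 1\<close>.
  Adding these inequalities with the weights of the components bounds \<open>x * wd\<close>, and
  \<open>snc_weight_bound\<close> shows that the bound is at most \<open>u + v\<close>.
\<close>

lemma Min_thresholds_wd:
  assumes res: "log_resolution g T" and wd: "wd > 0"
  shows "Min (thresholds T) * real wd \<le> real (u + v)"
proof -
  define x where "x = Min (thresholds T)"
  have fin: "finite T" using res by (simp add: log_resolution_def)
  have x_le: "x \<le> y" if "y \<in> thresholds T" for y
    unfolding x_def using finite_thresholds[OF fin] that by (rule Min_le)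
  have exc: "x * real (exc_order g t) \<le> real (exc_discrepancy t + 1)" if "t \<in> T" for t
  proof (cases "exc_order g t = 0")
    case False
    hence "x \<le> real (exc_discrepancy t + 1) / real (exc_order g t)"
      using that by (intro x_le) (auto simp: thresholds_def)
    thus ?thesis using False by (simp add: pos_le_divide_eq)
  qed simp
  have ax: "x * real a \<le> 1" "x * real b \<le> 1"
    using x_le[OF branch_thresholds(1)] x_le[OF branch_thresholds(2)]
    by (cases "a = 0"; cases "b = 0"; simp add: pos_le_divide_eq)+
  have ml: "x * real (m l) \<le> 1" if "l \<in> S" for l
    using x_le[OF branch_thresholds(3)[OF that]] m_pos[OF that] by (simp add: pos_le_divide_eq)
  show ?thesis
  proof (cases "toric_points \<subseteq> T")
    case True
    obtain t M N k1 k2 where t: "toric t 1 1 M N k1 k2" using ex_toric_equal_weights by blast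
    have "t \<in> T" using True toric_pointsI[OF t] by (rule subsetD)
    moreover have "exc_order g t = wd" "exc_discrepancy t + 1 = u + v"
      using toric_weights(4,5)[OF t] exc_toric[OF t] by simp_all
    ultimately show ?thesis using exc[of t] by (simp only: x_def)
  next
    case False
    define t where "t = (ARG_MIN length t. t \<in> toric_points \<and> t \<notin> T)"
    have t: "t \<in> toric_points" "t \<notin> T"
      using arg_min_natI[of "\<lambda>t. t \<in> toric_points \<and> t \<notin> T" _ length] False unfolding t_def by auto
    have shorter: "t' \<in> T" if "t' \<in> toric_points" "length t' < length t" for t'
      using arg_min_nat_le[of "\<lambda>t. t \<in> toric_points \<and> t \<notin> T" t' length] that
      unfolding t_def[symmetric] by auto
    obtain \<alpha> \<beta> M N k1 k2 where tor: "toric t \<alpha> \<beta> M N k1 k2"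
      using t(1) by (auto simp: toric_points_def)
    note w = toric_weights[OF tor]
    have "t = [] \<or> butlast t \<in> T"
    proof (cases t rule: rev_cases)
      case (snoc t' d)
      thus ?thesis using toric_points_snoc[of t' d] t(1) shorter[of t'] by simp
    qed simp
    hence "snc_at_origin (pullback g t * pullback_jacobian t)"
      using res t(2) unfolding log_resolution_def by blast
    then obtain A B r s i j where snc: "s * (pullback g t * pullback_jacobian t) = r * A ^ i * B ^ j"
      "value0 r \<noteq> 0" "value0 (jacobian A B) \<noteq> 0"
      unfolding snc_at_origin_def by blast
    have bound: "\<alpha> * of_bool (M + k1 > 0) + \<beta> * of_bool (N + k2 > 0) + \<alpha> * \<beta> * card S \<le> \<alpha> + \<beta>"
      using toric_factored_form(2)[OF tor] snc by (rule factored_form.snc_weight_bound)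
    have M: "x * real M \<le> real (k1 + of_bool (M + k1 > 0))"
    proof (cases "M = 0")
      case False
      have "x * real M \<le> real (k1 + 1)"
        using conjunct1[OF toric_axes[OF tor]]
      proof (elim disjE bexE conjE)
        fix t' assume t': "t' \<in> toric_points" "length t' < length t" "exc_order g t' = M"
          "exc_discrepancy t' = k1"
        show ?thesis using exc[OF shorter[OF t'(1,2)]] t'(3,4) by simp
      qed (use ax(1) in simp)
      thus ?thesis using False by simp
    qed simp
    have N: "x * real N \<le> real (k2 + of_bool (N + k2 > 0))"
    proof (cases "N = 0")
      case False
      have "x * real N \<le> real (k2 + 1)"
        using conjunct2[OF toric_axes[OF tor]]
      proof (elim disjE bexE conjE)
        fix t' assume t': "t' \<in> toric_points" "length t' < length t" "exc_order g t' = N"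
          "exc_discrepancy t' = k2"
        show ?thesis using exc[OF shorter[OF t'(1,2)]] t'(3,4) by simp
      qed (use ax(2) in simp)
      thus ?thesis using False by simp
    qed simp
    have D: "x * real D \<le> real (card S)"
    proof -
      have "x * real D = (\<Sum>l\<in>S. x * real (m l))" by (simp add: D_eq sum_distrib_left)
      also have "\<dots> \<le> (\<Sum>l\<in>S. 1)" by (intro sum_mono ml)
      finally show ?thesis by simp
    qed
    have "x * real wd = real \<alpha> * (x * real M) + real \<beta> * (x * real N) + real (\<alpha> * \<beta>) * (x * real D)"
      by (simp flip: w(4) add: algebra_simps)
    also have "\<dots> \<le> real \<alpha> * real (k1 + of_bool (M + k1 > 0)) +
        real \<beta> * real (k2 + of_bool (N + k2 > 0)) + real (\<alpha> * \<beta>) * real (card S)"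
      by (intro add_mono mult_left_mono M N D) simp_all
    also have "\<dots> = real (\<alpha> * k1 + \<beta> * k2 +
        (\<alpha> * of_bool (M + k1 > 0) + \<beta> * of_bool (N + k2 > 0) + \<alpha> * \<beta> * card S))"
      by (simp add: algebra_simps)
    also have "\<dots> \<le> real (\<alpha> * k1 + \<beta> * k2 + (\<alpha> + \<beta>))"
      using bound by (simp only: of_nat_le_iff add_le_cancel_left)
    also have "\<alpha> * k1 + \<beta> * k2 + (\<alpha> + \<beta>) = u + v"
      using w(5) by (simp add: algebra_simps)
    finally show ?thesis by (simp add: x_def)
  qed
qed

text \<open>
  The points of the chain form a log resolution, so the choice in the definition of the threshold picks
  a log resolution; which one does not matter by the bounds above.
\<close>

theorem lct_greatest_admissible:
  assumes "wd > 0"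
  shows "admissible (lct g)" "admissible L \<Longrightarrow> L \<le> lct g"
proof -
  define T where "T = (SOME T. log_resolution g T)"
  have T: "log_resolution g T" unfolding T_def using log_resolution_toric_points by (rule someI)
  have fin: "finite (thresholds T)"
    using T by (intro finite_thresholds) (simp add: log_resolution_def)
  have lct: "lct g = Min (thresholds T)" by (simp add: lct_def lct_via_eq T_def)
  show "L \<le> lct g" if "admissible L"
    unfolding lct using Min_in[OF fin thresholds_nonempty[OF assms]] by (rule admissible_le_threshold[OF that])
  have le: "lct g \<le> y" if "y \<in> thresholds T" for y unfolding lct using fin that by (rule Min_le)
  show "admissible (lct g)"
    unfolding admissible_def
  proof (intro conjI ballI)
    show "lct g * real a \<le> 1"
      using le[OF branch_thresholds(1)] by (cases "a = 0") (simp_all add: pos_le_divide_eq)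
    show "lct g * real b \<le> 1"
      using le[OF branch_thresholds(2)] by (cases "b = 0") (simp_all add: pos_le_divide_eq)
    show "lct g * real (m l) \<le> 1" if "l \<in> S" for l
      using le[OF branch_thresholds(3)[OF that]] m_pos[OF that] by (simp add: pos_le_divide_eq)
    show "lct g * real wd \<le> real (u + v)"
      unfolding lct by (rule Min_thresholds_wd[OF T assms])
  qed
qed

end

section \<open>Descent of ideal membership along Frobenius\<close>

text \<open>
  The homogenization of \<open>F\<close> of degree \<open>degree F\<close> lies in the ideal \<open>(s ^ A, t ^ B)\<close>, where \<open>t\<close> is
  the variable of \<open>F\<close> and \<open>s\<close> the homogenizing one.  Integer bounds are used since both may be negative,
  in which case the condition holds trivially.
\<close>

definition flanked :: "int \<Rightarrow> int \<Rightarrow> 'a::zero poly \<Rightarrow> bool" where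
  "flanked A B F \<longleftrightarrow> (\<forall>k. coeff F k \<noteq> 0 \<longrightarrow> B \<le> int k \<or> A \<le> int (degree F) - int k)"

lemma flanked_mono: "flanked A B F \<Longrightarrow> A' \<le> A \<Longrightarrow> B' \<le> B \<Longrightarrow> flanked A' B' F"
  unfolding flanked_def by (meson order_trans)

lemma flanked_mult:
  fixes F G :: "'a::idom poly"
  assumes "flanked A B F"
  shows "flanked A B (F * G)"
proof (cases "F = 0 \<or> G = 0")
  case False
  show ?thesis unfolding flanked_def
  proof (intro allI impI)
    fix k assume "coeff (F * G) k \<noteq> 0"
    then obtain i where i: "i \<le> k" "coeff F i \<noteq> 0" "coeff G (k - i) \<noteq> 0"
      unfolding coeff_mult by (metis (no_types, lifting) atMost_iff mult_eq_0_iff sum.neutral)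
    have "k - i \<le> degree G" using i(3) le_degree by blast
    moreover have "degree (F * G) = degree F + degree G" using False by (simp add: degree_mult_eq)
    moreover have "B \<le> int i \<or> A \<le> int (degree F) - int i" using assms i(2) by (auto simp: flanked_def)
    ultimately show "B \<le> int k \<or> A \<le> int (degree (F * G)) - int k" using i(1) by linarith
  qed
qed (auto simp: flanked_def)

lemma coeff_power_CHAR:
  fixes F :: "'a::idom poly"
  assumes p: "prime CHAR('a)" and "coeff (F ^ CHAR('a)) k \<noteq> 0"
  shows "\<exists>i. k = CHAR('a) * i \<and> coeff F i \<noteq> 0"
  using assms(2)
proof (induction F arbitrary: k rule: pCons_induct)
  case 0
  thus ?case using p prime_gt_0_nat by (simp add: zero_power)
next
  case (pCons a F)
  let ?p = "CHAR('a)"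
  have pp: "prime CHAR('a poly)" using p by simp
  have "pCons a F = [:a:] + monom 1 1 * F" by (simp add: monom_Suc monom_0)
  hence "pCons a F ^ ?p = [:a:] ^ ?p + monom 1 ?p * F ^ ?p"
    using freshmans_dream[OF pp refl, of "[:a:]" "monom 1 1 * F" ] 
    by (simp add: power_mult_distrib monom_power)
  hence *: "coeff (pCons a F ^ ?p) k =
     (if k = 0 then a ^ ?p else 0) + (if ?p \<le> k then coeff (F ^ ?p) (k - ?p) else 0)"
    by (simp add: poly_const_pow coeff_monom_mult coeff_pCons split: nat.split)
  show ?case
  proof (cases "k = 0")
    case True
    thus ?thesis using * pCons.prems p prime_gt_0_nat[OF p]
      by (intro exI[of _ 0]) (auto simp: zero_power)
  next
    case False
    hence "?p \<le> k" "coeff (F ^ ?p) (k - ?p) \<noteq> 0" using * pCons.prems by (auto split: if_splits)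
    from pCons.IH[OF this(2)] obtain i where "k - ?p = ?p * i" "coeff F i \<noteq> 0" by blast
    with \<open>?p \<le> k\<close> show ?thesis by (intro exI[of _ "Suc i"]) auto
  qed
qed

lemma flanked_power_CHAR:
  fixes F :: "'a::idom poly"
  assumes p: "prime CHAR('a)" and "flanked A B F"
  shows "flanked (int CHAR('a) * A) (int CHAR('a) * B) (F ^ CHAR('a))"
  unfolding flanked_def
proof (intro allI impI)
  fix k assume "coeff (F ^ CHAR('a)) k \<noteq> 0"
  then obtain i where i: "k = CHAR('a) * i" "coeff F i \<noteq> 0" using coeff_power_CHAR[OF p] by blast
  let ?p = "int CHAR('a)"
  have "degree (F ^ CHAR('a)) = CHAR('a) * degree F"
    using i(2) by (subst degree_power_eq) auto
  moreover have "B \<le> int i \<or> A \<le> int (degree F) - int i" using assms i(2) by (auto simp: flanked_def)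
  hence "?p * B \<le> ?p * int i \<or> ?p * A \<le> ?p * (int (degree F) - int i)"
    by (meson mult_left_mono of_nat_0_le_iff)
  ultimately show "?p * B \<le> int k \<or> ?p * A \<le> int (degree (F ^ CHAR('a))) - int k"
    using i(1) by (simp add: algebra_simps)
qed

text \<open>
  Only exponents divisible by \<open>p\<close> occur, and the coefficients have \<open>p\<close>-th roots.
\<close>

lemma pderiv_0_imp_power_CHAR:
  fixes F :: "'a::alg_closed_field poly"
  assumes p: "prime CHAR('a)" and "pderiv F = 0"
  shows "\<exists>Z. F = Z ^ CHAR('a)"
proof -
  let ?p = "CHAR('a)"
  have p0: "?p > 0" using p prime_gt_0_nat by blast
  obtain r :: "'a \<Rightarrow> 'a" where r: "r x ^ ?p = x" for x
    using nth_root_exists[OF p0] by metis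
  have van: "coeff F k = 0" if "\<not> ?p dvd k" for k
  proof -
    have "k > 0" using that by (cases k) auto
    hence "of_nat k * coeff F k = 0" using coeff_pderiv[of F "k - 1"] assms(2) by simp
    thus ?thesis using that by (simp add: of_nat_eq_0_iff_char_dvd)
  qed
  define Z where "Z = (\<Sum>i\<le>degree F. monom (r (coeff F (?p * i))) i)"
  have pp: "prime CHAR('a poly)" using p by simp
  have "Z ^ ?p = (\<Sum>i\<le>degree F. monom (coeff F (?p * i)) (?p * i))"
    unfolding Z_def using freshmans_dream_sum[OF pp refl, of "\<lambda>i. monom (r (coeff F (?p * i))) i" "{..degree F}"]
    by (simp add: monom_power r mult.commute)
  also have "\<dots> = F"
  proof (rule poly_eqI)
    fix k
    have "coeff (\<Sum>i\<le>degree F. monom (coeff F (?p * i)) (?p * i)) k =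
       (\<Sum>i\<le>degree F. if ?p * i = k then coeff F k else 0)"
      unfolding coeff_sum by (intro sum.cong) auto
    also have "\<dots> = coeff F k"
    proof (cases "?p dvd k \<and> k \<le> degree F")
      case True
      then obtain j where j: "k = ?p * j" by auto
      have "j \<le> degree F" using True j p0 by (metis dual_order.trans le_add2 mult_le_mono1 nat_mult_1 Suc_leI One_nat_def)
      have "(\<Sum>i\<le>degree F. if ?p * i = k then coeff F k else 0) = (\<Sum>i\<le>degree F. if i = j then coeff F k else 0)"
        using p0 j by (intro sum.cong) auto
      thus ?thesis using \<open>j \<le> degree F\<close> by simp
    next
      case False
      hence "coeff F k = 0" using van coeff_eq_0 by (metis not_le)
      thus ?thesis by (simp only: if_cancel sum.neutral_const)
    qed
    finally show "coeff (\<Sum>i\<le>degree F. monom (coeff F (?p * i)) (?p * i)) k = coeff F k" .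
  qed
  finally show ?thesis by metis
qed

lemma order_prod_linear_powers:
  fixes r :: "'a::idom \<Rightarrow> nat"
  assumes "finite S"
  shows "order l (\<Prod>c\<in>S. [:- c, 1:] ^ r c) = (if l \<in> S then r l else 0)"
  using assms
proof (induction S)
  case (insert c S)
  have "order l ([:- c, 1:] ^ r c) = (if l = c then r c else 0)"
    by (auto simp: order_power_n_n intro!: order_0I)
  moreover have "[:- c, 1:] ^ r c * (\<Prod>c\<in>S. [:- c, 1:] ^ r c) \<noteq> 0"
    using insert.hyps by (auto simp: prod_zero_iff)
  ultimately show ?case
    using insert by (auto simp: order_mult)
qed simp

lemma degree_prod_linear_powers:
  fixes r :: "'a::idom \<Rightarrow> nat"
  assumes "finite S"
  shows "degree (\<Prod>c\<in>S. [:- c, 1:] ^ r c) = (\<Sum>c\<in>S. r c)"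
  using assms
proof (induction S)
  case (insert c S)
  have "(\<Prod>c\<in>S. [:- c, 1:] ^ r c) \<noteq> 0"
    using insert.hyps by (auto simp: prod_zero_iff)
  thus ?case using insert by (simp add: degree_mult_eq degree_linear_power)
qed simp

lemma order_power:
  fixes f :: "'a::idom poly"
  assumes "f \<noteq> 0"
  shows "order l (f ^ n) = n * order l f"
  by (induction n) (use assms in \<open>auto simp: order_mult\<close>)

lemma dvd_if_order_le:
  fixes f g :: "'a::alg_closed_field poly"
  assumes "f \<noteq> 0" "g \<noteq> 0" "\<And>l. order l f \<le> order l g"
  shows "f dvd g"
  using assms
proof (induction "degree f" arbitrary: f g rule: less_induct)
  case less
  show ?case
  proof (cases "degree f = 0")
    case True
    hence "is_unit f" using less.prems(1) by (simp add: is_unit_iff_degree)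
    thus ?thesis by (rule unit_imp_dvd)
  next
    case False
    then obtain l where l: "poly f l = 0" using alg_closed_imp_poly_has_root by blast
    define c where "c = [:- l, 1:]"
    have c: "c \<noteq> 0" "degree c = 1" by (simp_all add: c_def)
    obtain f' where f': "f = c * f'" using l unfolding c_def poly_eq_0_iff_dvd by (elim dvdE)
    have "order l f > 0" using l less.prems(1) by (simp add: order_root)
    hence "poly g l = 0" using less.prems(3)[of l] less.prems(2) by (simp add: order_root)
    then obtain g' where g': "g = c * g'" unfolding c_def poly_eq_0_iff_dvd by (elim dvdE)
    have nz: "f' \<noteq> 0" "g' \<noteq> 0" using less.prems(1,2) f' g' by auto
    have "degree f' < degree f" using nz c by (simp add: f' degree_mult_eq)
    moreover have "order k f' \<le> order k g'" for k
      using less.prems(3)[of k] less.prems(1,2) unfolding f' g' by (simp add: order_mult)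
    ultimately show ?thesis using less.hyps nz f' g' by (simp add: mult_dvd_mono)
  qed
qed

lemma power_CHAR_diff:
  fixes F U :: "'a::idom poly"
  assumes "prime CHAR('a)"
  shows "(F - U) ^ CHAR('a) = F ^ CHAR('a) - U ^ CHAR('a)"
proof -
  have "(F - U + U) ^ CHAR('a) = (F - U) ^ CHAR('a) + U ^ CHAR('a)"
    by (rule freshmans_dream) (use assms in simp_all)
  thus ?thesis by (simp only: diff_add_cancel eq_diff_eq)
qed

text \<open>
  Truncating at \<open>t ^ B\<close> makes the membership a Pade approximation: \<open>F ^ p * H \<equiv> W1\<close> modulo
  \<open>t ^ (p * B)\<close> with \<open>W1\<close> of small degree, where \<open>H\<close> collects the linear factors that are left
  over when the exponents are divided by \<open>p\<close>.  Since \<open>F ^ p\<close> and the modulus have derivative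
  \<open>0\<close>, the Wronskian of \<open>H\<close> and \<open>W1\<close> is divisible by \<open>t ^ (p * B)\<close>; by the margin its degree is
  too small, so it vanishes.  Hence \<open>W1 / H\<close> is a \<open>p\<close>-th power of a rational function, and a
  polynomial one because all roots of \<open>H\<close> have multiplicity less than \<open>p\<close>.  Extracting
  \<open>p\<close>-th roots gives \<open>F \<equiv> U\<close> modulo \<open>t ^ B\<close>, with the degree of \<open>U\<close> in the required range.
\<close>

lemma flanked_descent:
  fixes F :: "'a::alg_closed_field poly"
  defines "p \<equiv> CHAR('a)"
  assumes p: "prime CHAR('a)" and S: "finite S" "0 \<notin> S" and r: "\<And>c. c \<in> S \<Longrightarrow> r c < p"
    and F0: "coeff F 0 \<noteq> 0" and x: "x < p" and y: "y < p"
    and fl: "flanked (int p * A - int x) (int p * B - int y) (F ^ p * (\<Prod>c\<in>S. [:- c, 1:] ^ r c))"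
    and margin: "A + B - int (degree F) \<ge> 2 * int (card S) + 3"
  shows "flanked A B F"
proof (cases "B \<le> 0")
  case True
  thus ?thesis by (auto simp: flanked_def)
next
  case False
  define b where "b = nat B"
  have b: "B = int b" "b \<ge> 1" using False by (auto simp: b_def)
  have p2: "p \<ge> 2" using p prime_ge_2_nat by (simp add: p_def)
  have p0: "of_nat p = (0 :: 'a)" by (simp add: p_def)
  have F: "F \<noteq> 0" using F0 by auto
  define R where "R = (\<Prod>c\<in>S. [:- c, 1:] ^ r c)"
  have R: "R \<noteq> 0" using S by (auto simp: R_def prod_zero_iff)
  have pb: "p \<le> p * b" using b by simp
  define n where "n = p * b - y"
  have n: "n + y = p * b" using y pb unfolding n_def by linarith
  define G where "G = F ^ p * R"
  have degG: "degree G = p * degree F + degree R"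
    using F R by (simp add: G_def degree_mult_eq degree_power_eq)
  define W where "W = poly_cutoff n G"
  define V where "V = poly_shift n G"
  have G_split: "G = W + monom 1 n * V"
    by (rule poly_eqI) (auto simp: W_def V_def coeff_poly_cutoff coeff_poly_shift coeff_monom_mult)
  define H where "H = monom 1 y * R"
  define W1 where "W1 = monom 1 y * W"
  define M where "M = (monom 1 (p * b) :: 'a poly)"
  have H: "H \<noteq> 0" using R by (simp add: H_def)
  have eq: "F ^ p * H = W1 + M * V"
  proof -
    have "F ^ p * H = monom 1 y * G" by (simp add: H_def G_def)
    also have "\<dots> = W1 + (monom 1 y * monom 1 n) * V"
      by (subst G_split) (simp add: W1_def algebra_simps)
    also have "monom 1 y * monom 1 n = M" using n by (simp add: M_def mult_monom add.commute)
    finally show ?thesis .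
  qed
  have dF: "pderiv (F ^ p) = 0"
    by (simp add: pderiv_power p0)
  have dM: "pderiv M = 0" by (simp add: M_def pderiv_monom p0)
  have eq': "F ^ p * pderiv H = pderiv W1 + M * pderiv V"
    using arg_cong[OF eq, of pderiv] by (simp add: pderiv_mult pderiv_add dF dM)
  define E where "E = H * pderiv W1 - W1 * pderiv H"
  have E_eq: "E = M * (V * pderiv H - H * pderiv V)"
  proof -
    have "E = H * (F ^ p * pderiv H - M * pderiv V) - (F ^ p * H - M * V) * pderiv H"
      by (simp add: E_def eq eq')
    thus ?thesis by (simp add: algebra_simps)
  qed
  have R0: "coeff R 0 \<noteq> 0"
    using S by (auto simp: R_def poly_prod simp flip: poly_0_coeff_0)
  have W0: "W \<noteq> 0"
  proof
    assume "W = 0"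
    hence "coeff (F ^ p * H) y = coeff (M * V) y" by (simp add: eq W1_def)
    also have "\<dots> = 0"
      using less_le_trans[OF y pb] by (simp add: M_def coeff_monom_mult not_le)
    also have "F ^ p * H = monom 1 y * (F ^ p * R)" by (simp add: H_def)
    finally have "coeff (F ^ p * R) 0 = 0" by (simp add: coeff_monom_mult)
    thus False using F0 R0 by (simp flip: poly_0_coeff_0)
  qed
  have degW: "int (degree W) \<le> int (p * degree F) + int (degree R) - int p * A + int x"
  proof -
    have *: "coeff W (degree W) \<noteq> 0" using W0 by simp
    hence *: "coeff G (degree W) \<noteq> 0" "degree W < n"
      by (auto simp: W_def coeff_poly_cutoff split: if_splits)
    have "int p * B - int y \<le> int (degree W) \<or>
          int p * A - int x \<le> int (degree G) - int (degree W)"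
      using fl *(1) unfolding flanked_def G_def R_def by blast
    moreover have "int n = int p * B - int y" using arg_cong[OF n, of int] b(1) by simp
    ultimately show ?thesis
      using degG *(2) by linarith
  qed
  have degR: "degree R \<le> card S * p"
  proof -
    have "degree R = (\<Sum>c\<in>S. r c)" using S by (simp add: R_def degree_prod_linear_powers)
    also have "\<dots> \<le> (\<Sum>c\<in>S. p)" using r by (intro sum_mono) (simp add: less_imp_le)
    finally show ?thesis by simp
  qed
  have marg: "int p * A + int p * B - int (p * degree F) \<ge> 2 * int (card S * p) + 3 * int p"
    using mult_left_mono[OF margin, of "int p"] by (simp add: algebra_simps)
  have degH: "degree H = y + degree R" using R by (simp add: H_def degree_mult_eq degree_monom_eq)
  have degW1: "degree W1 = y + degree W" using W0 by (simp add: W1_def degree_mult_eq degree_monom_eq)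
  \<comment> \<open>The margin is chosen for this step: \<open>degree R \<le> card S * p\<close> and \<open>x, y < p\<close>.\<close>
  have E0: "E = 0"
  proof (rule ccontr)
    assume "E \<noteq> 0"
    hence "p * b \<le> degree E"
      unfolding E_eq by (subst degree_mult_eq) (auto simp: M_def degree_monom_eq)
    also have "degree E \<le> degree H + degree W1"
      unfolding E_def
    proof (rule degree_diff_le)
      show "degree (H * pderiv W1) \<le> degree H + degree W1"
        by (rule order_trans[OF degree_mult_le add_left_mono[OF order_trans[OF degree_pderiv_le diff_le_self]]])
      show "degree (W1 * pderiv H) \<le> degree H + degree W1"
        using order_trans[OF degree_mult_le add_left_mono[OF order_trans[OF degree_pderiv_le diff_le_self]], of W1 H]
        by (simp add: add.commute)
    qed
    finally have "int (p * b) \<le> 2 * int y + int (degree R) + int (degree W)"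
      unfolding degH degW1 by linarith
    moreover have "int p * B = int (p * b)" using b by simp
    ultimately show False using degW marg degR x y by linarith
  qed
  \<comment> \<open>The numerator of \<open>W1 / H\<close> over the denominator \<open>H ^ p\<close>, which has derivative \<open>0\<close>.\<close>
  have "pderiv (W1 * H ^ (p - 1)) = 0"
  proof -
    define k where "k = p - 2"
    have k: "p = Suc (Suc k)" using p2 by (simp add: k_def)
    have "of_nat (Suc k) = (-1 :: 'a)" using p0 unfolding k by (simp add: add_eq_0_iff add.commute)
    hence "pderiv (H ^ Suc k) = - (H ^ k * pderiv H)"
      by (simp only: pderiv_power_Suc) simp
    hence "pderiv (W1 * H ^ Suc k) = W1 * (- (H ^ k * pderiv H)) + H ^ Suc k * pderiv W1"
      by (simp only: pderiv_mult)
    also have "\<dots> = H ^ k * E" by (simp add: E_def algebra_simps)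
    finally have "pderiv (W1 * H ^ Suc k) = H ^ k * E" .
    thus ?thesis by (simp add: k E0)
  qed
  then obtain Z where Z: "W1 * H ^ (p - 1) = Z ^ p"
    using pderiv_0_imp_power_CHAR[OF p] unfolding p_def by blast
  have W1: "W1 \<noteq> 0" using W0 by (simp add: W1_def)
  have Z0: "Z \<noteq> 0" using Z W1 H p2 by (auto simp: zero_power)
  have ordH: "order l H < p" for l
  proof -
    have "H = (\<Prod>c\<in>insert 0 S. [:- c, 1:] ^ (r(0 := y)) c)"
      using S by (auto simp: H_def R_def monom_altdef intro!: arg_cong2[where f = "(*)"] prod.cong)
    hence "order l H = (if l \<in> insert 0 S then (r(0 := y)) l else 0)"
      using S(1) by (simp only: order_prod_linear_powers finite_insert)
    thus ?thesis using r y p2 by auto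
  qed
  have "H dvd Z"
  proof (rule dvd_if_order_le[OF H Z0])
    fix l
    have "p * order l Z = order l W1 + (p - 1) * order l H"
      using arg_cong[OF Z, of "order l"] W1 H Z0 by (simp add: order_mult order_power)
    moreover have "(p - 1) * order l H + order l H = p * order l H"
      using p2 by (simp add: algebra_simps)
    ultimately have "p * order l Z + order l H \<ge> p * order l H" by linarith
    hence "p * order l H < p * order l Z + p * 1" using ordH[of l] by linarith
    hence "p * order l H < p * (order l Z + 1)" by (simp only: distrib_left)
    hence "order l H < order l Z + 1" by (simp only: mult_less_cancel1)
    thus "order l H \<le> order l Z" by linarith
  qed
  then obtain U where U: "Z = H * U" by blast
  have "W1 * H ^ (p - 1) = (H * U ^ p) * H ^ (p - 1)"
  proof -
    have "H ^ p = H * H ^ (p - 1)" using p2 by (simp flip: power_Suc)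
    thus ?thesis using Z unfolding U power_mult_distrib by (simp add: mult_ac)
  qed
  hence W1_eq: "W1 = H * U ^ p" using H by simp
  have U0: "U \<noteq> 0" using Z0 U by auto
  have *: "H * (F - U) ^ p = M * V"
  proof -
    have "H * (F - U) ^ p = F ^ p * H - W1"
      unfolding W1_eq p_def power_CHAR_diff[OF p] by (simp add: algebra_simps)
    thus ?thesis by (simp add: eq)
  qed
  have agree: "coeff F k = coeff U k" if "k < b" for k
  proof (cases "F = U")
    case False
    have "(F - U) ^ p * H \<noteq> 0" using False H by simp
    hence V: "M * V \<noteq> 0" by (simp only: * mult.commute[of _ H] not_False_eq_True)
    have "order 0 M = p * b"
      using order_power_n_n[of "0::'a" "p * b"] by (simp add: M_def monom_altdef)
    hence "p * b \<le> order 0 (H * (F - U) ^ p)"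
      unfolding * using V by (simp add: order_mult)
    also have "\<dots> = order 0 H + p * order 0 (F - U)"
      using False H by (simp add: order_mult order_power)
    finally have "p * b < p * order 0 (F - U) + p * 1" using ordH[of 0] by linarith
    hence "p * b < p * (order 0 (F - U) + 1)" by (simp only: distrib_left)
    hence "b < order 0 (F - U) + 1" by (simp only: mult_less_cancel1)
    hence "b \<le> order 0 (F - U)" by linarith
    hence "monom 1 b dvd F - U" using False by (simp add: monom_1_dvd_iff)
    hence "coeff (F - U) k = 0" using that by (simp add: monom_1_dvd_iff')
    thus ?thesis by simp
  qed simp
  have "degree W1 = degree H + p * degree U"
    unfolding W1_eq using H U0 by (simp add: degree_mult_eq degree_power_eq)
  hence "int (degree W1) = int (degree H) + int p * int (degree U)" by simp
  hence pU: "int p * int (degree U) \<le> int p * int (degree F) - int p * A + int x"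
    using degW degW1 degH of_nat_mult[where ?'a = int, of p "degree F"] by linarith
  have "int p * (int (degree U) - int (degree F) + A) < int p * 1"
  proof -
    have "int p * (int (degree U) - int (degree F) + A) =
        int p * int (degree U) - int p * int (degree F) + int p * A"
      by (simp add: algebra_simps)
    thus ?thesis using pU x by linarith
  qed
  hence "int (degree U) - int (degree F) + A < 1" 
    by (rule mult_less_cancel_left_pos[THEN iffD1, rotated]) (use p2 in simp)
  hence degU: "int (degree U) \<le> int (degree F) - A" by linarith
  show ?thesis unfolding flanked_def
  proof (intro allI impI)
    fix k assume k: "coeff F k \<noteq> 0"
    show "B \<le> int k \<or> A \<le> int (degree F) - int k"
    proof (cases "k < b")
      case True
      hence "k \<le> degree U" using agree[OF True] k by (intro le_degree) simp
      thus ?thesis using degU by linarith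
    qed (use b in auto)
  qed
qed

section \<open>Real exponents of a product of binomials\<close>

lemma eventually_floor_at_right:
  fixes k w x :: real
  assumes "k \<ge> 0"
  shows "eventually (\<lambda>x'. \<lfloor>k * x' + w\<rfloor> = \<lfloor>k * x + w\<rfloor>) (at_right x)"
proof -
  have "((\<lambda>x'. k * x' + w) \<longlongrightarrow> k * x + w) (at_right x)"
    by (intro tendsto_intros)
  hence "eventually (\<lambda>x'. k * x' + w < of_int \<lfloor>k * x + w\<rfloor> + 1) (at_right x)"
    by (rule order_tendstoD(2)) linarith
  moreover have "eventually (\<lambda>x'. x < x') (at_right x)"
    by (rule eventually_at_right_less)
  ultimately show ?thesis
  proof eventually_elim
    case (elim x')
    have "k * x \<le> k * x'" using elim assms by (intro mult_left_mono) auto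
    moreover have "of_int \<lfloor>k * x + w\<rfloor> \<le> k * x + w" by simp
    ultimately show ?case using elim by (intro floor_unique) linarith+
  qed
qed

lemma eventually_floor_at_left:
  fixes k w x :: real
  assumes "k \<ge> 0" "k = 0 \<or> k * x + w \<notin> \<int>"
  shows "eventually (\<lambda>x'. \<lfloor>k * x' + w\<rfloor> = \<lfloor>k * x + w\<rfloor>) (at_left x)"
proof (cases "k = 0")
  case False
  have "of_int \<lfloor>k * x + w\<rfloor> \<noteq> k * x + w" using assms False by (metis Ints_of_int)
  hence *: "of_int \<lfloor>k * x + w\<rfloor> < k * x + w" by (simp add: order_less_le)
  have "((\<lambda>x'. k * x' + w) \<longlongrightarrow> k * x + w) (at_left x)"
    by (intro tendsto_intros)
  hence "eventually (\<lambda>x'. of_int \<lfloor>k * x + w\<rfloor> < k * x' + w) (at_left x)"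
    by (rule order_tendstoD(1)) (rule *)
  moreover have "eventually (\<lambda>x'. x' < x) (at_left x)"
    by (auto simp: eventually_at_left_field intro: exI[of _ "x - 1"])
  ultimately show ?thesis
  proof eventually_elim
    case (elim x')
    have "k * x' \<le> k * x" using elim assms by (intro mult_left_mono) auto
    moreover have "k * x + w < of_int \<lfloor>k * x + w\<rfloor> + 1" by linarith
    ultimately show ?case using elim by (intro floor_unique) linarith+
  qed
qed simp

text \<open>
  Rounding up the numerator first does not change the rounded quotient.
\<close>

lemma ceiling_divide_diff:
  fixes \<theta> :: real and v :: nat
  assumes "v > 0" "0 \<le> \<theta>" "\<theta> < 1"
  shows "\<lceil>(of_int z - \<theta>) / v\<rceil> = \<lceil>of_int z / real v\<rceil>"
proof (rule antisym)
  show "\<lceil>(of_int z - \<theta>) / v\<rceil> \<le> \<lceil>of_int z / real v\<rceil>"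
    using assms by (intro ceiling_mono divide_right_mono) auto
  let ?K = "\<lceil>(of_int z - \<theta>) / v\<rceil>"
  have "(of_int z - \<theta>) / v \<le> of_int ?K" by simp
  hence "of_int z - \<theta> \<le> of_int ?K * real v" using assms(1) by (simp only: pos_divide_le_eq of_nat_0_less_iff)
  hence "real_of_int z < of_int (?K * int v + 1)" using assms(3) by simp
  hence "z \<le> ?K * int v" by linarith
  hence "real_of_int z \<le> of_int ?K * real v" by (metis of_int_le_iff of_int_mult of_int_of_nat_eq)
  thus "\<lceil>of_int z / real v\<rceil> \<le> ?K" using assms(1) by (simp add: ceiling_le_iff pos_divide_le_eq)
qed

lemma nat_floor_times:
  fixes y :: real
  assumes "k > 0"
  shows "nat \<lfloor>y\<rfloor> * k \<le> nat \<lfloor>real k * y\<rfloor>" "nat \<lfloor>real k * y\<rfloor> < nat \<lfloor>y\<rfloor> * k + k"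
proof -
  show "nat \<lfloor>y\<rfloor> * k \<le> nat \<lfloor>real k * y\<rfloor>"
  proof (cases "y \<ge> 0")
    case True
    hence "real (nat \<lfloor>y\<rfloor>) * real k \<le> y * real k" by (intro mult_right_mono) auto
    thus ?thesis by (intro le_nat_floor) (simp add: mult.commute)
  qed simp
  show "nat \<lfloor>real k * y\<rfloor> < nat \<lfloor>y\<rfloor> * k + k"
  proof (cases "y \<ge> 0")
    case True
    hence "y < real (nat \<lfloor>y\<rfloor>) + 1" by linarith
    hence "real k * y < real k * (real (nat \<lfloor>y\<rfloor>) + 1)" using assms by simp
    moreover have "real (nat \<lfloor>real k * y\<rfloor>) \<le> real k * y" using True by simp
    ultimately have "real (nat \<lfloor>real k * y\<rfloor>) < real (nat \<lfloor>y\<rfloor> * k + k)"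
      by (simp add: algebra_simps)
    thus ?thesis by (simp only: of_nat_less_iff)
  next
    case False
    hence "real k * y \<le> 0" by (simp add: mult_nonneg_nonpos)
    hence "nat \<lfloor>real k * y\<rfloor> = 0" by simp
    thus ?thesis using assms by simp
  qed
qed

lemma ceiling_times:
  fixes y :: real
  assumes "k > 0"
  shows "\<lceil>real k * y\<rceil> \<le> int k * \<lceil>y\<rceil>" "int k * \<lceil>y\<rceil> < \<lceil>real k * y\<rceil> + int k"
proof -
  have "real k * y \<le> real k * \<lceil>y\<rceil>" by (intro mult_left_mono) auto
  thus "\<lceil>real k * y\<rceil> \<le> int k * \<lceil>y\<rceil>" by (simp add: ceiling_le_iff)
  have "of_int \<lceil>y\<rceil> < y + 1" by linarith
  hence "real k * of_int \<lceil>y\<rceil> < real k * (y + 1)" using assms by (intro mult_strict_left_mono) auto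
  hence "real_of_int (int k * \<lceil>y\<rceil>) < real k * y + real k" by (simp add: distrib_left)
  also have "\<dots> \<le> of_int (\<lceil>real k * y\<rceil> + int k)" by simp
  finally show "int k * \<lceil>y\<rceil> < \<lceil>real k * y\<rceil> + int k" by linarith
qed

text \<open>
  The data of \<open>X ^ a * Y ^ b * (\<Prod>l\<in>S. (Y ^ u - l * X ^ v) ^ m l)\<close> in characteristic \<open>p\<close>.
\<close>

locale weighted_form =
  fixes u v a b p :: nat and S :: "'a::alg_closed_field set" and m :: "'a \<Rightarrow> nat"
  assumes p_eq: "p = CHAR('a)" and p_prime: "prime p"
    and weights_pos: "u > 0" "v > 0"
    and roots: "finite S" "0 \<notin> S"
begin

definition wdeg :: nat where
  "wdeg = u * a + v * b + u * v * (\<Sum>c\<in>S. m c)"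

text \<open>
  The dehomogenized power with real exponent \<open>x\<close>, all exponents being rounded down.
\<close>

definition rpow :: "real \<Rightarrow> 'a poly" where
  "rpow x = (\<Prod>c\<in>S. [:- c, 1:] ^ nat \<lfloor>real (m c) * x\<rfloor>)"

text \<open>
  For natural numbers \<open>q\<close> and \<open>x\<close> this says that the \<open>x\<close>-th power of the form lies in
  \<open>(X ^ q, Y ^ q)\<close>.  Real exponents make membership at level \<open>q\<close> a condition on the ratio
  \<open>\<tau> = x / q\<close> alone, so that different levels can be compared.
\<close>

definition power_in_ideal :: "real \<Rightarrow> real \<Rightarrow> bool" where
  "power_in_ideal q x \<longleftrightarrow> flanked \<lceil>(q - real a * x) / v\<rceil> \<lceil>(q - real b * x) / u\<rceil> (rpow x)"

definition ratios :: "real set" where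
  "ratios = {real N / real (p ^ e) | N e. power_in_ideal (real (p ^ e)) (real N)}"

lemma p_gt_1: "p > 1"
  using p_prime prime_gt_1_nat by blast

lemma rpow_split:
  assumes "\<And>c. c \<in> S \<Longrightarrow> nat \<lfloor>real (m c) * x\<rfloor> * k \<le> nat \<lfloor>real (m c) * x'\<rfloor>"
  shows "rpow x' = rpow x ^ k * (\<Prod>c\<in>S. [:- c, 1:] ^ (nat \<lfloor>real (m c) * x'\<rfloor> - nat \<lfloor>real (m c) * x\<rfloor> * k))"
  unfolding rpow_def prod_power_distrib prod.distrib[symmetric] power_mult[symmetric]
    power_add[symmetric]
  by (rule prod.cong) (use assms in auto)

lemma rpow_nonzero: "rpow x \<noteq> 0" "coeff (rpow x) 0 \<noteq> 0"
proof -
  have "poly (rpow x) 0 \<noteq> 0"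
    using roots by (auto simp: rpow_def poly_prod)
  thus "coeff (rpow x) 0 \<noteq> 0" "rpow x \<noteq> 0" by (auto simp: poly_0_coeff_0)
qed

lemma scale_eq: "(real p * q - real n * (real p * x)) / w = real p * ((q - real n * x) / w)"
  by (simp add: algebra_simps diff_divide_distrib)

lemma rpow_frobenius:
  "rpow (real p * x) = rpow x ^ p *
     (\<Prod>c\<in>S. [:- c, 1:] ^ (nat \<lfloor>real (m c) * (real p * x)\<rfloor> - nat \<lfloor>real (m c) * x\<rfloor> * p))"
  using nat_floor_times(1)[of p] p_gt_1
  by (intro rpow_split) (simp add: mult.left_commute[of _ "real p"])

lemma power_in_ideal_frobenius:
  assumes "power_in_ideal q x"
  shows "power_in_ideal (real p * q) (real p * x)"
  unfolding power_in_ideal_def scale_eq rpow_frobenius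
proof (rule flanked_mult, rule flanked_mono[OF flanked_power_CHAR[OF p_prime[unfolded p_eq], folded p_eq]])
  show "flanked \<lceil>(q - real a * x) / v\<rceil> \<lceil>(q - real b * x) / u\<rceil> (rpow x)"
    using assms by (simp add: power_in_ideal_def)
qed (rule ceiling_times(1), use p_gt_1 in simp)+

text \<open>
  The left-hand side of the margin is \<open>u * v\<close> times a lower bound for \<open>A + B\<close> minus the degree.
\<close>

lemma power_in_ideal_descent:
  assumes mem: "power_in_ideal (real p * q) (real p * x)" and x: "x \<ge> 0"
    and margin: "real (u + v) * q - real wdeg * x \<ge> real (u * v * (2 * card S + 3))"
  shows "power_in_ideal q x"
proof -
  let ?A = "\<lceil>(q - real a * x) / v\<rceil>" and ?B = "\<lceil>(q - real b * x) / u\<rceil>"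
  have p0: "p > 0" using p_gt_1 by simp
  define xx where "xx = nat (int p * ?A - \<lceil>real p * ((q - real a * x) / v)\<rceil>)"
  define yy where "yy = nat (int p * ?B - \<lceil>real p * ((q - real b * x) / u)\<rceil>)"
  have xx: "xx < p" "int p * ?A - int xx = \<lceil>real p * ((q - real a * x) / v)\<rceil>"
    using ceiling_times[OF p0, of "(q - real a * x) / v"] p0 unfolding xx_def by linarith+
  have yy: "yy < p" "int p * ?B - int yy = \<lceil>real p * ((q - real b * x) / u)\<rceil>"
    using ceiling_times[OF p0, of "(q - real b * x) / u"] p0 unfolding yy_def by linarith+
  have deg: "real (degree (rpow x)) \<le> (\<Sum>c\<in>S. m c) * x"
  proof -
    have "real (degree (rpow x)) = (\<Sum>c\<in>S. real (nat \<lfloor>real (m c) * x\<rfloor>))"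
      using roots by (simp add: rpow_def degree_prod_linear_powers)
    also have "\<dots> \<le> (\<Sum>c\<in>S. real (m c) * x)"
      using x by (intro sum_mono) simp
    finally show ?thesis by (simp add: sum_distrib_right)
  qed
  have "real (2 * card S + 3) \<le> (real (u + v) * q - real wdeg * x) / (real u * real v)"
    using margin weights_pos by (simp add: pos_le_divide_eq algebra_simps)
  also have "\<dots> = (q - real a * x) / v + (q - real b * x) / u - (\<Sum>c\<in>S. m c) * x"
    using weights_pos by (simp add: wdeg_def field_simps)
  also have "\<dots> \<le> of_int ?A + of_int ?B - real (degree (rpow x))"
    using deg by (intro diff_mono add_mono) auto
  finally have marg: "2 * int (card S) + 3 \<le> ?A + ?B - int (degree (rpow x))"
    by linarith
  have fl: "flanked (int p * ?A - int xx) (int p * ?B - int yy) (rpow x ^ p *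
      (\<Prod>c\<in>S. [:- c, 1:] ^ (nat \<lfloor>real (m c) * (real p * x)\<rfloor> - nat \<lfloor>real (m c) * x\<rfloor> * p)))"
    using mem unfolding power_in_ideal_def scale_eq rpow_frobenius xx(2) yy(2) .
  have less: "nat \<lfloor>real (m c) * (real p * x)\<rfloor> - nat \<lfloor>real (m c) * x\<rfloor> * p < p" for c
    using nat_floor_times[OF p0, of "real (m c) * x"] unfolding mult.left_commute[of "real (m c)"]
    by linarith
  show ?thesis unfolding power_in_ideal_def
    by (rule flanked_descent[where ?'a = 'a, folded p_eq, OF p_prime roots less rpow_nonzero(2) xx(1) yy(1) fl marg])
qed

lemma power_in_ideal_frobenius_power:
  assumes "power_in_ideal q x"
  shows "power_in_ideal (real p ^ k * q) (real p ^ k * x)"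
proof (induction k)
  case (Suc k)
  from power_in_ideal_frobenius[OF this] show ?case by (simp add: mult_ac)
qed (use assms in simp)

lemma power_in_ideal_descent_power:
  assumes "power_in_ideal (real p ^ k * q) (real p ^ k * x)" and x: "x \<ge> 0"
    and margin: "real (u + v) * q - real wdeg * x \<ge> real (u * v * (2 * card S + 3))"
  shows "power_in_ideal q x"
  using assms(1)
proof (induction k)
  case (Suc k)
  have "real (u * v * (2 * card S + 3)) \<le> 1 * (real (u + v) * q - real wdeg * x)"
    using margin by simp
  also have "\<dots> \<le> real p ^ k * (real (u + v) * q - real wdeg * x)"
  proof (intro mult_right_mono)
    show "0 \<le> real (u + v) * q - real wdeg * x" by (rule order_trans[OF of_nat_0_le_iff margin])
  qed (use p_gt_1 in simp)
  finally have "real (u * v * (2 * card S + 3)) \<le> real (u + v) * (real p ^ k * q) - real wdeg * (real p ^ k * x)"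
    by (simp add: algebra_simps)
  with power_in_ideal_descent[of "real p ^ k * q" "real p ^ k * x"] Suc.prems x have "power_in_ideal (real p ^ k * q) (real p ^ k * x)"
    by (simp add: mult_ac)
  thus ?case by (rule Suc.IH)
qed simp

lemma power_in_ideal_cong:
  assumes "\<And>c. c \<in> S \<Longrightarrow> \<lfloor>real (m c) * x\<rfloor> = \<lfloor>real (m c) * x'\<rfloor>"
    and "\<lceil>(q - real a * x) / v\<rceil> = \<lceil>(q - real a * x') / v\<rceil>" "\<lceil>(q - real b * x) / u\<rceil> = \<lceil>(q - real b * x') / u\<rceil>"
  shows "power_in_ideal q x \<longleftrightarrow> power_in_ideal q x'"
proof -
  have "rpow x = rpow x'" unfolding rpow_def by (intro prod.cong) (simp_all add: assms(1))
  thus ?thesis by (simp add: power_in_ideal_def assms(2,3))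
qed

lemma ceiling_as_floor: "\<lceil>(q - real n * x) / w\<rceil> = - \<lfloor>real n / w * x + (- q / w)\<rfloor>"
  by (simp add: ceiling_def diff_divide_distrib)

lemma eventually_power_in_ideal_at_right:
  "eventually (\<lambda>x'. power_in_ideal q x' \<longleftrightarrow> power_in_ideal q x) (at_right x)"
proof -
  have "eventually (\<lambda>x'. \<forall>c\<in>S. \<lfloor>real (m c) * x' + 0\<rfloor> = \<lfloor>real (m c) * x + 0\<rfloor>) (at_right x)"
    using roots by (intro eventually_ball_finite ballI eventually_floor_at_right) auto
  moreover have "eventually (\<lambda>x'. \<lceil>(q - real a * x') / v\<rceil> = \<lceil>(q - real a * x) / v\<rceil>) (at_right x)"
    unfolding ceiling_as_floor neg_equal_iff_equal by (intro eventually_floor_at_right) simp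
  moreover have "eventually (\<lambda>x'. \<lceil>(q - real b * x') / u\<rceil> = \<lceil>(q - real b * x) / u\<rceil>) (at_right x)"
    unfolding ceiling_as_floor neg_equal_iff_equal by (intro eventually_floor_at_right) simp
  ultimately show ?thesis
    by eventually_elim (rule power_in_ideal_cong, auto)
qed

text \<open>
  Membership changes only where one of the roundings jumps, and for integral \<open>q\<close> a jump from the
  left forces \<open>M * x\<close> to be an integer for one of the exponents \<open>M\<close>.
\<close>

lemma eventually_power_in_ideal_at_left:
  assumes "\<And>c. c \<in> S \<Longrightarrow> m c > 0 \<Longrightarrow> real (m c) * x \<notin> \<int>"
    and "a > 0 \<Longrightarrow> real a * x \<notin> \<int>" "b > 0 \<Longrightarrow> real b * x \<notin> \<int>" and "q \<in> \<int>"
  shows "eventually (\<lambda>x'. power_in_ideal q x' \<longleftrightarrow> power_in_ideal q x) (at_left x)"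
proof -
  have *: "real n / w * x + - q / w \<notin> \<int>" if "real n * x \<notin> \<int>" "w > 0" for n w :: nat
  proof
    assume "real n / w * x + - q / w \<in> \<int>"
    hence "real w * (real n / w * x + - q / w) \<in> \<int>" by (rule Ints_mult[OF Ints_of_nat])
    hence "real w * (real n / w * x + - q / w) + q \<in> \<int>" using assms(4) by (rule Ints_add)
    also have "real w * (real n / w * x + - q / w) + q = real n * x" using \<open>w > 0\<close> by (simp add: field_simps)
    finally show False using that by simp
  qed
  have "eventually (\<lambda>x'. \<forall>c\<in>S. \<lfloor>real (m c) * x' + 0\<rfloor> = \<lfloor>real (m c) * x + 0\<rfloor>) (at_left x)"
    using roots assms(1) by (intro eventually_ball_finite ballI eventually_floor_at_left) auto
  moreover have "eventually (\<lambda>x'. \<lceil>(q - real a * x') / v\<rceil> = \<lceil>(q - real a * x) / v\<rceil>) (at_left x)"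
    unfolding ceiling_as_floor neg_equal_iff_equal
    using assms(2) *[of a v] weights_pos by (intro eventually_floor_at_left) auto
  moreover have "eventually (\<lambda>x'. \<lceil>(q - real b * x') / u\<rceil> = \<lceil>(q - real b * x) / u\<rceil>) (at_left x)"
    unfolding ceiling_as_floor neg_equal_iff_equal
    using assms(3) *[of b u] weights_pos by (intro eventually_floor_at_left) auto
  ultimately show ?thesis
    by eventually_elim (rule power_in_ideal_cong, auto)
qed

lemma ratios_nonneg: "x \<in> ratios \<Longrightarrow> x \<ge> 0"
  by (auto simp: ratios_def)

lemma Inf_ratios_le: "x \<in> ratios \<Longrightarrow> Inf ratios \<le> x"
  using ratios_nonneg by (auto intro!: cInf_lower bdd_belowI)

text \<open>
  For a ratio with denominator a power of \<open>p\<close>, membership at any level suffices: by Frobenius it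
  passes to a higher level, where the exponent is a natural number.
\<close>

lemma ratiosI:
  assumes "power_in_ideal q (\<tau> * q)" "q = real p ^ e" "\<tau> = real N / real p ^ e'"
  shows "\<tau> \<in> ratios"
proof -
  have p0: "real p > 0" using p_gt_1 by simp
  have eq: "real p ^ e' * (\<tau> * q) = real (N * p ^ e)"
    using p0 by (simp add: assms(2,3))
  have eq': "real p ^ e' * q = real (p ^ (e' + e))"
    by (simp add: assms(2) power_add)
  have "power_in_ideal (real (p ^ (e' + e))) (real (N * p ^ e))"
    using power_in_ideal_frobenius_power[OF assms(1), of e'] unfolding eq eq' .
  moreover have "\<tau> = real (N * p ^ e) / real (p ^ (e' + e))"
    using p0 by (simp add: assms(3) power_add)
  ultimately show ?thesis unfolding ratios_def by blast
qed

text \<open>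
  A monomial outside the ideal has weighted degree at most \<open>(u + v) * (q - 1)\<close>.
\<close>

lemma power_in_ideal_if_wdeg_gt:
  assumes "(u + v) * (q - 1) < wdeg * N" "q > 0"
  shows "power_in_ideal (real q) (real N)"
  unfolding power_in_ideal_def flanked_def
proof (intro allI impI)
  fix k assume "coeff (rpow (real N)) k \<noteq> 0"
  hence k: "k \<le> degree (rpow (real N))" by (rule le_degree)
  let ?n = "degree (rpow (real N))"
  have n: "?n = (\<Sum>c\<in>S. m c) * N"
    using roots by (simp add: rpow_def degree_prod_linear_powers sum_distrib_right flip: of_nat_mult)
  show "\<lceil>(real q - real b * real N) / real u\<rceil> \<le> int k \<or>
        \<lceil>(real q - real a * real N) / real v\<rceil> \<le> int ?n - int k"
  proof (rule ccontr)
    assume neg: "\<not> ?thesis"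
    hence "real_of_int (int k) < (real q - real b * real N) / real u"
      by (simp add: not_le less_ceiling_iff)
    hence "real u * real k + real b * real N < real q"
      using weights_pos by (simp add: pos_less_divide_eq algebra_simps)
    hence "real (u * k + b * N) < real q" by simp
    hence 1: "u * k + b * N \<le> q - 1" by linarith
    have "real_of_int (int ?n - int k) < (real q - real a * real N) / real v"
      using neg by (simp only: not_le less_ceiling_iff de_Morgan_disj)
    hence "real (?n - k) < (real q - real a * real N) / real v"
      using k by (simp only: of_nat_diff of_int_diff of_int_of_nat_eq)
    hence "real (?n - k) * real v < real q - real a * real N"
      using weights_pos by (simp only: pos_less_divide_eq of_nat_0_less_iff)
    moreover have "real (v * (?n - k) + a * N) = real (?n - k) * real v + real a * real N"
      by (simp only: of_nat_add of_nat_mult mult.commute)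
    ultimately have "real (v * (?n - k) + a * N) < real q" by linarith
    hence 2: "v * (?n - k) + a * N \<le> q - 1" by linarith
    have "wdeg * N = v * (u * k + b * N) + u * (v * (?n - k) + a * N)"
    proof -
      have "u * v * ?n = v * (u * k) + u * (v * (?n - k))"
        using k by (simp add: algebra_simps diff_mult_distrib2)
      thus ?thesis by (simp add: wdeg_def n algebra_simps)
    qed
    also have "\<dots> \<le> v * (q - 1) + u * (q - 1)"
      using 1 2 by (intro add_mono mult_left_mono) auto
    finally show False using assms by (simp add: algebra_simps)
  qed
qed

lemma flanked_linear_power: "flanked (int p ^ e) (int p ^ e) ([:- c, 1:] ^ (p ^ e) :: 'a poly)"
proof (induction e)
  case 0
  show ?case by (auto simp: flanked_def coeff_pCons split: nat.splits)
next
  case (Suc e)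
  from flanked_power_CHAR[OF p_prime[unfolded p_eq] this, folded p_eq] show ?case
    by (simp add: mult.commute flip: power_mult)
qed

lemma power_in_ideal_if_root:
  assumes "c \<in> S" "m c * N \<ge> p ^ e"
  shows "power_in_ideal (real (p ^ e)) (real N)"
proof -
  have "nat \<lfloor>real (m c) * real N\<rfloor> = m c * N" by (simp flip: of_nat_mult)
  hence "rpow (real N) = [:- c, 1:] ^ (m c * N) *
           (\<Prod>c\<in>S - {c}. [:- c, 1:] ^ nat \<lfloor>real (m c) * real N\<rfloor>)"
    unfolding rpow_def using assms(1) roots(1) by (subst prod.remove[of S c]) simp_all
  also have "[:- c, 1:] ^ (m c * N) = [:- c, 1:] ^ (p ^ e) * [:- c, 1:] ^ (m c * N - p ^ e)"
    using assms(2) by (simp flip: power_add)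
  finally have *: "flanked (int p ^ e) (int p ^ e) (rpow (real N))"
    unfolding mult.assoc by (simp only:) (intro flanked_mult flanked_linear_power)
  have **: "\<lceil>(real (p ^ e) - real n * real N) / real w\<rceil> \<le> int p ^ e" if "w > 0" for n w
  proof -
    have "real (p ^ e) - real n * real N \<le> real (p ^ e)" by simp
    also have "\<dots> \<le> real (p ^ e) * real w" using that by (simp add: mult_le_cancel_left1)
    finally show ?thesis using that by (simp add: ceiling_le_iff pos_divide_le_eq)
  qed
  show ?thesis unfolding power_in_ideal_def
    using * by (rule flanked_mono) (use ** weights_pos in auto)
qed

lemma power_in_ideal_if_axis:
  assumes "a * N \<ge> q \<or> b * N \<ge> q"
  shows "power_in_ideal (real q) (real N)"
proof -
  have *: "\<lceil>(real q - real n * real N) / real w\<rceil> \<le> 0" if "n * N \<ge> q" for n w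
  proof -
    have "real q - real n * real N \<le> 0" using that by (simp flip: of_nat_mult)
    thus ?thesis by (simp add: ceiling_le_iff divide_nonpos_nonneg)
  qed
  show ?thesis unfolding power_in_ideal_def flanked_def
  proof (intro allI impI)
    fix k assume "coeff (rpow (real N)) k \<noteq> 0"
    hence "k \<le> degree (rpow (real N))" by (rule le_degree)
    with assms *[of a v] *[of b u]
    show "\<lceil>(real q - real b * real N) / real u\<rceil> \<le> int k \<or>
        \<lceil>(real q - real a * real N) / real v\<rceil> \<le> int (degree (rpow (real N))) - int k"
      by linarith
  qed
qed

lemma Inf_ratios_le_limit:
  assumes "\<And>e. \<exists>N. power_in_ideal (real (p ^ e)) (real N) \<and> real N \<le> x * real (p ^ e) + 1"
  shows "Inf ratios \<le> x"
proof (rule field_le_epsilon)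
  fix \<epsilon> :: real assume \<epsilon>: "\<epsilon> > 0"
  have "1 < real p" using p_gt_1 by simp
  then obtain e where e: "1 / \<epsilon> < real p ^ e" using real_arch_pow by blast
  obtain N where N: "power_in_ideal (real (p ^ e)) (real N)" "real N \<le> x * real (p ^ e) + 1"
    using assms by blast
  have pe: "real (p ^ e) > 0" using p_gt_1 by simp
  have "Inf ratios \<le> real N / real (p ^ e)"
    using N(1) unfolding ratios_def by (intro Inf_ratios_le[unfolded ratios_def]) blast
  also have "\<dots> \<le> x + 1 / real (p ^ e)"
  proof -
    have "x + 1 / real (p ^ e) = (x * real (p ^ e) + 1) / real (p ^ e)"
      using pe by (simp add: add_divide_distrib)
    thus ?thesis using N(2) pe by (simp only: divide_right_mono less_imp_le)
  qed
  also have "1 / real (p ^ e) \<le> \<epsilon>"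
  proof -
    have "1 < real (p ^ e) * \<epsilon>" using e \<epsilon> by (simp add: pos_divide_less_eq)
    thus ?thesis using pe by (simp only: pos_divide_le_eq mult.commute less_imp_le)
  qed
  finally show "Inf ratios \<le> x + \<epsilon>" by simp
qed

lemma Inf_ratios_upper_bounds:
  assumes "wdeg > 0"
  shows "Inf ratios \<le> real (u + v) / real wdeg"
    and "a > 0 \<Longrightarrow> Inf ratios \<le> 1 / real a"
    and "b > 0 \<Longrightarrow> Inf ratios \<le> 1 / real b"
    and "c \<in> S \<Longrightarrow> m c > 0 \<Longrightarrow> Inf ratios \<le> 1 / real (m c)"
proof -
  have pe: "p ^ e > 0" for e using p_gt_1 by simp
  show "Inf ratios \<le> real (u + v) / real wdeg"
  proof (rule Inf_ratios_le_limit)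
    fix e
    define N where "N = (u + v) * (p ^ e - 1) div wdeg + 1"
    have "(u + v) * (p ^ e - 1) < wdeg * N"
      using assms by (simp add: N_def dividend_less_times_div)
    moreover have "real N \<le> real (u + v) / real wdeg * real (p ^ e) + 1"
    proof -
      have "real ((u + v) * (p ^ e - 1) div wdeg) \<le> real ((u + v) * (p ^ e - 1)) / real wdeg"
          by (rule of_nat_div_le_of_nat)
      also have "\<dots> \<le> real ((u + v) * p ^ e) / real wdeg"
        by (intro divide_right_mono) (simp_all only: of_nat_le_iff mult_le_mono2 diff_le_self of_nat_0_le_iff)
      finally show ?thesis by (simp add: N_def)
    qed
    ultimately show "\<exists>N. power_in_ideal (real (p ^ e)) (real N) \<and>
        real N \<le> real (u + v) / real wdeg * real (p ^ e) + 1"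
      by (intro exI[of _ N] conjI power_in_ideal_if_wdeg_gt pe)
  qed
  have *: "Inf ratios \<le> 1 / real n" 
    if "n > 0" "\<And>e N. n * N \<ge> p ^ e \<Longrightarrow> power_in_ideal (real (p ^ e)) (real N)" for n
  proof (rule Inf_ratios_le_limit)
    fix e
    define N where "N = nat \<lceil>real (p ^ e) / real n\<rceil>"
    have "real (p ^ e) / real n \<le> real N" unfolding N_def by (rule real_nat_ceiling_ge)
    hence "real (p ^ e) \<le> real N * real n" using \<open>n > 0\<close> by (simp only: pos_divide_le_eq of_nat_0_less_iff)
    hence "real (p ^ e) \<le> real (n * N)" by (simp only: of_nat_mult mult.commute)
    hence "p ^ e \<le> n * N" by (simp only: of_nat_le_iff)
    moreover have "0 \<le> real (p ^ e) / real n" by simp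
    hence "real N \<le> real (p ^ e) / real n + 1" unfolding N_def by linarith
    ultimately show "\<exists>N. power_in_ideal (real (p ^ e)) (real N) \<and> real N \<le> 1 / real n * real (p ^ e) + 1"
      by (intro exI[of _ N] conjI that(2)) simp_all
  qed
  show "Inf ratios \<le> 1 / real a" if "a > 0"
    by (rule *[OF that]) (rule power_in_ideal_if_axis, rule disjI1)
  show "Inf ratios \<le> 1 / real b" if "b > 0"
    by (rule *[OF that]) (rule power_in_ideal_if_axis, rule disjI2)
  show "Inf ratios \<le> 1 / real (m c)" if "c \<in> S" "m c > 0"
    by (rule *[OF that(2)]) (rule power_in_ideal_if_root[OF that(1)])
qed

end

section \<open>The denominator of the threshold\<close>

context weighted_form begin

lemma power_in_ideal_zero:
  assumes "q > 0"
  shows "\<not> power_in_ideal q 0"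
proof -
  have "rpow 0 = 1" by (simp add: rpow_def)
  thus ?thesis using assms weights_pos by (auto simp: power_in_ideal_def flanked_def not_le)
qed

text \<open>
  The hypothesis says \<open>N = (q - 1) * c\<close>.  Replacing \<open>c * q\<close> by \<open>N\<close> changes \<open>m l * x\<close> and the
  numerators \<open>q - a * x\<close> and \<open>q - b * x\<close> by \<open>m l * c\<close>, \<open>a * c\<close> and \<open>b * c\<close>, which lie in \<open>[0, 1)\<close>; the
  values at \<open>N\<close> are integers, so no rounding changes.
\<close>

lemma power_in_ideal_floor_exponent:
  assumes q: "real q * c = c + real N" and c: "0 \<le> c" "real a * c < 1" "real b * c < 1"
    "\<And>l. l \<in> S \<Longrightarrow> real (m l) * c < 1"
  shows "power_in_ideal (real q) (c * real q) \<longleftrightarrow> power_in_ideal (real q) (real N)"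
proof (rule power_in_ideal_cong)
  have cq: "c * real q = c + real N" using q by (simp add: mult.commute)
  fix l assume "l \<in> S"
  have "real (m l) * (c * real q) = real (m l) * c + of_int (int (m l * N))"
    by (simp add: cq algebra_simps)
  hence "\<lfloor>real (m l) * (c * real q)\<rfloor> = \<lfloor>real (m l) * c\<rfloor> + int (m l * N)"
    by (simp only: floor_add_int)
  also have "\<lfloor>real (m l) * c\<rfloor> = 0"
    using c(1) c(4)[OF \<open>l \<in> S\<close>] by (simp add: floor_eq_iff)
  also have "int (m l * N) = \<lfloor>real (m l) * real N\<rfloor>"
    by (metis floor_of_nat of_nat_mult)
  finally show "\<lfloor>real (m l) * (c * real q)\<rfloor> = \<lfloor>real (m l) * real N\<rfloor>" by simp
next
  have cq: "c * real q = c + real N" using q by (simp add: mult.commute)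
  have *: "\<lceil>(real q - real n * (c * real q)) / real w\<rceil> = \<lceil>(real q - real n * real N) / real w\<rceil>"
    if "w > 0" "real n * c < 1" for n w
  proof -
    have "real q - real n * (c * real q) = of_int (int q - int n * int N) - real n * c"
      by (simp add: cq algebra_simps)
    moreover have "real q - real n * real N = of_int (int q - int n * int N)" by simp
    ultimately show ?thesis
      using that c(1) by (simp only: ceiling_divide_diff mult_nonneg_nonneg of_nat_0_le_iff)
  qed
  show "\<lceil>(real q - real a * (c * real q)) / real v\<rceil> = \<lceil>(real q - real a * real N) / real v\<rceil>"
    "\<lceil>(real q - real b * (c * real q)) / real u\<rceil> = \<lceil>(real q - real b * real N) / real u\<rceil>"
    using * weights_pos c by auto
qed

context
  fixes c :: real
  assumes c_def: "c = Inf ratios"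
    and wdeg_pos: "wdeg > 0"
    and below_wdeg: "c * real wdeg < real (u + v)"
begin

lemma ratios_nonempty: "ratios \<noteq> {}"
proof -
  have "power_in_ideal (real (p ^ 0)) (real 1)"
    using power_in_ideal_if_wdeg_gt[of 1 1] wdeg_pos by simp
  thus ?thesis unfolding ratios_def by blast
qed

lemma Inf_ratios_nonneg: "c \<ge> 0"
  unfolding c_def by (rule cInf_greatest[OF ratios_nonempty ratios_nonneg])

text \<open>
  Between the threshold \<open>c\<close> and \<open>t < (u + v) / d\<close> the margin of the descent grows linearly with the level, so
  every ratio up to \<open>t\<close> descends to any sufficiently high level \<open>q\<close>.  There membership is continuous from the
  right and passes to the infimum.
\<close>

lemma eventually_power_in_ideal_Inf:
  "\<exists>e0. \<forall>e\<ge>e0. power_in_ideal (real p ^ e) (c * real p ^ e)"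
proof -
  have c_lt: "c < real (u + v) / real wdeg"
    using below_wdeg wdeg_pos by (simp add: pos_less_divide_eq)
  obtain t where t: "c < t" "t < real (u + v) / real wdeg" using dense[OF c_lt] by (elim exE conjE)
  define \<eta> where "\<eta> = real (u + v) - real wdeg * t"
  have \<eta>: "\<eta> > 0" using t(2) wdeg_pos by (simp add: \<eta>_def pos_less_divide_eq mult.commute)
  define K where "K = real (u * v * (2 * card S + 3))"
  have p1: "1 < real p" using p_gt_1 by simp
  obtain e0 where e0: "K / \<eta> < real p ^ e0" using real_arch_pow[OF p1] by blast
  have "power_in_ideal (real p ^ e) (c * real p ^ e)" if "e \<ge> e0" for e
  proof -
    define q where "q = real p ^ e"
    have q0: "q > 0" using p1 by (simp add: q_def)
    have "real p ^ e0 \<le> q" unfolding q_def using that p1 by (intro power_increasing) auto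
    hence "K / \<eta> \<le> q" using e0 by linarith
    hence K: "K \<le> \<eta> * q" using \<eta> by (simp add: pos_divide_le_eq mult.commute)
    have mem: "power_in_ideal q (\<tau> * q)" if \<tau>r: "\<tau> \<in> ratios" and \<tau>t: "\<tau> \<le> t" for \<tau>
    proof -
      obtain N e' where N: "\<tau> = real N / real (p ^ e')" "power_in_ideal (real (p ^ e')) (real N)"
        using \<tau>r unfolding ratios_def by blast
      have \<tau>0: "\<tau> \<ge> 0" by (rule ratios_nonneg[OF \<tau>r])
      have pe': "real p ^ e' > 0" using p1 by simp
      have N': "power_in_ideal (real p ^ e') (\<tau> * real p ^ e')" using N pe' by simp
      show ?thesis
      proof (cases "e' \<ge> e")
        case True
        then obtain k where k: "e' = k + e" by (metis le_add_diff_inverse2)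
        have "power_in_ideal (real p ^ k * q) (real p ^ k * (\<tau> * q))"
          using N' by (simp add: k q_def power_add mult_ac)
        moreover have "K \<le> real (u + v) * q - real wdeg * (\<tau> * q)"
        proof -
          have "real wdeg * \<tau> \<le> real wdeg * t" using \<tau>t by (intro mult_left_mono) auto
          hence "\<eta> * q \<le> (real (u + v) - real wdeg * \<tau>) * q"
            using q0 by (intro mult_right_mono) (auto simp: \<eta>_def)
          thus ?thesis using K by (simp add: algebra_simps)
        qed
        ultimately show ?thesis
          using power_in_ideal_descent_power \<tau>0 q0 unfolding K_def by simp
      next
        case False
        then obtain k where k: "e = k + e'" by (metis le_add_diff_inverse2 nle_le)
        from power_in_ideal_frobenius_power[OF N', of k] show ?thesis
          by (simp add: k q_def power_add mult_ac)
      qed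
    qed
    obtain x where x: "x > c * q" "\<And>x'. c * q < x' \<Longrightarrow> x' < x \<Longrightarrow> power_in_ideal q x' = power_in_ideal q (c * q)"
      using eventually_power_in_ideal_at_right[of q "c * q"] by (auto simp: eventually_at_right_field)
    have "c < min t (x / q)" using x(1) q0 t(1) by (simp add: pos_less_divide_eq)
    then obtain \<tau> where \<tau>: "\<tau> \<in> ratios" "\<tau> < min t (x / q)"
      unfolding c_def using cInf_lessD[OF ratios_nonempty] by blast
    have "c \<le> \<tau>" unfolding c_def by (rule Inf_ratios_le[OF \<tau>(1)])
    have "power_in_ideal q (\<tau> * q)" using mem \<tau> by simp
    show ?thesis
    proof (cases "c = \<tau>")
      case True
      thus ?thesis using \<open>power_in_ideal q (\<tau> * q)\<close> by (simp add: q_def)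
    next
      case False
      hence "c * q < \<tau> * q" using \<open>c \<le> \<tau>\<close> q0 by simp
      moreover have "\<tau> * q < x" using \<tau>(2) q0 by (simp add: pos_less_divide_eq)
      ultimately show ?thesis using x(2) \<open>power_in_ideal q (\<tau> * q)\<close> by (simp add: q_def)
    qed
  qed
  thus ?thesis by blast
qed

lemma Inf_ratios_pos: "c > 0"
proof -
  obtain e0 where "power_in_ideal (real p ^ e0) (c * real p ^ e0)"
    using eventually_power_in_ideal_Inf by blast
  moreover have "real p ^ e0 > 0" using p_gt_1 by simp
  ultimately show ?thesis using Inf_ratios_nonneg power_in_ideal_zero[of "real p ^ e0"] by (cases "c = 0") auto
qed

text \<open>
  Otherwise membership at \<open>c\<close> would persist for some smaller ratios with denominator a power of
  \<open>p\<close>.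
\<close>

lemma Inf_ratios_integrality:
  "\<exists>M e. (M = a \<or> M = b \<or> M \<in> m ` S) \<and> M > 0 \<and> real M * (c * real p ^ e) \<in> \<int>"
proof (rule ccontr)
  assume neg: "\<not> ?thesis"
  obtain e where mem: "power_in_ideal (real p ^ e) (c * real p ^ e)"
    using eventually_power_in_ideal_Inf by blast
  define q where "q = real p ^ e"
  have q0: "q > 0" using p_gt_1 by (simp add: q_def)
  have qZ: "q \<in> \<int>" by (simp add: q_def)
  have "eventually (\<lambda>x'. power_in_ideal q x' \<longleftrightarrow> power_in_ideal q (c * q)) (at_left (c * q))"
    using neg qZ by (intro eventually_power_in_ideal_at_left) (auto simp: q_def)
  then obtain x where x: "x < c * q" "\<And>x'. x < x' \<Longrightarrow> x' < c * q \<Longrightarrow> power_in_ideal q x' = power_in_ideal q (c * q)"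
    by (auto simp: eventually_at_left_field)
  define s where "s = max 0 (x / q)"
  have s: "0 \<le> s" "s < c" using x(1) q0 Inf_ratios_pos by (auto simp: s_def pos_divide_less_eq)
  have "1 < real p" using p_gt_1 by simp
  then obtain e' where e': "1 / (c - s) < real p ^ e'" using real_arch_pow by blast
  define Q where "Q = real p ^ e'"
  have Q0: "Q > 0" using p_gt_1 by (simp add: Q_def)
  have "1 < (c - s) * Q" using e' s by (simp add: Q_def pos_divide_less_eq mult.commute)
  hence *: "s * Q < c * Q - 1" by (simp add: algebra_simps)
  define N where "N = nat (\<lceil>c * Q\<rceil> - 1)"
  have "0 \<le> s * Q" using s Q0 by simp
  hence N: "real N < c * Q" "real N \<ge> c * Q - 1" using * unfolding N_def by linarith+
  define \<tau> where "\<tau> = real N / Q"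
  have \<tau>: "\<tau> < c" "s < \<tau>" using N * Q0 by (simp_all add: \<tau>_def pos_divide_less_eq pos_less_divide_eq)
  have "x < \<tau> * q" "\<tau> * q < c * q"
    using \<tau> q0 by (auto simp: s_def pos_divide_less_eq)
  hence "power_in_ideal q (\<tau> * q)" using x(2) mem by (simp add: q_def)
  hence "\<tau> \<in> ratios" by (rule ratiosI) (simp_all add: q_def \<tau>_def Q_def)
  thus False using Inf_ratios_le \<tau>(1) by (fastforce simp: c_def)
qed

theorem Inf_ratios_denominator:
  assumes c_small: "real a * c < 1" "real b * c < 1" "\<And>l. l \<in> S \<Longrightarrow> real (m l) * c < 1"
  shows "\<exists>k e M. e \<ge> 1 \<and> is_min_denominator c (k * p ^ e) \<and>
           (M = a \<or> M = b \<or> M \<in> m ` S) \<and> factor_of k M"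
proof -
  obtain M e0 where M: "M = a \<or> M = b \<or> M \<in> m ` S" "M > 0" "real M * (c * real p ^ e0) \<in> \<int>"
    using Inf_ratios_integrality by blast
  define Q where "Q = p ^ e0"
  have Q0: "Q > 0" using p_gt_1 by (simp add: Q_def)
  obtain z where z: "real M * (c * real p ^ e0) = of_int z" using M(3) by (elim Ints_cases)
  have c_eq: "c = of_int z / of_int (int (M * Q))"
    using z M(2) Q0 by (simp add: Q_def field_simps)
  define r :: rat where "r = of_int z / of_int (int (M * Q))"
  have r: "c = of_rat r" by (simp add: r_def c_eq of_rat_divide of_rat_mult)
  obtain n D where nD: "quotient_of r = (n, D)" by force
  have D0: "D > 0" using quotient_of_denom_pos[OF nD] .
  have cop: "coprime n D" using quotient_of_coprime[OF nD] .
  have "r = of_int n / of_int D" using quotient_of_div[OF nD] .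
  hence "c = of_rat (of_int n / of_int D)" using r by simp
  hence c_nD: "c = of_int n / of_int D" by (simp add: of_rat_divide)
  define d where "d = nat D"
  have d: "D = int d" "d > 0" using D0 by (auto simp: d_def)
  have cd: "c * real d = of_int n" using d by (simp add: c_nD)
  have n0: "n > 0" using Inf_ratios_pos cd d(2) by (metis mult_pos_pos of_nat_0_less_iff of_int_0_less_iff)
  have "real_of_int (n * int (M * Q)) = real_of_int (z * D)"
  proof -
    have "real_of_int z = c * real (M * Q)" using c_eq M(2) Q0 by simp
    thus ?thesis using cd d(1) by simp
  qed
  hence "n * int (M * Q) = z * D" by (simp only: of_int_eq_iff)
  hence "D dvd n * int (M * Q)" by simp
  hence "D dvd int (M * Q)" using cop by (simp add: coprime_commute coprime_dvd_mult_right_iff)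
  hence dMQ: "d dvd M * p ^ e0" unfolding d(1) Q_def by (simp only: int_dvd_int_iff)
  \<comment> \<open>If not, Euler's theorem provides arbitrarily large \<open>q = p ^ e\<close> with \<open>(q - 1) * c\<close> integral.\<close>
  have pd: "p dvd d"
  proof (rule ccontr)
    assume "\<not> p dvd d"
    hence "coprime p d" using p_prime by (simp add: prime_imp_coprime)
    hence "[p ^ totient d = 1] (mod d)" by (rule euler_theorem)
    obtain e1 where e1: "\<And>e. e \<ge> e1 \<Longrightarrow> power_in_ideal (real p ^ e) (c * real p ^ e)"
      using eventually_power_in_ideal_Inf by blast
    define e where "e = totient d * Suc e1"
    have tot: "totient d > 0" using d(2) by simp
    have "1 * Suc e1 \<le> totient d * Suc e1" using tot by (intro mult_le_mono1) linarith
    hence e: "e \<ge> e1" unfolding e_def mult_1 by (rule Suc_leD)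
    have "[(p ^ totient d) ^ Suc e1 = 1 ^ Suc e1] (mod d)"
      using \<open>[p ^ totient d = 1] (mod d)\<close> by (rule cong_pow)
    hence "[p ^ e = 1] (mod d)" by (simp only: e_def power_mult power_one)
    hence "d dvd p ^ e - 1" using p_gt_1 cong_altdef_nat[of 1 "p ^ e" d] by simp
    then obtain k where k: "p ^ e - 1 = d * k" by blast
    define N where "N = k * nat n"
    have "real (p ^ e) = real d * real k + 1"
    proof -
      have "p ^ e = d * k + 1" using k p_gt_1 by (simp flip: k)
      thus ?thesis by simp
    qed
    hence N: "real (p ^ e) * c = c + real N"
      using cd n0 by (simp add: N_def algebra_simps)
    have "power_in_ideal (real (p ^ e)) (real N)"
      using e1[OF e] power_in_ideal_floor_exponent[OF N] Inf_ratios_nonneg c_small by simp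
    hence "real N / real (p ^ e) \<in> ratios" unfolding ratios_def by blast
    hence "c \<le> real N / real (p ^ e)" unfolding c_def by (rule Inf_ratios_le)
    hence "c * real (p ^ e) \<le> real N" using p_gt_1 by (simp add: pos_le_divide_eq)
    thus False using N Inf_ratios_pos by (simp add: mult.commute)
  qed
  obtain k where k: "d = p ^ multiplicity p d * k" "\<not> p dvd k"
    using multiplicity_decompose'[of d p] d(2) p_prime by (metis not_prime_unit not_gr_zero)
  have "multiplicity p d \<ge> 1"
    using pd d(2) p_gt_1 by (intro multiplicity_geI) auto
  moreover have "is_min_denominator c (k * p ^ multiplicity p d)"
    unfolding is_min_denominator_def using r nD d(1) k(1) by (intro exI[of _ r]) (simp add: mult.commute)
  moreover have "k dvd M"
  proof -
    have "k dvd d" using k(1) by (metis dvd_triv_right)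
    hence "k dvd M * p ^ e0" using dMQ by (rule dvd_trans)
    moreover have "coprime k (p ^ e0)"
      using prime_imp_coprime[OF p_prime k(2)] by (simp add: coprime_commute)
    ultimately show ?thesis by (simp add: coprime_dvd_mult_left_iff)
  qed
  ultimately show ?thesis using M unfolding factor_of_def by blast
qed

end

end

section \<open>Comparison at a good prime\<close>

text \<open>
  The ideal is monomial, so membership can be read off the coefficients; in particular it does not
  change under field extension.
\<close>

lemma in_frobenius_ideal_iff:
  "in_frobenius_ideal q f \<longleftrightarrow> (\<forall>i j. coeff (coeff f j) i \<noteq> 0 \<longrightarrow> q \<le> i \<or> q \<le> j)"
  for f :: "'a::field poly poly"
proof -
  have X: "varX ^ q = ([:monom 1 q:] :: 'a poly poly)"
    using monomial_conv_monom[of "1 :: 'a" q 0] by (simp add: monom_0)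
  have Y: "varY ^ q = (monom 1 q :: 'a poly poly)"
    using monomial_conv_monom[of "1 :: 'a" 0 q] by simp
  show ?thesis
  proof
    assume "in_frobenius_ideal q f"
    then obtain A B where f: "f = A * varX ^ q + B * varY ^ q"
      by (auto simp: in_frobenius_ideal_def)
    show "\<forall>i j. coeff (coeff f j) i \<noteq> 0 \<longrightarrow> q \<le> i \<or> q \<le> j"
    proof (intro allI impI, rule ccontr)
      fix i j assume nz: "coeff (coeff f j) i \<noteq> 0" and "\<not> (q \<le> i \<or> q \<le> j)"
      thus False unfolding f X Y
        by (simp add: mult.commute[of A] mult.commute[of B] coeff_monom_mult)
    qed
  next
    assume *: "\<forall>i j. coeff (coeff f j) i \<noteq> 0 \<longrightarrow> q \<le> i \<or> q \<le> j"
    have "[:monom 1 q:] dvd poly_cutoff q f"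
      unfolding const_poly_dvd_iff monom_1_dvd_iff'
    proof (intro allI impI)
      fix j i assume "i < q"
      thus "coeff (coeff (poly_cutoff q f) j) i = 0"
        using *[rule_format, of j i]
        by (cases "coeff (coeff f j) i = 0") (auto simp: coeff_poly_cutoff)
    qed
    then obtain A where A: "poly_cutoff q f = [:monom 1 q:] * A" by (elim dvdE)
    have "f = poly_cutoff q f + poly_shift q f * monom 1 q"
      by (rule poly_eqI)
         (auto simp: coeff_poly_cutoff coeff_poly_shift coeff_monom_mult mult.commute[of _ "monom 1 q"])
    hence "f = A * varX ^ q + poly_shift q f * varY ^ q"
      by (simp only: A X Y mult.commute)
    thus "in_frobenius_ideal q f" unfolding in_frobenius_ideal_def by blast
  qed
qed

lemma coeff_map_poly2:
  "\<phi> 0 = 0 \<Longrightarrow> coeff (coeff (map_poly2 \<phi> f) j) i = \<phi> (coeff (coeff f j) i)"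
  by (simp add: map_poly2_def coeff_map_poly)

lemma over_closure_power: "over_closure (f ^ n) = over_closure f ^ n"
proof (induction n)
  case 0
  show ?case by (simp add: over_closure_def map_poly2_def)
next
  case (Suc n)
  have "over_closure (f * g) = over_closure f * over_closure g" for f g :: "'a poly poly"
    unfolding over_closure_def map_poly2_def
    by (simp add: map_poly_mult_hom map_poly_add_hom)
  with Suc show ?case by simp
qed

lemma in_frobenius_ideal_over_closure:
  "in_frobenius_ideal q (over_closure f) \<longleftrightarrow> in_frobenius_ideal q f"
  by (simp add: in_frobenius_ideal_iff over_closure_def coeff_map_poly2)

locale factored_form_char = factored_form u v a b c S m f + weighted_form u v a b p S m
  for u v a b p :: nat and c :: "'a::{alg_closed_field,field_gcd}" and S m f
begin

lemma in_frobenius_ideal_power_iff_power_in_ideal: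
  "in_frobenius_ideal q (f ^ N) \<longleftrightarrow> power_in_ideal (real q) (real N)"
proof -
  define n where "n = (\<Sum>l\<in>S. m l)"
  define P where "P = (\<Prod>l\<in>S. [:- l, 1:] ^ m l)"
  have degP: "degree P = n" using roots by (simp add: P_def n_def degree_prod_linear_powers)
  have rp: "rpow (real N) = P ^ N"
  proof -
    have "nat \<lfloor>real (m l) * real N\<rfloor> = m l * N" for l by (simp flip: of_nat_mult)
    thus ?thesis by (simp add: rpow_def P_def prod_power_distrib power_mult)
  qed
  have P0: "P \<noteq> 0" using rpow_nonzero(1)[of 1] by (auto simp: rpow_def P_def)
  have degPN: "degree (P ^ N) = n * N" using P0 by (simp add: degree_power_eq degP mult.commute)
  have "f ^ N = qhom u v a b n (smult c P) ^ N" using f_qhom by (simp add: n_def P_def)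
  also have "\<dots> = qhom u v (a * N) (b * N) (n * N) (smult c P ^ N)"
    by (rule qhom_power) (simp add: degP degree_smult_le[THEN order_trans])
  finally have fN: "f ^ N = qhom u v (a * N) (b * N) (n * N) (smult (c ^ N) (P ^ N))"
    by (simp add: smult_power)
  have ceil: "\<lceil>(real q - real k * real N) / real w\<rceil> \<le> int x \<longleftrightarrow> q \<le> k * N + w * x" if "w > 0" for k w x
  proof -
    have "\<lceil>(real q - real k * real N) / real w\<rceil> \<le> int x \<longleftrightarrow>
        real q - real k * real N \<le> real x * real w"
      using that by (simp add: ceiling_le_iff pos_divide_le_eq)
    also have "\<dots> \<longleftrightarrow> real q \<le> real (k * N + w * x)" by (simp add: algebra_simps)
    finally show ?thesis by (simp only: of_nat_le_iff)
  qed
  have "in_frobenius_ideal q (f ^ N) \<longleftrightarrow>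
      (\<forall>k\<le>n * N. coeff (P ^ N) k \<noteq> 0 \<longrightarrow> q \<le> a * N + v * (n * N - k) \<or> q \<le> b * N + u * k)"
    (is "?L \<longleftrightarrow> ?R")
  proof
    assume L: ?L
    show ?R
    proof (intro allI impI)
      fix k assume k: "k \<le> n * N" "coeff (P ^ N) k \<noteq> 0"
      have "coeff (coeff (f ^ N) (b * N + u * k)) (a * N + v * (n * N - k)) = c ^ N * coeff (P ^ N) k"
        unfolding fN coeff_qhom[OF pos(1)] using k(1) pos(1) by auto
      hence "coeff (coeff (f ^ N) (b * N + u * k)) (a * N + v * (n * N - k)) \<noteq> 0"
        using k(2) c_nonzero by simp
      thus "q \<le> a * N + v * (n * N - k) \<or> q \<le> b * N + u * k"
        using L unfolding in_frobenius_ideal_iff by blast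
    qed
  next
    assume R: ?R
    show ?L unfolding in_frobenius_ideal_iff
    proof (intro allI impI)
      fix i j assume nz: "coeff (coeff (f ^ N) j) i \<noteq> 0"
      then obtain k where k: "k \<le> n * N" "j = b * N + u * k" "i = a * N + v * (n * N - k)"
        unfolding fN coeff_qhom[OF pos(1)] by (auto split: if_splits)
      have "coeff (P ^ N) k \<noteq> 0"
        using nz k pos(1) unfolding fN coeff_qhom[OF pos(1)] by (auto split: if_splits)
      thus "q \<le> i \<or> q \<le> j" using R k by blast
    qed
  qed
  also have "\<dots> \<longleftrightarrow> power_in_ideal (real q) (real N)"
  proof -
    have *: "coeff (P ^ N) k \<noteq> 0 \<Longrightarrow> k \<le> n * N" for k using le_degree degPN by metis
    have "power_in_ideal (real q) (real N) \<longleftrightarrow>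
       (\<forall>k. coeff (P ^ N) k \<noteq> 0 \<longrightarrow> q \<le> b * N + u * k \<or> q \<le> a * N + v * (n * N - k))"
      unfolding power_in_ideal_def flanked_def rp degPN
      using ceil[OF pos(1), of b] ceil[OF pos(2), of a] *
      by (metis of_nat_diff)
    thus ?thesis using * by blast
  qed
  finally show ?thesis .
qed

end

lemma fpt_eq_Inf_ratios:
  fixes f :: "'a::field poly poly"
  assumes "factored_form_char u v a b p c S m (over_closure f)"
  shows "fpt f = Inf (weighted_form.ratios u v a b p S m)"
proof -
  interpret factored_form_char u v a b p c S m "over_closure f" by (rule assms)
  have "in_frobenius_ideal q (f ^ N) \<longleftrightarrow> power_in_ideal (real q) (real N)" for q N
    using in_frobenius_ideal_power_iff_power_in_ideal[of q N]
    by (simp add: in_frobenius_ideal_over_closure flip: over_closure_power)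
  thus ?thesis unfolding fpt_def ratios_def using p_eq by simp
qed

lemma quasi_homogeneous_map_poly2:
  assumes "quasi_homogeneous u v f" "\<phi> 0 = 0" "map_poly2 \<phi> f \<noteq> 0"
  shows "quasi_homogeneous u v (map_poly2 \<phi> f)"
proof -
  obtain d where "\<And>i j. coeff (coeff f j) i \<noteq> 0 \<Longrightarrow> u * i + v * j = d"
    using assms(1) by (auto simp: quasi_homogeneous_def)
  hence "\<And>i j. coeff (coeff (map_poly2 \<phi> f) j) i \<noteq> 0 \<Longrightarrow> u * i + v * j = d"
    using assms(2) by (metis coeff_map_poly2)
  thus ?thesis using assms(3) unfolding quasi_homogeneous_def by blast
qed

lemma is_factorization_nonzero:
  assumes "is_factorization f c hms"
  shows "f \<noteq> 0"
proof
  assume "f = 0"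
  hence "const2 c * (\<Prod>(h, m)\<leftarrow>hms. h ^ m) = 0" "const2 c \<noteq> 0"
    using assms unfolding is_factorization_def by simp_all
  hence "0 \<in> set (map (\<lambda>(h, m). h ^ m) hms)" by (simp only: mult_eq_0_iff prod_list_zero_iff) blast
  then obtain h m where "(h, m) \<in> set hms" "h = 0" by auto
  hence "irreducible (0 :: 'a poly poly)" using assms by (auto simp: is_factorization_def)
  thus False by simp
qed

text \<open>
  The factors \<open>X\<close> and \<open>Y\<close> contribute the same exponents on both sides and can be cancelled.
\<close>

lemma similar_factorizations_exponents:
  fixes f :: "'a::{alg_closed_field,field_gcd} poly poly" and g :: "'b::{alg_closed_field,field_gcd} poly poly"
  assumes f: "factored_form u v a b c S m f" and g: "factored_form u' v' a b c' S' m' g"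
    and sim: "similar_factorizations f g"
  shows "image_mset m (mset_set S) = image_mset m' (mset_set S')"
proof -
  obtain d d' hms hms' where "is_factorization f d hms" "is_factorization g d' hms'"
    "map snd hms = map snd hms'"
    using sim unfolding similar_factorizations_def by blast
  thus ?thesis
    using factored_form.exponents_multiset[OF f] factored_form.exponents_multiset[OF g]
    by (metis add_left_cancel)
qed

theorem theorem8p2:
  fixes u v p :: nat
    and g0 :: "rat poly poly"
    and gp :: "'p::prime_card mod_ring poly poly"
  assumes "u * v \<noteq> 0"
    and "quasi_homogeneous u v g0"
    and "\<nexists>c. g0 = const2 c"
    and "p = CARD('p)"
    and "good_prime TYPE('p) g0"
    and "gp = reduction g0"
    and "fpt gp \<noteq> lct (over_C g0)"
  shows "\<exists>k e. e \<ge> 1 \<and> is_min_denominator (fpt gp) (k * p ^ e) \<and>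
           (factor_of k (multiplicity varX (over_C g0) * u) \<or>
            factor_of k (multiplicity varY (over_C g0) * v) \<or>
            (\<exists>h. irreducible h \<and> h dvd over_C g0 \<and>
                 \<not> h dvd varX \<and> \<not> h dvd varY \<and>
                 factor_of k (multiplicity h (over_C g0))))"
proof -
  define w where "w = gcd u v"
  have uv: "u > 0" "v > 0" using assms(1) by auto
  hence w: "w > 0" by (simp add: w_def)
  obtain u' v' where uv': "u = w * u'" "v = w * v'" "coprime u' v'"
    using gcd_coprime_exists[of u v] w unfolding w_def by (auto simp: mult.commute)
  have pos': "u' > 0" "v' > 0" using uv uv' by auto
  define gC where "gC = over_C g0"
  define gK where "gK = over_closure gp"
  have good: "similar_factorizations gC gK" "multiplicity varX gK = multiplicity varX gC"
    "multiplicity varY gK = multiplicity varY gC"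
    using assms(5) unfolding good_prime_def Let_def gC_def gK_def assms(6) by auto
  obtain d d' hms hms' where fac: "is_factorization gC d hms" "is_factorization gK d' hms'"
    using good(1) unfolding similar_factorizations_def by blast
  have qhC: "quasi_homogeneous u v gC"
    using quasi_homogeneous_map_poly2[OF assms(2), of of_rat] is_factorization_nonzero[OF fac(1)]
    by (simp add: gC_def over_C_def)
  have "gp \<noteq> 0" using is_factorization_nonzero[OF fac(2)] by (auto simp: gK_def over_closure_def map_poly2_def)
  hence "quasi_homogeneous u v gp"
    using quasi_homogeneous_map_poly2[OF assms(2), of "reduce_rat :: rat \<Rightarrow> 'p mod_ring"]
    by (simp add: assms(6) reduction_def reduce_rat_def)
  hence qhK: "quasi_homogeneous u v gK"
    using quasi_homogeneous_map_poly2[of u v gp to_ac] is_factorization_nonzero[OF fac(2)]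
    by (simp add: gK_def over_closure_def)
  obtain a b c S m where C: "factored_form u' v' a b c S m gC"
    using quasi_homogeneous_factored[OF qhC[unfolded uv'(1,2)] uv'(3) pos' w] .
  obtain a' b' c' S' m' where K: "factored_form u' v' a' b' c' S' m' gK"
    using quasi_homogeneous_factored[OF qhK[unfolded uv'(1,2)] uv'(3) pos' w] .
  have multC: "multiplicity varX gC = a" "multiplicity varY gC = b"
    using factored_form.multiplicities(1,2)[OF C] by auto
  have ab: "a' = a" "b' = b"
    using factored_form.multiplicities(1,2)[OF K] multC good(2,3) by auto
  note K = K[unfolded ab]
  have ms: "image_mset m (mset_set S) = image_mset m' (mset_set S')"
    by (rule similar_factorizations_exponents[OF C K good(1)])
  have sums: "(\<Sum>l\<in>S. m l) = (\<Sum>l\<in>S'. m' l)"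
    using arg_cong[OF ms, of sum_mset] by (simp add: sum_unfold_sum_mset)
  have finS: "finite S" "finite S'" using C K by (auto simp: factored_form_def)
  have imgs: "m ` S = m' ` S'"
    using arg_cong[OF ms, of set_mset] finS by simp
  define wd where "wd = u' * a + v' * b + u' * v' * (\<Sum>l\<in>S. m l)"
  interpret C: complex_form u' v' a b c S m gC "\<Sum>l\<in>S. m l" wd
    using C by (simp add: complex_form_def complex_form_axioms_def wd_def)
  have p: "p = CHAR('p mod_ring alg_closure)" "prime p"
    using assms(4) prime_card[where ?'a = 'p] by simp_all
  have W: "weighted_form u' v' p S'"
    using p pos' K by (simp add: weighted_form_def factored_form_def)
  interpret W: weighted_form u' v' a b p S' m' by (rule W)
  have "factored_form_char u' v' a b p c' S' m' gK"
    using K W by (simp add: factored_form_char_def)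
  hence fpt: "fpt gp = Inf W.ratios"
    unfolding gK_def by (rule fpt_eq_Inf_ratios)
  have wdeg: "W.wdeg = wd" by (simp add: W.wdeg_def wd_def sums)
  have wd0: "wd > 0"
  proof (rule ccontr)
    assume "\<not> wd > 0"
    hence "a = 0" "b = 0" "S = {}"
      using pos' finS C.m_pos by (auto simp: wd_def)
    hence gC: "gC = const2 c" using C.f_eq by simp
    have "coeff (coeff g0 j) i = 0" if "i \<noteq> 0 \<or> j \<noteq> 0" for i j
    proof -
      have "of_rat (coeff (coeff g0 j) i) = coeff (coeff gC j) i"
        by (simp add: gC_def over_C_def coeff_map_poly2)
      also have "\<dots> = 0" using that by (auto simp: gC const2_def coeff_pCons split: nat.splits)
      finally show ?thesis by simp
    qed
    hence "g0 = const2 (coeff (coeff g0 0) 0)"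
      by (intro poly_eqI) (auto simp: const2_def coeff_pCons split: nat.splits)
    thus False using assms(3) by blast
  qed
  define x where "x = fpt gp"
  have x: "x = Inf W.ratios" by (simp add: x_def fpt)
  have "C.admissible x"
    unfolding C.admissible_def
  proof (intro conjI ballI)
    show "x * real a \<le> 1" "x * real b \<le> 1"
      using W.Inf_ratios_upper_bounds(2,3) wd0 wdeg unfolding x
      by (cases "a = 0"; cases "b = 0"; simp add: pos_le_divide_eq)+
    show "x * real wd \<le> real (u' + v')"
      using W.Inf_ratios_upper_bounds(1) wd0 wdeg unfolding x by (simp add: pos_le_divide_eq)
    fix l assume l: "l \<in> S"
    then obtain l' where l': "l' \<in> S'" "m l = m' l'" using imgs by (metis imageE imageI)
    show "x * real (m l) \<le> 1"
      using W.Inf_ratios_upper_bounds(4)[OF _ l'(1)] wd0 wdeg C.m_pos[OF l] l'(2)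
      unfolding x by (simp add: pos_le_divide_eq)
  qed
  hence "x \<le> lct gC" by (rule C.lct_greatest_admissible(2)[OF wd0])
  hence lt: "x < lct gC" using assms(7) by (simp add: x_def gC_def)
  have adm: "C.admissible (lct gC)" by (rule C.lct_greatest_admissible(1)[OF wd0])
  have strict: "x * real n < real n'" if "lct gC * real n \<le> real n'" "n' > 0" for n n'
  proof (cases "n = 0")
    case False
    hence "x * real n < lct gC * real n" using lt by simp
    thus ?thesis using that(1) by simp
  qed (use that in simp)
  have "x * real a < 1" "x * real b < 1" "x * real wd < real (u' + v')"
    "\<And>l. l \<in> S \<Longrightarrow> x * real (m l) < 1"
    using adm strict[of a 1] strict[of b 1] strict[of wd "u' + v'"] strict[of "m _" 1] pos'
    unfolding C.admissible_def by auto
  moreover from this(4) have "real (m' l) * x < 1" if "l \<in> S'" for l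
    using imgs that by (metis imageE imageI mult.commute)
  ultimately obtain k e M where kM: "e \<ge> 1" "is_min_denominator x (k * p ^ e)"
    "M = a \<or> M = b \<or> M \<in> m' ` S'" "factor_of k M"
    using W.Inf_ratios_denominator[OF x] wd0 wdeg by (metis mult.commute)
  have "factor_of k (a * u) \<or> factor_of k (b * v) \<or>
      (\<exists>h. irreducible h \<and> h dvd gC \<and> \<not> h dvd varX \<and> \<not> h dvd varY \<and> factor_of k (multiplicity h gC))"
    using kM(3)
  proof (elim disjE)
    assume "M \<in> m' ` S'"
    then obtain l where l: "l \<in> S" "M = m l" unfolding imgs[symmetric] by blast
    hence pd: "qbinom u' v' l \<in> C.prime_divisors" by (simp add: C.prime_divisors_def)
    have "irreducible (qbinom u' v' l)"
      by (rule Factorial_Ring.prime_elem_imp_irreducible[OF C.prime_divisors_prime[OF pd]])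
    moreover have "factor_of k (multiplicity (qbinom u' v' l) gC)"
      using kM(4) l C.multiplicities(3)[OF l(1)] by simp
    ultimately show ?thesis
      using C.prime_divisors_dvd[OF pd] C.not_dvd(3,4)[OF l(1)] by blast
  qed (use kM(4) uv in \<open>auto simp: factor_of_def\<close>)
  thus ?thesis
    using kM(1,2) multC unfolding x_def gC_def by blast
qed

end
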